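(* Let $d\geq 2$, $\tau_0,\ldots,\tau_d>0$ and $s=\tau_0^2+\ldots+\tau_d^2$. Let $v_0,\ldots,v_d\in\mathbb{R}^d$ be in orthocentric position with parameters $\tau_0,\ldots,\tau_d$, and let $Q=[v_0,\ldots,v_d]$ be their convex hull. Let $\kappa\neq 0$ be real with $Q\subseteq\bar{\mathbb{B}}^d(\kappa)$. Then $$\mathrm{Vol}_{d,\kappa}(Q)=\frac{\omega_{d+1}}{\sqrt{\kappa}^{\,d}}\,\frac{1}{\sqrt{2\pi}}\int_0^{(1-i)\infty}\Big(\prod_{j=0}^d\Phi\Big(\frac{\tau_j}{s}\sqrt{\kappa-s}\,x\Big)+\prod_{j=0}^d\Phi\Big(-\frac{\tau_j}{s}\sqrt{\kappa-s}\,x\Big)\Big)e^{-x^2/2}\,dx,$$ where the convention $\sqrt{-r}=i\sqrt r$ for $r\geq0$ is used for all square roots of negative numbers (including $\sqrt{\kappa}$ when $\kappa<0$); in particular the improper integral converges. The formula remains valid if $\int_0^{(1-i)\infty}$ is replaced by $\int_0^{(1+i)\infty}$ and simultaneously the convention is changed to $\sqrt{-r}=-i\sqrt r$ for $r\geq 0$.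
   Context: $\Phi:\mathbb{C}\to\mathbb{C}$, $\Phi(z)=\frac12+\frac{1}{\sqrt{2\pi}}\int_0^z e^{-x^2/2}\,dx$ (an entire function; the integral is along any path from $0$ to $z$). For $\omega\in\mathbb{C}\setminus\{0\}$ and $f$ entire, $\int_0^{\omega\infty}f(x)\,dx:=\lim_{B\to+\infty}\int_0^B f(\omega y)\,\omega\,dy$ whenever the limit exists. $\omega_{d+1}=2\pi^{(d+1)/2}/\Gamma((d+1)/2)$ is the surface area of the unit sphere $\mathbb{S}^d\subset\mathbb{R}^{d+1}$. Klein model: for $\kappa\ge0$, $\mathbb{B}^d(\kappa)=\bar{\mathbb{B}}^d(\kappa)=\mathbb{R}^d$; for $\kappa<0$, $\mathbb{B}^d(\kappa)=\{x\in\mathbb{R}^d:\|x\|<1/\sqrt{-\kappa}\}$ and $\bar{\mathbb{B}}^d(\kappa)=\{x:\|x\|\le 1/\sqrt{-\kappa}\}$. It carries the Riemannian metric $ds^2=\frac{(1+\kappa\|u\|^2)\|du\|^2-\kappa\langle u,du\rangle^2}{(1+\kappa\|u\|^2)^2}$ of constant curvature $\kappa$ (spherical for $\kappa>0$, hyperbolic for $\kappa<0$), and the volume of a Borel set $A\subseteq\bar{\mathbb{B}}^d(\kappa)$ is $\mathrm{Vol}_{d,\kappa}(A)=\int_A(1+\kappa\|y\|^2)^{-(d+1)/2}\,dy$. Orthocentric position: given $\tau_0,\ldots,\tau_d>0$ and $s=\sum_j\tau_j^2$, vectors $v_0,\ldots,v_d\in\mathbb{R}^d$ are in orthocentric position with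 parameters $\tau_0,\ldots,\tau_d$ if $\langle v_j,v_k\rangle=-1/s$ for $j\ne k$ and $\|v_j\|^2=-1/s+1/\tau_j^2$ for all $j$. *)

theory Defs
  imports "HOL-Complex_Analysis.Complex_Analysis"
begin

definition Phi :: "complex \<Rightarrow> complex" where
  "Phi z = 1/2 + (1 / complex_of_real (sqrt (2*pi))) *
     contour_integral (linepath 0 z) (\<lambda>x. exp (- (x^2) / 2))"

definition ray_integral_conv :: "complex \<Rightarrow> (complex \<Rightarrow> complex) \<Rightarrow> complex \<Rightarrow> bool" where
  "ray_integral_conv \<omega> f L \<longleftrightarrow>
     ((\<lambda>B::real. integral {0..B} (\<lambda>y::real. f (\<omega> * complex_of_real y) * \<omega>)) \<longlongrightarrow> L) at_top"

definition sqrt_plus :: "real \<Rightarrow> complex" where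
  "sqrt_plus r = (if r \<ge> 0 then complex_of_real (sqrt r) else \<i> * complex_of_real (sqrt (- r)))"

definition sqrt_minus :: "real \<Rightarrow> complex" where
  "sqrt_minus r = (if r \<ge> 0 then complex_of_real (sqrt r) else - \<i> * complex_of_real (sqrt (- r)))"

definition sphere_area :: "nat \<Rightarrow> real" where
  "sphere_area n = 2 * pi powr (real n / 2) / Gamma (real n / 2)"

definition klein_cball :: "real \<Rightarrow> ('a::euclidean_space) set" where
  "klein_cball \<kappa> = (if \<kappa> \<ge> 0 then UNIV else cball 0 (1 / sqrt (- \<kappa>)))"

definition klein_density :: "real \<Rightarrow> 'a::euclidean_space \<Rightarrow> real" where
  "klein_density \<kappa> y = (1 + \<kappa> * norm y ^ 2) powr (- (real DIM('a) + 1) / 2)"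

definition klein_vol :: "real \<Rightarrow> ('a::euclidean_space) set \<Rightarrow> real" where
  "klein_vol \<kappa> A = (LINT y:A|lborel. klein_density \<kappa> y)"

definition orthocentric :: "nat \<Rightarrow> (nat \<Rightarrow> real) \<Rightarrow> (nat \<Rightarrow> 'a::real_inner) \<Rightarrow> bool" where
  "orthocentric d \<tau> v \<longleftrightarrow>
     (let s = (\<Sum>j\<le>d. (\<tau> j)^2) in
       (\<forall>j\<le>d. \<forall>k\<le>d. j \<noteq> k \<longrightarrow> inner (v j) (v k) = - 1 / s) \<and>
       (\<forall>j\<le>d. (norm (v j))^2 = - 1 / s + 1 / (\<tau> j)^2))"

definition orth_integrand ::
    "(real \<Rightarrow> complex) \<Rightarrow> nat \<Rightarrow> (nat \<Rightarrow> real) \<Rightarrow> real \<Rightarrow> complex \<Rightarrow> complex" where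
  "orth_integrand sq d \<tau> \<kappa> x =
     (let s = (\<Sum>j\<le>d. (\<tau> j)^2) in
       ((\<Prod>j\<le>d. Phi (complex_of_real (\<tau> j / s) * sq (\<kappa> - s) * x)) +
        (\<Prod>j\<le>d. Phi (- complex_of_real (\<tau> j / s) * sq (\<kappa> - s) * x))) * exp (- (x^2) / 2))"

end

theory Submission
  imports Defs "HOL-Probability.Probability" "HOL-Real_Asymp.Real_Asymp"
begin

text \<open>Writing the density as a Gamma integral \<open>\<integral> r\<^sup>d exp (- r\<^sup>2 (1 + \<kappa> |y|\<^sup>2) / 2) dr\<close> turns the volume into a Gaussian
  integral over the cone spanned by the vectors \<open>(1, v\<^sub>j)\<close>. In the coordinates \<open>\<lambda>\<^sub>j\<close> of this cone, orthocentricity makes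
  the quadratic form a diagonal one plus a multiple of \<open>(\<Sum> \<lambda>\<^sub>j)\<^sup>2\<close>; linearising the exponential of the latter square by
  a further Gaussian integral in \<open>u\<close> decouples the \<open>\<lambda>\<^sub>j\<close>, and each of them contributes one factor \<open>\<Phi>\<close>. All this is
  absolutely convergent for \<open>P + K |y|\<^sup>2\<close> in place of \<open>1 + \<kappa> |y|\<^sup>2\<close>, where \<open>P\<close> and \<open>K\<close> are suitable complex numbers of
  positive real part. Letting them tend to \<open>\<i> \<sigma>\<close> and \<open>\<i> \<sigma> \<kappa>\<close> with \<open>\<sigma> = 1\<close> or \<open>\<sigma> = - 1\<close> moves the \<open>u\<close>-integral onto the ray
  through \<open>1 - \<i>\<close>. There it converges only conditionally, but uniformly along the limit: expand the products of
  \<open>\<Phi> = 1 - \<psi>\<close> and integrate the terms with at most one factor \<open>\<psi>\<close> by parts. The second formula is the complex conjugate of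
  the first.\<close>

section \<open>Gaussian integrals and the function Phi\<close>

text \<open>For \<kappa> < 0 the choice P = 1, K = \<kappa> is impossible, since the Gaussians in
  the cone coordinates would grow. After multiplication by \<i> \<sigma> both coefficients are
  purely imaginary whatever the sign of \<kappa>, hence limits of numbers with positive real part.
  The sign \<sigma> is forced by Fubini. Write K = k^2 and P = k^2 / s - a^2, so that exp (a^2 T^2 /
  2) with T the coefficient sum has to be linearised, and turn the u-line by q. Absolute convergence
  asks for s Re (a q)^2 < Re (k^2) Re (q^2), whose right side tends to 0; so a q must become purely
  imaginary. The ray x = (1 - \<i>) u prescribes the remaining exponent q^2 - s \<zeta>^2 = - 2 \<i>
  with \<zeta> = a q / k and \<zeta>^2 = - 2 \<i> (\<kappa> - s) / s^2, whence q^2 = - 2 \<i>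
  \<kappa> / s in the limit. As a^2 tends to \<i> \<sigma> (\<kappa> - s) / s, the limit of (a q)^2
  is 2 \<sigma> \<kappa> (\<kappa> - s) / s^2, and this must not be positive: \<sigma> = - 1 for
  \<kappa> > s and for \<kappa> < 0, \<sigma> = 1 for 0 < \<kappa> < s. At \<kappa> = s the
  parameter a vanishes and u decouples.\<close>

lemma integrable_exp_neg_square:
  assumes "(a::real) > 0"
  shows "integrable lborel (\<lambda>t. exp (- (a * t\<^sup>2)))"
proof -
  define \<sigma> where "\<sigma> = 1 / sqrt (2 * a)"
  have s: "\<sigma> > 0" "\<sigma>\<^sup>2 = 1 / (2 * a)" using assms by (auto simp: \<sigma>_def power_divide)
  have "integrable lborel (\<lambda>x. sqrt (2 * pi * \<sigma>\<^sup>2) * normal_density 0 \<sigma> x)"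
    using integrable_normal_density[OF s(1)] by simp
  also have "(\<lambda>x. sqrt (2 * pi * \<sigma>\<^sup>2) * normal_density 0 \<sigma> x) = (\<lambda>x. exp (- (a * x\<^sup>2)))"
    using s assms by (auto simp: normal_density_def fun_eq_iff field_simps)
  finally show ?thesis .
qed

text \<open>Completing the square in such a way that half of the quadratic decay survives: the
  linear term then costs only a constant factor in a Gaussian majorant.\<close>

lemma linear_minus_square_le:
  assumes "(a::real) > 0"
  shows "b * t - a * t\<^sup>2 \<le> b\<^sup>2 / (2 * a) - a / 2 * t\<^sup>2"
proof -
  have "0 \<le> (a * t - b)\<^sup>2 / (2 * a)" using assms by simp
  also have "\<dots> = b\<^sup>2 / (2 * a) - a / 2 * t\<^sup>2 - (b * t - a * t\<^sup>2)"
    using assms by (simp add: power2_eq_square field_simps)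
  finally show ?thesis by simp
qed

lemma integrable_exp_linear_square:
  assumes "Re (k\<^sup>2) > 0"
  shows "integrable lborel (\<lambda>t::real. exp (b * of_real t - k\<^sup>2 * (of_real t)\<^sup>2 / 2))"
proof (rule Bochner_Integration.integrable_bound)
  let ?a = "Re (k\<^sup>2) / 2"
  show "integrable lborel (\<lambda>t. exp ((Re b)\<^sup>2 / (2 * ?a)) * exp (- (?a / 2 * t\<^sup>2)))"
    by (intro integrable_mult_right integrable_exp_neg_square) (use assms in auto)
  show "AE t in lborel. norm (exp (b * of_real t - k\<^sup>2 * (of_real t)\<^sup>2 / 2))
      \<le> norm (exp ((Re b)\<^sup>2 / (2 * ?a)) * exp (- (?a / 2 * t\<^sup>2)))"
  proof (rule AE_I2)
    fix t :: real
    have "Re (b * of_real t - k\<^sup>2 * (of_real t)\<^sup>2 / 2) = Re b * t - ?a * t\<^sup>2"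
      by (simp flip: of_real_power)
    also have "\<dots> \<le> (Re b)\<^sup>2 / (2 * ?a) - ?a / 2 * t\<^sup>2"
      by (rule linear_minus_square_le) (use assms in auto)
    finally show "norm (exp (b * of_real t - k\<^sup>2 * (of_real t)\<^sup>2 / 2))
      \<le> norm (exp ((Re b)\<^sup>2 / (2 * ?a)) * exp (- (?a / 2 * t\<^sup>2)))"
      unfolding norm_exp_eq_Re norm_mult exp_add[symmetric] by (simp add: exp_add[symmetric])
  qed
qed measurable

text \<open>\<open>Phi\<close> integrates along a segment that moves with z. On the convex set
  \<open>UNIV\<close> the integrand has a global primitive, and the segment integral is a difference
  of two of its values.\<close>

lemma Phi_has_field_derivative [derivative_intros]:
  "(Phi has_field_derivative exp (- (z\<^sup>2) / 2) / of_real (sqrt (2 * pi))) (at z)"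
proof -
  obtain g :: "complex \<Rightarrow> complex" where g: "\<And>x. x \<in> UNIV \<Longrightarrow> (g has_field_derivative exp (- (x\<^sup>2) / 2)) (at x within UNIV)"
    by (rule holomorphic_convex_primitive'[of UNIV "\<lambda>x. exp (- (x\<^sup>2) / 2)"]) (auto intro!: holomorphic_intros)
  have eq: "Phi = (\<lambda>z. 1/2 + (1 / complex_of_real (sqrt (2*pi))) * (g z - g 0))"
  proof
    fix z
    have "((\<lambda>x. exp (- (x\<^sup>2) / 2)) has_contour_integral (g (pathfinish (linepath 0 z)) - g (pathstart (linepath 0 z)))) (linepath 0 z)"
      by (rule contour_integral_primitive[of UNIV]) (use g in \<open>auto simp del: linepath_0\<close>)
    then show "Phi z = 1/2 + (1 / complex_of_real (sqrt (2*pi))) * (g z - g 0)"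
      unfolding Phi_def by (simp add: contour_integral_unique)
  qed
  show ?thesis unfolding eq using g[of z] by (auto intro!: derivative_eq_intros)
qed

lemma Phi_0 [simp]: "Phi 0 = 1 / 2"
  by (simp add: Phi_def)

lemma Phi_compose_derivative [derivative_intros]:
  "(f has_field_derivative f') (at z within S) \<Longrightarrow>
   ((\<lambda>z. Phi (f z)) has_field_derivative exp (- ((f z)\<^sup>2) / 2) / of_real (sqrt (2 * pi)) * f') (at z within S)"
  by (rule DERIV_chain2[OF Phi_has_field_derivative])

lemma holomorphic_on_Phi: "Phi holomorphic_on S"
  unfolding holomorphic_on_def field_differentiable_def
  using has_field_derivative_at_within[OF Phi_has_field_derivative] by blast

lemma continuous_on_Phi [continuous_intros]:
  "continuous_on S f \<Longrightarrow> continuous_on S (\<lambda>x. Phi (f x))"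
  by (rule continuous_on_compose2[OF holomorphic_on_imp_continuous_on[OF holomorphic_on_Phi[of UNIV]]]) auto

lemma Phi_minus: "Phi (- z) = 1 - Phi z"
proof -
  have "((\<lambda>z. Phi z + Phi (- z)) has_field_derivative 0) (at x within UNIV)" for x
    by (auto intro!: derivative_eq_intros)
  from has_field_derivative_zero_constant[OF convex_UNIV this]
  obtain c where c: "\<And>x. x \<in> UNIV \<Longrightarrow> Phi x + Phi (- x) = c" by blast
  have "c = 1" using c[of 0] by simp
  with c[of z] show ?thesis by (simp add: eq_diff_eq add.commute)
qed

lemma Phi_cnj: "Phi (cnj z) = cnj (Phi z)"
proof -
  have "((\<lambda>z. Phi z - cnj (Phi (cnj z))) has_field_derivative 0) (at x within UNIV)" for x
  proof -
    have "((cnj \<circ> Phi \<circ> cnj) has_field_derivative cnj (exp (- ((cnj x)\<^sup>2) / 2) / of_real (sqrt (2 * pi)))) (at x)"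
      using Phi_has_field_derivative[of "cnj x"] by (intro has_field_derivative_cnj_cnj) auto
    then show ?thesis by (auto intro!: derivative_eq_intros simp: o_def exp_cnj)
  qed
  from has_field_derivative_zero_constant[OF convex_UNIV this]
  obtain c where c: "\<And>x. x \<in> UNIV \<Longrightarrow> Phi x - cnj (Phi (cnj x)) = c" by blast
  from c[of 0] c[of z] show ?thesis by (simp add: complex_eq_iff)
qed

text \<open>Completing the square, b t - k^2 t^2 / 2 = b^2 / (2 k^2) - (k t - b / k)^2 / 2, makes
  \<open>F\<close> below a primitive.\<close>

lemma has_integral_Phi_line:
  assumes "k \<noteq> 0" "0 \<le> N"
  shows "((\<lambda>t. exp (b * of_real t - k\<^sup>2 * (of_real t)\<^sup>2 / 2)) has_integral
    of_real (sqrt (2 * pi)) / k * exp (b\<^sup>2 / (2 * k\<^sup>2)) * (Phi (k * of_real N - b / k) - Phi (- b / k))) {0..N}"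
proof -
  define F where "F = (\<lambda>t::real. of_real (sqrt (2 * pi)) / k * exp (b\<^sup>2 / (2 * k\<^sup>2)) * Phi (k * of_real t - b / k))"
  have "(F has_vector_derivative exp (b * of_real t - k\<^sup>2 * (of_real t)\<^sup>2 / 2)) (at t within {0..N})" for t
  proof -
    have e: "b\<^sup>2 / (2 * k\<^sup>2) + (- (k * of_real t - b / k)\<^sup>2 / 2) = b * of_real t - k\<^sup>2 * (of_real t)\<^sup>2 / 2"
      using assms by (simp add: field_simps power2_eq_square)
    have "((\<lambda>z. of_real (sqrt (2 * pi)) / k * exp (b\<^sup>2 / (2 * k\<^sup>2)) * Phi (k * z - b / k)) has_field_derivative
       (exp (b\<^sup>2 / (2 * k\<^sup>2)) * exp (- (k * of_real t - b / k)\<^sup>2 / 2))) (at (of_real t))"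
      using assms by (auto intro!: derivative_eq_intros)
    from has_vector_derivative_real_field[OF this] show ?thesis
      unfolding F_def exp_add[symmetric] e .
  qed
  then have "((\<lambda>t. exp (b * of_real t - k\<^sup>2 * (of_real t)\<^sup>2 / 2)) has_integral (F N - F 0)) {0..N}"
    by (intro fundamental_theorem_of_calculus assms) auto
  also have "F N - F 0 = of_real (sqrt (2 * pi)) / k * exp (b\<^sup>2 / (2 * k\<^sup>2)) * (Phi (k * of_real N - b / k) - Phi (- b / k))"
    by (simp only: F_def right_diff_distrib) simp
  finally show ?thesis .
qed

lemma integral_Icc_tendsto_lborel:
  fixes f :: "real \<Rightarrow> complex"
  assumes "integrable lborel (\<lambda>t. indicator {0..} t *\<^sub>R f t)"
  shows "((\<lambda>N. integral {0..N} f) \<longlongrightarrow> (\<integral>t. indicator {0..} t *\<^sub>R f t \<partial>lborel)) at_top"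
proof -
  have si: "set_integrable lborel {0..} f" using assms by (simp add: set_integrable_def)
  have "((\<lambda>N. LINT t:{0..N}|lborel. f t) \<longlongrightarrow> (LINT t:{0..}|lborel. f t)) at_top"
    by (rule tendsto_set_lebesgue_integral_at_top[OF _ si]) auto
  moreover have "(LINT t:{0..N}|lborel. f t) = integral {0..N} f" for N
    by (rule set_borel_integral_eq_integral(2)) (rule set_integrable_subset[OF si], auto)
  ultimately show ?thesis by (simp add: set_lebesgue_integral_def)
qed

lemma Phi_of_real_tendsto_1: "((\<lambda>x::real. Phi (of_real x)) \<longlongrightarrow> 1) at_top"
proof -
  let ?f = "\<lambda>t::real. exp (- (t\<^sup>2) / 2)"
  have 0: "has_bochner_integral lborel (\<lambda>x::real. indicator {0..} x *\<^sub>R exp (- x\<^sup>2)) (sqrt pi / 2)"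
    by (rule gaussian_moment_0)
  \<comment> \<open>The substitution t = x / sqrt 2 turns exp (- t^2) of the known moment into exp
    (- x^2 / 2).\<close>
  have "has_bochner_integral lborel (\<lambda>x. indicator {0..} (0 + (1/sqrt 2) * x) *\<^sub>R exp (- (0 + (1/sqrt 2) * x)\<^sup>2)) ((sqrt pi / 2) /\<^sub>R \<bar>1 / sqrt 2\<bar>)"
    by (rule lborel_has_bochner_integral_real_affine_iff[THEN iffD1, OF _ 0]) auto
  also have "(\<lambda>x. indicator {0..} (0 + (1/sqrt 2) * x) *\<^sub>R exp (- (0 + (1/sqrt 2) * x)\<^sup>2)) = (\<lambda>x. indicator {0..} x *\<^sub>R ?f x)"
    by (auto simp: fun_eq_iff indicator_def power_mult_distrib power_divide zero_le_divide_iff)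
  also have "(sqrt pi / 2) /\<^sub>R \<bar>1 / sqrt 2\<bar> = sqrt (2 * pi) / 2"
    by (simp add: real_sqrt_mult)
  finally have hb: "has_bochner_integral lborel (\<lambda>x. indicator {0..} x *\<^sub>R ?f x) (sqrt (2 * pi) / 2)" .
  then have hbc: "has_bochner_integral lborel (\<lambda>x. complex_of_real (indicator {0..} x *\<^sub>R ?f x)) (complex_of_real (sqrt (2 * pi) / 2))"
    by (rule has_bochner_integral_of_real)
  have eq: "complex_of_real (indicator {0..} x *\<^sub>R ?f x) = indicator {0..} x *\<^sub>R exp (0 * of_real x - 1\<^sup>2 * (of_real x)\<^sup>2 / 2)" for x
    by (auto simp: indicator_def exp_of_real[symmetric])
  have lim: "((\<lambda>N. integral {0..N} (\<lambda>x. exp (0 * complex_of_real x - 1\<^sup>2 * (of_real x)\<^sup>2 / 2))) \<longlongrightarrow> complex_of_real (sqrt (2 * pi) / 2)) at_top"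
    using integral_Icc_tendsto_lborel[of "\<lambda>x. exp (0 * complex_of_real x - 1\<^sup>2 * (of_real x)\<^sup>2 / 2)"] hbc
    unfolding eq has_bochner_integral_iff by metis
  have "\<forall>\<^sub>F N in at_top. integral {0..N} (\<lambda>x. exp (0 * complex_of_real x - 1\<^sup>2 * (of_real x)\<^sup>2 / 2)) = of_real (sqrt (2 * pi)) * (Phi (of_real N) - 1 / 2)"
    using eventually_ge_at_top[of 0]
  proof eventually_elim
    case (elim N)
    show ?case using integral_unique[OF has_integral_Phi_line[of 1 N 0]] elim by simp
  qed
  from Lim_transform_eventually[OF lim this]
  have "((\<lambda>N. of_real (sqrt (2 * pi)) * (Phi (of_real N) - 1 / 2)) \<longlongrightarrow> complex_of_real (sqrt (2 * pi) / 2)) at_top" .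
  from tendsto_add[OF tendsto_divide[OF this tendsto_const[of "complex_of_real (sqrt (2 * pi))"]] tendsto_const[of "1/2"]]
  show ?thesis by (simp add: field_simps)
qed

text \<open>Mean value inequality on the vertical segment from Re z to z. There the real part is
  fixed and |Im w| increases, so |exp (- w^2 / 2)| is largest at z itself.\<close>

lemma Phi_minus_Phi_Re_le: "norm (Phi z - Phi (of_real (Re z))) \<le> exp (- Re (z\<^sup>2) / 2) * \<bar>Im z\<bar>"
proof -
  have "norm (Phi z - Phi (of_real (Re z))) \<le> exp (- Re (z\<^sup>2) / 2) * norm (z - of_real (Re z))"
  proof (rule field_differentiable_bound)
    fix w assume "w \<in> closed_segment (complex_of_real (Re z)) z"
    then obtain u where u: "0 \<le> u" "u \<le> 1" "w = (1 - u) *\<^sub>R of_real (Re z) + u *\<^sub>R z"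
      by (auto simp: in_segment)
    have w: "Re w = Re z" "Im w = u * Im z" using u by (auto simp: left_diff_distrib)
    have "u\<^sup>2 * (Im z)\<^sup>2 \<le> 1 * (Im z)\<^sup>2"
      using u by (intro mult_right_mono power_le_one) auto
    then have "(Im w)\<^sup>2 \<le> (Im z)\<^sup>2" unfolding w power_mult_distrib by simp
    then have "Re (w\<^sup>2) \<ge> Re (z\<^sup>2)" using w by (simp add: power2_eq_square)
    then have "exp (- Re (w\<^sup>2) / 2) / sqrt (2 * pi) \<le> exp (- Re (z\<^sup>2) / 2) / 1"
      using pi_gt3 by (intro frac_le) (auto simp: real_le_rsqrt)
    then show "norm (exp (- (w\<^sup>2) / 2) / of_real (sqrt (2 * pi))) \<le> exp (- Re (z\<^sup>2) / 2)"
      by (simp add: norm_divide)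
  next
    fix w show "(Phi has_field_derivative exp (- (w\<^sup>2) / 2) / of_real (sqrt (2 * pi))) (at w within closed_segment (complex_of_real (Re z)) z)"
      using Phi_has_field_derivative has_field_derivative_at_within by blast
  qed auto
  also have "norm (z - of_real (Re z)) = \<bar>Im z\<bar>"
    by (simp add: cmod_def)
  finally show ?thesis .
qed

text \<open>The hypotheses say |arg k| < pi / 4. Then Re (z^2) grows quadratically along the ray
  while Im z grows linearly, so the comparison with the real axis has an error tending to 0.\<close>

lemma Phi_sector_tendsto_1:
  assumes "Re k > 0" "Re (k\<^sup>2) > 0"
  shows "((\<lambda>N. Phi (k * of_real N - b)) \<longlongrightarrow> 1) at_top"
proof -
  define z where "z = (\<lambda>N. k * of_real N - b)"
  have "filterlim (\<lambda>N. Re k * N - Re b) at_top at_top"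
    using assms(1) by real_asymp
  then have "filterlim (\<lambda>N. Re (z N)) at_top at_top" by (simp add: z_def)
  from filterlim_compose[OF Phi_of_real_tendsto_1 this]
  have 1: "((\<lambda>N. Phi (of_real (Re (z N)))) \<longlongrightarrow> 1) at_top" .
  have "((\<lambda>N. Phi (z N) - Phi (of_real (Re (z N)))) \<longlongrightarrow> 0) at_top"
  proof (rule Lim_null_comparison)
    show "\<forall>\<^sub>F N in at_top. norm (Phi (z N) - Phi (of_real (Re (z N)))) \<le> exp (- Re ((z N)\<^sup>2) / 2) * \<bar>Im (z N)\<bar>"
      by (intro always_eventually allI Phi_minus_Phi_Re_le)
    have e: "exp (- Re ((z N)\<^sup>2) / 2) * \<bar>Im (z N)\<bar> =
      exp (- (Re (k\<^sup>2) * N\<^sup>2 - 2 * Re (k * b) * N + Re (b\<^sup>2)) / 2) * \<bar>Im k * N - Im b\<bar>" for N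
      by (simp add: z_def power2_eq_square algebra_simps)
    define A B D where "A = Re (k\<^sup>2)" and "B = Re (k * b)" and "D = Re (b\<^sup>2)"
    have "A > 0" using assms by (simp add: A_def)
    then have "((\<lambda>N::real. exp (- (A * N\<^sup>2 - 2 * B * N + D) / 2)) \<longlongrightarrow> 0) at_top"
      and "((\<lambda>N::real. exp (- (A * N\<^sup>2 - 2 * B * N + D) / 2) * N) \<longlongrightarrow> 0) at_top"
      by real_asymp+
    then have "((\<lambda>N::real. \<bar>Im k * (exp (- (A * N\<^sup>2 - 2 * B * N + D) / 2) * N)
        - Im b * exp (- (A * N\<^sup>2 - 2 * B * N + D) / 2)\<bar>) \<longlongrightarrow> \<bar>Im k * 0 - Im b * 0\<bar>) at_top"
      by (intro tendsto_intros)
    also have "(\<lambda>N::real. \<bar>Im k * (exp (- (A * N\<^sup>2 - 2 * B * N + D) / 2) * N)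
        - Im b * exp (- (A * N\<^sup>2 - 2 * B * N + D) / 2)\<bar>) =
      (\<lambda>N. exp (- (A * N\<^sup>2 - 2 * B * N + D) / 2) * \<bar>Im k * N - Im b\<bar>)"
      (is "?l = ?r")
    proof
      fix N :: real
      have "?l N = \<bar>exp (- (A * N\<^sup>2 - 2 * B * N + D) / 2) * (Im k * N - Im b)\<bar>"
        by (simp only: right_diff_distrib left_diff_distrib mult_ac)
      then show "?l N = ?r N" by (simp only: abs_mult abs_exp_cancel)
    qed
    finally have "((\<lambda>N::real. exp (- (A * N\<^sup>2 - 2 * B * N + D) / 2) * \<bar>Im k * N - Im b\<bar>) \<longlongrightarrow> 0) at_top"
      by simp
    then show "((\<lambda>N. exp (- Re ((z N)\<^sup>2) / 2) * \<bar>Im (z N)\<bar>) \<longlongrightarrow> 0) at_top"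
      unfolding e A_def B_def D_def .
  qed
  from tendsto_add[OF this 1] show ?thesis by (simp add: z_def)
qed

text \<open>The upper boundary value of the antiderivative tends to 1 in the sector, and reflection
  turns 1 - Phi (- b / k) into Phi (b / k). Every factor \<open>Phi\<close> of the volume formula
  arises from this integral.\<close>

lemma gaussian_half_line:
  assumes "Re k > 0" "Re (k\<^sup>2) > 0"
  shows "has_bochner_integral lborel (\<lambda>t::real. indicator {0..} t *\<^sub>R exp (b * of_real t - k\<^sup>2 * (of_real t)\<^sup>2 / 2))
    (of_real (sqrt (2 * pi)) / k * exp (b\<^sup>2 / (2 * k\<^sup>2)) * Phi (b / k))"
proof -
  let ?f = "\<lambda>t::real. exp (b * of_real t - k\<^sup>2 * (of_real t)\<^sup>2 / 2)"
  have k0: "k \<noteq> 0" using assms by auto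
  have int: "integrable lborel (\<lambda>t::real. indicator {0..} t *\<^sub>R ?f t)"
    by (rule integrable_mult_indicator[OF _ integrable_exp_linear_square[OF assms(2)]]) simp
  let ?c = "of_real (sqrt (2 * pi)) / k * exp (b\<^sup>2 / (2 * k\<^sup>2))"
  have "((\<lambda>N. ?c * (Phi (k * of_real N - b / k) - Phi (- b / k))) \<longlongrightarrow> ?c * (1 - Phi (- b / k))) at_top"
    by (intro tendsto_intros Phi_sector_tendsto_1 assms)
  moreover have "\<forall>\<^sub>F N in at_top. ?c * (Phi (k * of_real N - b / k) - Phi (- b / k)) = integral {0..N} ?f"
    using eventually_ge_at_top[of 0]
    by eventually_elim (rule integral_unique[OF has_integral_Phi_line, symmetric], use k0 in auto)
  ultimately have "((\<lambda>N. integral {0..N} ?f) \<longlongrightarrow> ?c * (1 - Phi (- b / k))) at_top"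
    by (rule Lim_transform_eventually)
  from tendsto_unique[OF _ integral_Icc_tendsto_lborel[OF int] this]
  have "(\<integral>t. indicator {0..} t *\<^sub>R ?f t \<partial>lborel) = ?c * (1 - Phi (- b / k))" by simp
  also have "1 - Phi (- b / k) = Phi (b / k)" using Phi_minus[of "b/k"] by simp
  finally show ?thesis using int by (simp add: has_bochner_integral_iff)
qed

lemma has_bochner_integral_split_half_lines:
  fixes f :: "real \<Rightarrow> complex"
  assumes "has_bochner_integral lborel (\<lambda>t. indicator {0..} t *\<^sub>R f t) x"
    and "has_bochner_integral lborel (\<lambda>t. indicator {0..} t *\<^sub>R f (- t)) y"
  shows "has_bochner_integral lborel f (x + y)"
proof -
  have "has_bochner_integral lborel (\<lambda>t. indicator {0..} (0 + (-1) * t) *\<^sub>R f (- (0 + (-1) * t))) (y /\<^sub>R \<bar>-1\<bar>)"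
    by (rule lborel_has_bochner_integral_real_affine_iff[THEN iffD1, OF _ assms(2)]) auto
  then have "has_bochner_integral lborel (\<lambda>t. indicator {..0} t *\<^sub>R f t) y"
    by (simp add: indicator_def)
  from has_bochner_integral_add[OF assms(1) this]
  have *: "has_bochner_integral lborel (\<lambda>t. indicator {0..} t *\<^sub>R f t + indicator {..0} t *\<^sub>R f t) (x + y)" .
  have ae: "AE t in lborel. f t = indicator {0..} t *\<^sub>R f t + indicator {..0} t *\<^sub>R f t"
    using AE_lborel_singleton[of "0::real"] by eventually_elim (auto simp: indicator_def)
  \<comment> \<open>Measurability of \<open>f\<close> has to be recovered from the two halves; their
    sum counts \<open>f 0\<close> twice, so this one value is corrected.\<close>
  have meas: "f \<in> borel_measurable lborel"
  proof -
    have "(\<lambda>t. if t = 0 then f 0 else indicator {0..} t *\<^sub>R f t + indicator {..0} t *\<^sub>R f t) \<in> borel_measurable lborel"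
      using borel_measurable_has_bochner_integral[OF *] by measurable
    also have "(\<lambda>t. if t = 0 then f 0 else indicator {0..} t *\<^sub>R f t + indicator {..0} t *\<^sub>R f t) = f"
      by (auto simp: fun_eq_iff indicator_def)
    finally show ?thesis .
  qed
  show ?thesis
    by (rule has_bochner_integral_cong_AE[THEN iffD2, OF meas borel_measurable_has_bochner_integral[OF *] ae *])
qed

lemma gaussian_line:
  assumes "Re k > 0" "Re (k\<^sup>2) > 0"
  shows "has_bochner_integral lborel (\<lambda>t::real. exp (b * of_real t - k\<^sup>2 * (of_real t)\<^sup>2 / 2))
    (of_real (sqrt (2 * pi)) / k * exp (b\<^sup>2 / (2 * k\<^sup>2)))"
proof -
  have "has_bochner_integral lborel (\<lambda>t::real. exp (b * of_real t - k\<^sup>2 * (of_real t)\<^sup>2 / 2))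
    (of_real (sqrt (2 * pi)) / k * exp (b\<^sup>2 / (2 * k\<^sup>2)) * Phi (b / k) +
     of_real (sqrt (2 * pi)) / k * exp ((- b)\<^sup>2 / (2 * k\<^sup>2)) * Phi ((- b) / k))"
    by (rule has_bochner_integral_split_half_lines[OF gaussian_half_line[OF assms]])
      (use gaussian_half_line[OF assms, of "- b"] in simp)
  also have "of_real (sqrt (2 * pi)) / k * exp (b\<^sup>2 / (2 * k\<^sup>2)) * Phi (b / k) +
     of_real (sqrt (2 * pi)) / k * exp ((- b)\<^sup>2 / (2 * k\<^sup>2)) * Phi ((- b) / k) = of_real (sqrt (2 * pi)) / k * exp (b\<^sup>2 / (2 * k\<^sup>2))"
    using Phi_minus[of "b/k"] by (simp add: distrib_left[symmetric] add_divide_distrib[symmetric])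
  finally show ?thesis .
qed

section \<open>Radial Gaussian moments with a complex parameter\<close>

lemma integrable_power_exp_neg_square:
  assumes "(a::real) > 0"
  shows "integrable lborel (\<lambda>t. t ^ n * exp (- (a * t\<^sup>2)))"
proof -
  define \<sigma> where "\<sigma> = 1 / sqrt (2 * a)"
  have s: "\<sigma> > 0" "\<sigma>\<^sup>2 = 1 / (2 * a)" using assms by (auto simp: \<sigma>_def power_divide)
  have "integrable lborel (\<lambda>x. sqrt (2 * pi * \<sigma>\<^sup>2) * (normal_density 0 \<sigma> x * (x - 0) ^ n))"
    by (intro integrable_mult_right integrable_normal_moment s)
  also have "(\<lambda>x. sqrt (2 * pi * \<sigma>\<^sup>2) * (normal_density 0 \<sigma> x * (x - 0) ^ n)) = (\<lambda>x. x ^ n * exp (- (a * x\<^sup>2)))"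
    using s assms by (auto simp: normal_density_def fun_eq_iff field_simps)
  finally show ?thesis .
qed

lemma integrable_power_exp_complex:
  assumes "Re p > 0"
  shows "integrable lborel (\<lambda>t::real. indicator {0..} t *\<^sub>R (of_real t ^ n * exp (- (p * (of_real t)\<^sup>2 / 2))))"
proof (rule integrable_mult_indicator, simp, rule Bochner_Integration.integrable_bound)
  show "integrable lborel (\<lambda>t. t ^ n * exp (- (Re p / 2 * t\<^sup>2)))"
    by (rule integrable_power_exp_neg_square) (use assms in auto)
  show "AE t in lborel. norm (of_real t ^ n * exp (- (p * (of_real t)\<^sup>2 / 2)))
      \<le> norm (t ^ n * exp (- (Re p / 2 * t\<^sup>2)))"
    by (intro AE_I2) (simp add: norm_mult norm_power flip: of_real_power)
qed measurable

lemma Re_csqrt_pos: "Re p > 0 \<Longrightarrow> Re (csqrt p) > 0"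
  by (simp add: add_nonneg_pos)

text \<open>Both sides obey one two-step recursion: integration by parts multiplies the moment by (n
  + 1) / p, the functional equation of Gamma multiplies the sphere area by 2 pi / (n + 1). The
  branch of the square root matters only for n = 0; the case n = 1 and the recursion involve its
  square p alone.\<close>

lemma radial_gaussian_moment:
  assumes "Re p > 0"
  shows "of_real (sphere_area (Suc n)) * (\<integral>t. indicator {0..} t *\<^sub>R (of_real t ^ n * exp (- (p * (of_real t)\<^sup>2 / 2))) \<partial>lborel)
    = (of_real (sqrt (2 * pi)) / csqrt p) ^ Suc n"
proof -
  define J where "J = (\<lambda>n. \<integral>t. indicator {0..} t *\<^sub>R (of_real t ^ n * exp (- (p * (complex_of_real t)\<^sup>2 / 2))) \<partial>lborel)"
  have p0: "p \<noteq> 0" "csqrt p \<noteq> 0" using assms by auto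
  have lim: "((\<lambda>N. integral {0..N} (\<lambda>t. of_real t ^ n * exp (- (p * (of_real t)\<^sup>2 / 2)))) \<longlongrightarrow> J n) at_top" for n
    unfolding J_def by (rule integral_Icc_tendsto_lborel[OF integrable_power_exp_complex[OF assms]])
  have decay: "((\<lambda>N. of_real N ^ n * exp (- (p * (complex_of_real N)\<^sup>2 / 2))) \<longlongrightarrow> 0) at_top" for n
  proof (rule tendsto_norm_zero_cancel)
    have "((\<lambda>N. N ^ n * exp (- (Re p / 2 * N\<^sup>2))) \<longlongrightarrow> 0) at_top"
      using assms by real_asymp
    then have "((\<lambda>N. \<bar>N ^ n * exp (- (Re p / 2 * N\<^sup>2))\<bar>) \<longlongrightarrow> 0) at_top"
      by (rule tendsto_rabs_zero)
    then show "((\<lambda>N. norm (of_real N ^ n * exp (- (p * (complex_of_real N)\<^sup>2 / 2)))) \<longlongrightarrow> 0) at_top"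
      by (simp add: norm_mult norm_power abs_mult power_abs flip: of_real_power)
  qed
  let ?e = "\<lambda>t::real. exp (- (p * (complex_of_real t)\<^sup>2 / 2))"
  have de: "((\<lambda>z. exp (- (p * z\<^sup>2 / 2))) has_field_derivative - (p * z) * exp (- (p * z\<^sup>2 / 2))) (at z)" for z
    by (auto intro!: derivative_eq_intros)
  have J0: "of_real (sphere_area 1) * J 0 = of_real (sqrt (2 * pi)) / csqrt p"
  proof -
    have "J 0 = of_real (sqrt (2 * pi)) / csqrt p / 2"
      using gaussian_half_line[of "csqrt p" 0] Re_csqrt_pos[OF assms] assms unfolding J_def
      by (simp add: has_bochner_integral_iff)
    moreover have "sphere_area 1 = 2" by (simp add: sphere_area_def Gamma_one_half_real powr_half_sqrt)
    ultimately show ?thesis by simp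
  qed
  have J1: "of_real (sphere_area 2) * J 1 = (of_real (sqrt (2 * pi)) / csqrt p) ^ 2"
  proof -
    have "\<forall>\<^sub>F N in at_top. (1 - ?e N) / p = integral {0..N} (\<lambda>t. of_real t ^ 1 * ?e t)"
      using eventually_ge_at_top[of 0]
    proof eventually_elim
      case (elim N)
      have "((\<lambda>z. - exp (- (p * z\<^sup>2 / 2)) / p) has_field_derivative (z * exp (- (p * z\<^sup>2 / 2)))) (at z)" for z
        using p0 by (auto intro!: derivative_eq_intros simp: field_simps)
      from has_vector_derivative_real_field[OF this]
      have "((\<lambda>t. of_real t ^ 1 * ?e t) has_integral (- ?e N / p - (- ?e 0 / p))) {0..N}"
        by (intro fundamental_theorem_of_calculus elim) auto
      then show ?case by (simp add: integral_unique diff_divide_distrib)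
    qed
    moreover have "((\<lambda>N. (1 - ?e N) / p) \<longlongrightarrow> (1 - 0) / p) at_top"
      by (intro tendsto_intros) (use decay[of 0] p0 in auto)
    ultimately have "((\<lambda>N. integral {0..N} (\<lambda>t. of_real t ^ 1 * ?e t)) \<longlongrightarrow> (1 - 0) / p) at_top"
      by (rule Lim_transform_eventually[rotated])
    from tendsto_unique[OF _ lim[of 1] this] have "J 1 = 1 / p" by simp
    moreover have "sphere_area 2 = 2 * pi" by (simp add: sphere_area_def)
    ultimately show ?thesis by (simp add: power_divide flip: of_real_power)
  qed
  have rec: "J (Suc (Suc n)) = of_nat (Suc n) / p * J n" for n
  proof -
    have "\<forall>\<^sub>F N in at_top. of_nat (Suc n) / p * integral {0..N} (\<lambda>t. of_real t ^ n * ?e t) - of_real N ^ Suc n * ?e N / p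
      = integral {0..N} (\<lambda>t. of_real t ^ Suc (Suc n) * ?e t)"
      using eventually_ge_at_top[of 0]
    proof eventually_elim
      case (elim N)
      have "((\<lambda>z. z ^ Suc n * exp (- (p * z\<^sup>2 / 2)) / p) has_field_derivative
         (of_nat (Suc n) / p * (z ^ n * exp (- (p * z\<^sup>2 / 2))) - z ^ Suc (Suc n) * exp (- (p * z\<^sup>2 / 2)))) (at z)" for z
      proof -
        have "((\<lambda>z. z ^ Suc n) has_field_derivative of_nat (Suc n) * z ^ n) (at z)"
          by (rule derivative_eq_intros refl)+ simp
        from DERIV_cdivide[OF DERIV_mult[OF this de], of p]
        show ?thesis by (rule DERIV_cong) (use p0 in \<open>simp add: field_simps\<close>)
      qed
      from has_vector_derivative_real_field[OF this]
      have "((\<lambda>t. of_nat (Suc n) / p * (of_real t ^ n * ?e t) - of_real t ^ Suc (Suc n) * ?e t)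
        has_integral (of_real N ^ Suc n * ?e N / p - of_real 0 ^ Suc n * ?e 0 / p)) {0..N}"
        by (intro fundamental_theorem_of_calculus elim) auto
      moreover have "((\<lambda>t. of_nat (Suc n) / p * (of_real t ^ n * ?e t) - of_real t ^ Suc (Suc n) * ?e t)
        has_integral (of_nat (Suc n) / p * integral {0..N} (\<lambda>t. of_real t ^ n * ?e t) - integral {0..N} (\<lambda>t. of_real t ^ Suc (Suc n) * ?e t))) {0..N}"
        by (intro has_integral_diff has_integral_mult_right integrable_integral integrable_continuous_real continuous_intros) auto
      ultimately have "of_real N ^ Suc n * ?e N / p - of_real 0 ^ Suc n * ?e 0 / p =
          of_nat (Suc n) / p * integral {0..N} (\<lambda>t. of_real t ^ n * ?e t) - integral {0..N} (\<lambda>t. of_real t ^ Suc (Suc n) * ?e t)"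
        by (rule has_integral_unique)
      then show ?case by (simp add: diff_eq_eq eq_diff_eq add.commute)
    qed
    moreover have "((\<lambda>N. of_nat (Suc n) / p * integral {0..N} (\<lambda>t. of_real t ^ n * ?e t) - of_real N ^ Suc n * ?e N / p) \<longlongrightarrow>
      of_nat (Suc n) / p * J n - 0 / p) at_top"
      by (intro tendsto_intros lim decay p0)
    ultimately have "((\<lambda>N. integral {0..N} (\<lambda>t. of_real t ^ Suc (Suc n) * ?e t)) \<longlongrightarrow> of_nat (Suc n) / p * J n - 0 / p) at_top"
      by (rule Lim_transform_eventually[rotated])
    from tendsto_unique[OF _ lim this] show ?thesis by simp
  qed
  have sa: "sphere_area (Suc (Suc (Suc n))) * real (Suc n) = 2 * pi * sphere_area (Suc n)" for n
  proof -
    define x where "x = real (Suc n) / 2"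
    have x: "x > 0" "real (Suc n) = 2 * x" "real (Suc (Suc (Suc n))) / 2 = x + 1" by (auto simp: x_def)
    then have "Gamma (x + 1) = x * Gamma x" "Gamma x > 0"
      by (auto intro!: Gamma_plus1 Gamma_real_pos)
    with x show ?thesis unfolding sphere_area_def x
      by (simp add: powr_add field_simps)
  qed
  have "of_real (sphere_area (Suc n)) * J n = (of_real (sqrt (2 * pi)) / csqrt p) ^ Suc n" for n
  proof (induction n rule: induct_nat_012)
    case (ge2 n)
    have "of_real (sphere_area (Suc (Suc (Suc n)))) * J (Suc (Suc n)) =
      of_real (sphere_area (Suc (Suc (Suc n))) * real (Suc n)) / p * J n"
      unfolding rec by simp
    also have "\<dots> = of_real (2 * pi) / p * (of_real (sphere_area (Suc n)) * J n)"
      unfolding sa by simp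
    also have "of_real (2 * pi) / p = (of_real (sqrt (2 * pi)) / csqrt p) ^ 2"
      by (simp add: power_divide flip: of_real_power)
    finally show ?case unfolding ge2 by (simp only: power_add[symmetric]) (simp add: eval_nat_numeral)
  qed (use J0 J1 in \<open>simp_all add: numeral_2_eq_2\<close>)
  then show ?thesis by (simp add: J_def)
qed

text \<open>Up to the factor sqrt (2 pi) this is the Mills ratio of the normal law. It splits Phi (-
  z) into the Gaussian exp (- z^2 / 2), which may merely oscillate, and a factor of size 1 / Re z in
  the right half-plane.\<close>

definition mills :: "complex \<Rightarrow> complex" where
  "mills z = exp (z\<^sup>2 / 2) * Phi (- z)"

lemma Phi_minus_eq_mills: "Phi (- z) = exp (- (z\<^sup>2 / 2)) * mills z"
  by (simp add: mills_def flip: exp_add)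

lemma holomorphic_on_mills: "mills holomorphic_on S"
proof -
  have "(Phi \<circ> uminus) holomorphic_on S"
    by (intro holomorphic_on_compose holomorphic_on_Phi) (auto intro!: holomorphic_intros)
  then have "(\<lambda>z. exp (z\<^sup>2 / 2) * Phi (- z)) holomorphic_on S"
    unfolding o_def by (auto intro!: holomorphic_intros)
  then show ?thesis by (simp add: mills_def[abs_def])
qed

text \<open>By the half-line formula with k = 1 and b = - z, sqrt (2 pi) \<open>mills z\<close> is
  the integral of exp (- z t - t^2 / 2) over t >= 0; dropping the Gaussian factor leaves an
  exponential integral.\<close>

lemma norm_mills_le:
  assumes "Re z > 0"
  shows "norm (mills z) \<le> 1 / Re z"
proof -
  interpret E: prob_space "density lborel (exponential_density (Re z))"
    by (rule prob_space_exponential_density[OF assms])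
  have "(\<integral>t. 1 \<partial>density lborel (exponential_density (Re z))) = (1::real)"
    using E.prob_space by simp
  then have "integral\<^sup>L lborel (exponential_density (Re z)) = 1"
    by (subst (asm) integral_density) (auto simp: exponential_density_nonneg assms)
  \<comment> \<open>A non-integrable function has Bochner integral 0, so the value 1 certifies
    integrability.\<close>
  moreover from this have "integrable lborel (exponential_density (Re z))"
    by (metis not_integrable_integral_eq zero_neq_one)
  ultimately have "has_bochner_integral lborel (\<lambda>t. exponential_density (Re z) t *\<^sub>R (1 / Re z)) (1 *\<^sub>R (1 / Re z))"
    by (intro has_bochner_integral_scaleR_left) (simp add: has_bochner_integral_iff)
  also have "(\<lambda>t. exponential_density (Re z) t *\<^sub>R (1 / Re z)) = (\<lambda>t. indicator {0..} t *\<^sub>R exp (- (t * Re z)))"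
    using assms by (auto simp: exponential_density_def indicator_def fun_eq_iff)
  finally have ei: "has_bochner_integral lborel (\<lambda>t. indicator {0..} t *\<^sub>R exp (- (t * Re z))) (1 / Re z)" by simp
  have "integral\<^sup>L lborel (\<lambda>t. indicator {0..} t *\<^sub>R exp ((- z) * of_real t - 1\<^sup>2 * (of_real t)\<^sup>2 / 2))
    = of_real (sqrt (2 * pi)) * mills z"
    using gaussian_half_line[of 1 "- z"] by (simp add: has_bochner_integral_iff mills_def)
  then have "sqrt (2 * pi) * norm (mills z) = norm (integral\<^sup>L lborel (\<lambda>t. indicator {0..} t *\<^sub>R exp ((- z) * of_real t - 1\<^sup>2 * (of_real t)\<^sup>2 / 2)))"
    by (simp add: norm_mult)
  also have "\<dots> \<le> (\<integral>t. indicator {0..} t *\<^sub>R exp (- (t * Re z)) \<partial>lborel)"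
  proof (rule Bochner_Integration.integral_norm_bound_integral)
    show "integrable lborel (\<lambda>t. indicator {0..} t *\<^sub>R exp (- (t * Re z)))"
      using ei by (simp add: has_bochner_integral_iff)
  next
    show "integrable lborel (\<lambda>t::real. indicator {0..} t *\<^sub>R exp ((- z) * of_real t - 1\<^sup>2 * (of_real t)\<^sup>2 / 2))"
      using gaussian_half_line[of 1 "- z"] by (simp add: has_bochner_integral_iff)
  next
    fix t :: real
    show "norm (indicator {0..} t *\<^sub>R exp ((- z) * of_real t - 1\<^sup>2 * (of_real t)\<^sup>2 / 2)) \<le> indicator {0..} t *\<^sub>R exp (- (t * Re z))"
      by (auto simp: indicator_def mult.commute simp flip: of_real_power)
  qed
  also have "\<dots> = 1 / Re z"
    using ei by (simp add: has_bochner_integral_iff)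
  finally have "sqrt (2 * pi) * norm (mills z) \<le> 1 / Re z" .
  moreover have "1 * norm (mills z) \<le> sqrt (2 * pi) * norm (mills z)"
    using pi_gt3 by (intro mult_right_mono) (auto simp: real_le_rsqrt)
  ultimately show ?thesis by simp
qed

text \<open>Cauchy's estimate on the circle of radius Re z / 2, where real parts are at least Re z /
  2 and \<open>mills\<close> is bounded by 2 / Re z.\<close>

lemma norm_deriv_mills_le:
  assumes "Re z > 0"
  shows "norm (deriv mills z) \<le> 4 / (Re z)\<^sup>2"
proof -
  have "norm ((deriv ^^ 1) mills z) \<le> fact 1 * (2 / Re z) / (Re z / 2) ^ 1"
  proof (rule Cauchy_inequality[OF holomorphic_on_mills holomorphic_on_imp_continuous_on[OF holomorphic_on_mills]])
    fix x assume "norm (z - x) = Re z / 2"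
    then have x: "Re x \<ge> Re z / 2" using complex_Re_le_cmod[of "z - x"] by simp
    then have "norm (mills x) \<le> 1 / Re x" using assms by (intro norm_mills_le) auto
    also have "\<dots> \<le> 1 / (Re z / 2)" using x assms by (intro divide_left_mono) auto
    finally show "norm (mills x) \<le> 2 / Re z" by simp
  qed (use assms in auto)
  then show ?thesis by (simp add: power2_eq_square)
qed

section \<open>Uniform convergence of the oscillatory integrals\<close>

lemma norm_integral_inverse_square_le:
  fixes f :: "real \<Rightarrow> complex"
  assumes B: "0 < B" "B \<le> B'" and f: "f integrable_on {B..B'}" and G: "\<And>u. u \<in> {B..B'} \<Longrightarrow> norm (f u) \<le> G / u\<^sup>2" "G \<ge> 0"
  shows "norm (integral {B..B'} f) \<le> G / B"
proof -
  have sq: "((\<lambda>u. G * (1 / u\<^sup>2)) has_integral (G * (1 / B - 1 / B'))) {B..B'}"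
  proof -
    have "((\<lambda>u. 1 / u\<^sup>2) has_integral (- (1 / B') - - (1 / B))) {B..B'}"
    proof (intro fundamental_theorem_of_calculus B)
      fix u assume u: "u \<in> {B..B'}"
      have "((\<lambda>u. - (1 / u)) has_real_derivative 1 / u\<^sup>2) (at u within {B..B'})"
        using u B by (auto intro!: derivative_eq_intros simp: power2_eq_square)
      then show "((\<lambda>u. - (1 / u)) has_vector_derivative 1 / u\<^sup>2) (at u within {B..B'})"
        by (simp add: has_real_derivative_iff_has_vector_derivative)
    qed
    from has_integral_mult_right[OF this, of G] show ?thesis by simp
  qed
  have "norm (integral {B..B'} f) \<le> integral {B..B'} (\<lambda>u. G * (1 / u\<^sup>2))"
    by (rule Henstock_Kurzweil_Integration.integral_norm_bound_integral[OF f has_integral_integrable[OF sq]]) (use G in auto)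
  also have "\<dots> = G * (1 / B - 1 / B')" using sq by (rule integral_unique)
  also have "\<dots> \<le> G * (1 / B)"
    using B G by (intro mult_left_mono) auto
  finally show ?thesis by simp
qed

text \<open>Integration by parts against \<open>H\<close>, where H(u) = - e(u) / (\<alpha> u) has
  derivative e(u) + e(u) / (\<alpha> u^2): the boundary terms are O(1 / B) and the new integrand is
  O(1 / u^2). As Re \<alpha> = 0 is allowed, no decay of |e| can be used and only
  \<open>norm \<alpha>\<close> enters the bound.\<close>

lemma oscillatory_tail_le:
  fixes \<alpha> :: complex and g :: "real \<Rightarrow> complex"
  assumes a: "\<alpha> \<noteq> 0" "Re \<alpha> \<ge> 0" and B: "0 < B" "B \<le> B'"
    and g: "\<And>u. u \<in> {B..B'} \<Longrightarrow> (g has_vector_derivative g' u) (at u within {B..B'})"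
    and G: "\<And>u. u \<in> {B..B'} \<Longrightarrow> norm (g u) \<le> G" "\<And>u. u \<in> {B..B'} \<Longrightarrow> norm (g' u) \<le> G / u"
  shows "norm (integral {B..B'} (\<lambda>u. exp (- (\<alpha> * (of_real u)\<^sup>2 / 2)) * g u)) \<le> 4 * G / (norm \<alpha> * B)"
proof -
  define e where "e = (\<lambda>u::real. exp (- (\<alpha> * (of_real u)\<^sup>2 / 2)))"
  define H where "H = (\<lambda>u::real. - (e u / (\<alpha> * of_real u)))"
  define R where "R = (\<lambda>u. e u * (g u / (\<alpha> * (of_real u)\<^sup>2) - g' u / (\<alpha> * of_real u)))"
  have e_le: "norm (e u) \<le> 1" for u
    using a(2) by (simp add: e_def flip: of_real_power)
  have contg: "continuous_on {B..B'} g"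
    by (rule continuous_on_vector_derivative[OF g])
  have G0: "G \<ge> 0" using order_trans[OF norm_ge_zero G(1)[of B]] B by simp
  have na: "norm \<alpha> > 0" using a by simp
  have int1: "(\<lambda>u. e u * g u) integrable_on {B..B'}"
    unfolding e_def by (intro integrable_continuous_real continuous_intros contg) auto
  have dH: "(H has_vector_derivative (e u + e u / (\<alpha> * (of_real u)\<^sup>2))) (at u within {B..B'})" if "u \<in> {B..B'}" for u
  proof -
    have u: "complex_of_real u \<noteq> 0" using that B by auto
    have "((\<lambda>z. - (exp (- (\<alpha> * z\<^sup>2 / 2)) / (\<alpha> * z))) has_field_derivative (e u + e u / (\<alpha> * (of_real u)\<^sup>2))) (at (of_real u))"
      unfolding e_def using a u by (auto intro!: derivative_eq_intros simp: field_simps power2_eq_square)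
    from has_vector_derivative_real_field[OF this] show ?thesis by (simp add: H_def e_def)
  qed
  have "((\<lambda>u. H u * g' u + (e u + e u / (\<alpha> * (of_real u)\<^sup>2)) * g u) has_integral (H B' * g B' - H B * g B)) {B..B'}"
    by (intro fundamental_theorem_of_calculus B has_vector_derivative_mult dH g)
  moreover have "H u * g' u + (e u + e u / (\<alpha> * (of_real u)\<^sup>2)) * g u = e u * g u + R u" for u
    by (simp add: H_def R_def algebra_simps)
  ultimately have hi: "((\<lambda>u. e u * g u + R u) has_integral (H B' * g B' - H B * g B)) {B..B'}" by simp
  have intR: "R integrable_on {B..B'}"
    using integrable_diff[OF has_integral_integrable[OF hi] int1] by simp
  have eq: "integral {B..B'} (\<lambda>u. e u * g u) = (H B' * g B' - H B * g B) - integral {B..B'} R"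
    using integral_unique[OF hi] Henstock_Kurzweil_Integration.integral_add[OF int1 intR] by (simp add: algebra_simps)
  have Hg: "norm (H u * g u) \<le> G / (norm \<alpha> * B)" if "u \<in> {B..B'}" for u
  proof -
    have "norm (H u * g u) = norm (e u) * norm (g u) / (norm \<alpha> * u)"
      using that B by (simp add: H_def norm_mult norm_divide)
    also have "\<dots> \<le> 1 * G / (norm \<alpha> * B)"
      using that B na G0 by (intro frac_le mult_mono e_le G mult_left_mono) auto
    finally show ?thesis by simp
  qed
  have R_le: "norm (integral {B..B'} R) \<le> 2 * G / norm \<alpha> / B"
  proof (rule norm_integral_inverse_square_le[OF B intR])
    fix u assume u: "u \<in> {B..B'}"
    have "norm (R u) \<le> 1 * (norm (g u) / (norm \<alpha> * u\<^sup>2) + norm (g' u) / (norm \<alpha> * u))"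
      unfolding R_def norm_mult
    proof (intro mult_mono e_le)
      show "norm (g u / (\<alpha> * (of_real u)\<^sup>2) - g' u / (\<alpha> * of_real u)) \<le> norm (g u) / (norm \<alpha> * u\<^sup>2) + norm (g' u) / (norm \<alpha> * u)"
        using norm_triangle_ineq4[of "g u / (\<alpha> * (of_real u)\<^sup>2)" "g' u / (\<alpha> * of_real u)"] u B
        by (simp add: norm_mult norm_divide norm_power)
    qed auto
    also have "\<dots> \<le> 1 * (G / (norm \<alpha> * u\<^sup>2) + (G / u) / (norm \<alpha> * u))"
      using G[OF u] u B na by (intro mult_left_mono add_mono divide_right_mono) auto
    also have "\<dots> = 2 * G / norm \<alpha> * (1 / u\<^sup>2)"
      using u B na by (simp add: field_simps power2_eq_square)
    finally show "norm (R u) \<le> 2 * G / norm \<alpha> / u\<^sup>2" by simp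
  qed (use G0 in auto)
  have "norm (integral {B..B'} (\<lambda>u. e u * g u)) \<le> norm (H B' * g B') + norm (H B * g B) + norm (integral {B..B'} R)"
    unfolding eq by (rule order_trans[OF norm_triangle_ineq4 add_right_mono[OF norm_triangle_ineq4]])
  also have "\<dots> \<le> G / (norm \<alpha> * B) + G / (norm \<alpha> * B) + 2 * G / norm \<alpha> / B"
    by (intro add_mono Hg R_le) (use B in auto)
  also have "\<dots> = 4 * G / (norm \<alpha> * B)" by simp
  finally show ?thesis by (simp add: e_def)
qed

text \<open>A Moore-Osgood exchange of the limits in n and B. The tails are at most C / B uniformly
  in n, which replaces a dominating function on the half-line; on each bounded interval bounded
  convergence suffices. The limit function need not be Lebesgue integrable, so its integral is
  stated as an improper one.\<close>

lemma improper_limit_exchange: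
  fixes F :: "nat \<Rightarrow> real \<Rightarrow> complex"
  assumes cont: "\<And>n. continuous_on {0..} (F n)"
    and int: "\<And>n. integrable lborel (\<lambda>u. indicator {0..} u *\<^sub>R F n u)"
    and conv: "\<And>u. u \<ge> 0 \<Longrightarrow> (\<lambda>n. F n u) \<longlonglongrightarrow> F0 u"
    and bdd: "\<And>B. \<exists>K. \<forall>n. \<forall>u\<in>{0..B}. norm (F n u) \<le> K"
    and tail: "\<And>n B B'. 1 \<le> B \<Longrightarrow> B \<le> B' \<Longrightarrow> norm (integral {B..B'} (F n)) \<le> C / B"
  obtains L where "((\<lambda>B. integral {0..B} F0) \<longlongrightarrow> L) at_top"
    and "(\<lambda>n. \<integral>u. indicator {0..} u *\<^sub>R F n u \<partial>lborel) \<longlonglongrightarrow> L"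
proof -
  define J where "J = (\<lambda>n. \<integral>u. indicator {0..} u *\<^sub>R F n u \<partial>lborel)"
  define A where "A = (\<lambda>B. integral {0..B} F0)"
  have intF: "F n integrable_on {a..b}" if "0 \<le> a" for n a b
    by (intro integrable_continuous_real continuous_on_subset[OF cont]) (use that in auto)
  have AF: "(\<lambda>n. integral {0..B} (F n)) \<longlonglongrightarrow> A B" for B
  proof -
    obtain K where K: "\<And>n u. u \<in> {0..B} \<Longrightarrow> norm (F n u) \<le> K" using bdd[of B] by blast
    show ?thesis unfolding A_def
      by (rule dominated_convergence(2)[where h="\<lambda>_. K"]) (use K intF conv in auto)
  qed
  have C0: "C \<ge> 0" using tail[of 1 1] by simp
  have split: "integral {0..B'} (F n) - integral {0..B} (F n) = integral {B..B'} (F n)" if "0 \<le> B" "B \<le> B'" for n B B'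
    using Henstock_Kurzweil_Integration.integral_combine[of 0 B B' "F n"] intF that by (simp add: algebra_simps)
  have FF: "norm (integral {0..B'} (F n) - integral {0..B} (F n)) \<le> C / B" if "1 \<le> B" "B \<le> B'" for n B B'
    using tail[OF that] split[of B B' n] that by simp
  have AA: "norm (A B' - A B) \<le> C / B" if "1 \<le> B" "B \<le> B'" for B B'
    by (rule tendsto_upperbound[OF tendsto_norm[OF tendsto_diff[OF AF AF]]]) (use FF[OF that] in auto)
  have JL: "((\<lambda>B'. integral {0..B'} (F n)) \<longlongrightarrow> J n) at_top" for n
    unfolding J_def by (rule integral_Icc_tendsto_lborel[OF int])
  have JF: "norm (J n - integral {0..B} (F n)) \<le> C / B" if "1 \<le> B" for n B
  proof (rule tendsto_upperbound[OF tendsto_norm[OF tendsto_diff[OF JL tendsto_const]]])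
    show "\<forall>\<^sub>F B' in at_top. norm (integral {0..B'} (F n) - integral {0..B} (F n)) \<le> C / B"
      using eventually_ge_at_top[of B] by eventually_elim (use FF that in auto)
  qed simp
  have CB: "((\<lambda>B. C / B) \<longlongrightarrow> 0) at_top" by real_asymp
  have "Cauchy (\<lambda>m. A (real (Suc m)))"
  proof (rule metric_CauchyI)
    fix \<epsilon> :: real assume "\<epsilon> > 0"
    then have "\<forall>\<^sub>F B in at_top. C / B < \<epsilon>" using order_tendstoD(2)[OF CB] by blast
    then obtain N where N: "\<And>B. B \<ge> N \<Longrightarrow> C / B < \<epsilon>" by (auto simp: eventually_at_top_linorder)
    have *: "dist (A (real (Suc m))) (A (real (Suc n))) < \<epsilon>" if "m \<ge> nat \<lceil>N\<rceil>" "m \<le> n" for m n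
      using AA[of "real (Suc m)" "real (Suc n)"] N[of "real (Suc m)"] that by (simp add: dist_norm norm_minus_commute)
    show "\<exists>M. \<forall>m\<ge>M. \<forall>n\<ge>M. dist (A (real (Suc m))) (A (real (Suc n))) < \<epsilon>"
      using * by (metis dist_commute linorder_le_cases)
  qed
  then obtain L where L: "(\<lambda>m. A (real (Suc m))) \<longlonglongrightarrow> L"
    using Cauchy_convergent_iff convergent_def by blast
  have AL: "norm (L - A B) \<le> C / B" if "1 \<le> B" for B
  proof (rule tendsto_upperbound[OF tendsto_norm[OF tendsto_diff[OF L tendsto_const]]])
    show "\<forall>\<^sub>F m in sequentially. norm (A (real (Suc m)) - A B) \<le> C / B"
      using eventually_ge_at_top[of "nat \<lceil>B\<rceil>"] 
    proof eventually_elim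
      case (elim m)
      then have "B \<le> real (Suc m)" by linarith
      with that show ?case by (rule AA)
    qed
  qed simp
  have "((\<lambda>B. A B - L) \<longlongrightarrow> 0) at_top"
  proof (rule Lim_null_comparison[OF _ CB])
    show "\<forall>\<^sub>F B in at_top. norm (A B - L) \<le> C / B"
      using eventually_ge_at_top[of 1] by eventually_elim (use AL in \<open>simp add: norm_minus_commute\<close>)
  qed
  then have 1: "(A \<longlongrightarrow> L) at_top" by (simp add: LIM_zero_iff)
  have 2: "J \<longlonglongrightarrow> L"
  proof (rule LIMSEQ_I)
    fix \<epsilon> :: real assume e: "\<epsilon> > 0"
    then have "\<forall>\<^sub>F B in at_top. C / B < \<epsilon> / 3" using order_tendstoD(2)[OF CB, of "\<epsilon>/3"] by simp
    then obtain N where N: "\<And>B. B \<ge> N \<Longrightarrow> C / B < \<epsilon> / 3" by (auto simp: eventually_at_top_linorder)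
    define B where "B = max N 1"
    have B: "C / B < \<epsilon> / 3" "1 \<le> B" using N[of B] by (auto simp: B_def)
    obtain M where M: "\<And>n. n \<ge> M \<Longrightarrow> norm (integral {0..B} (F n) - A B) < \<epsilon> / 3"
      using LIMSEQ_D[OF AF[of B], of "\<epsilon>/3"] e by auto
    show "\<exists>M. \<forall>n\<ge>M. norm (J n - L) < \<epsilon>"
    proof (intro exI allI impI)
      fix n assume n: "n \<ge> M"
      have "norm (J n - L) \<le> norm (J n - integral {0..B} (F n)) + norm (integral {0..B} (F n) - A B) + norm (L - A B)"
        by norm
      then show "norm (J n - L) < \<epsilon>" using JF[OF B(2), of n] M[OF n] AL[OF B(2)] B(1) by simp
    qed
  qed
  show ?thesis by (rule that[OF 1[unfolded A_def] 2[unfolded J_def]])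
qed

text \<open>The u-integrand folded onto u >= 0. Direction \<zeta> and exponent \<open>w2\<close> are
  independent parameters, so one function covers all stages of the regularisation;
  \<open>w2 = - 2 * \<i>\<close> is the value on the ray through 1 - \<i>.\<close>

definition ray_fun :: "nat \<Rightarrow> (nat \<Rightarrow> real) \<Rightarrow> complex \<Rightarrow> complex \<Rightarrow> real \<Rightarrow> complex" where
  "ray_fun d \<tau> \<zeta> w2 u = ((\<Prod>j\<le>d. Phi (of_real (\<tau> j) * \<zeta> * of_real u)) +
        (\<Prod>j\<le>d. Phi (- (of_real (\<tau> j) * \<zeta> * of_real u)))) * exp (- (w2 * (of_real u)\<^sup>2 / 2))"

text \<open>\<open>C\<close> depends on \<rho> and R but not on \<zeta> or \<open>w2\<close>, which
  gives the uniformity needed in the limit. Sign conditions on the two extreme exponents, those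
  without and with all factors \<psi>, control every intermediate one; lower bounds on the modulus
  are required only for at most one factor.\<close>

lemma product_tail_le:
  fixes \<tau> :: "nat \<Rightarrow> real"
  assumes d: "d \<ge> 1" and \<tau>: "\<And>j. j \<le> d \<Longrightarrow> \<tau> j > 0" and \<rho>: "\<rho> > 0"
  obtains C where "\<And>\<zeta> w2 B B'. \<lbrakk>Re \<zeta> \<ge> \<rho>; norm \<zeta> \<le> R; Re w2 \<ge> 0;
      Re (w2 + of_real (\<Sum>j\<le>d. (\<tau> j)\<^sup>2) * \<zeta>\<^sup>2) \<ge> 0; norm w2 \<ge> \<rho>;
      \<And>j. j \<le> d \<Longrightarrow> norm (w2 + of_real ((\<tau> j)\<^sup>2) * \<zeta>\<^sup>2) \<ge> \<rho>; 1 \<le> B; B \<le> B'\<rbrakk> \<Longrightarrow>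
      norm (integral {B..B'} (ray_fun d \<tau> \<zeta> w2)) \<le> C / B"
proof -
  define \<mu> M where "\<mu> = Min (\<tau> ` {..d})" and "M = Max (\<tau> ` {..d})"
  have \<mu>: "\<mu> > 0" "\<And>j. j \<le> d \<Longrightarrow> \<mu> \<le> \<tau> j" and M: "\<And>j. j \<le> d \<Longrightarrow> \<tau> j \<le> M"
    unfolding \<mu>_def M_def using \<tau> by auto
  define A where "A = max 1 (1 / (\<mu> * \<rho>))"
  have A: "A \<ge> 1" "1 / (\<mu> * \<rho>) \<le> A" by (auto simp: A_def)
  have M0: "M > 0" using M[of 0] \<tau>[of 0] by simp
  define G where "G = A ^ Suc d + 4 * M * \<bar>R\<bar> * A\<^sup>2"
  have AG: "A \<le> G" "A ^ Suc d \<le> G" "1 \<le> G" "4 * M * \<bar>R\<bar> * A\<^sup>2 \<le> G"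
  proof -
    have "0 \<le> 4 * M * \<bar>R\<bar> * A\<^sup>2" using M0 by simp
    moreover have "A \<le> A ^ Suc d" using A by (intro self_le_power) auto
    ultimately have "A \<le> G \<and> A ^ Suc d \<le> G \<and> 1 \<le> G \<and> 4 * M * \<bar>R\<bar> * A\<^sup>2 \<le> G"
      using A unfolding G_def by (intro conjI) linarith+
    then show "A \<le> G" "A ^ Suc d \<le> G" "1 \<le> G" "4 * M * \<bar>R\<bar> * A\<^sup>2 \<le> G" by blast+
  qed
  \<comment> \<open>One summand for each of the 2^(d + 1) subsets of the indices and one more for
    the reflected product.\<close>
  define C where "C = (2 ^ Suc d + 1) * (4 * G / \<rho> + G)"
  show ?thesis
  proof (rule that[of C])
    fix \<zeta> w2 :: complex and B B' :: real
    assume z: "Re \<zeta> \<ge> \<rho>" "norm \<zeta> \<le> R" and w: "Re w2 \<ge> 0" "Re (w2 + of_real (\<Sum>j\<le>d. (\<tau> j)\<^sup>2) * \<zeta>\<^sup>2) \<ge> 0" "norm w2 \<ge> \<rho>"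
      and wj: "\<And>j. j \<le> d \<Longrightarrow> norm (w2 + of_real ((\<tau> j)\<^sup>2) * \<zeta>\<^sup>2) \<ge> \<rho>" and B: "1 \<le> B" "B \<le> B'"
    define m where "m = (\<lambda>j u. mills (of_real (\<tau> j) * \<zeta> * of_real u))"
    define \<alpha> where "\<alpha> = (\<lambda>S. w2 + of_real (\<Sum>j\<in>S. (\<tau> j)\<^sup>2) * \<zeta>\<^sup>2)"
    \<comment> \<open>\<open>T S\<close> is the term in which exactly the indices in S contribute
      Phi (- z) = exp (- z^2 / 2) \<open>mills z\<close>; all Gaussians are merged into the exponent
      \<open>\<alpha> S\<close>.\<close>
    define T where "T = (\<lambda>S u. exp (- (\<alpha> S * (of_real u)\<^sup>2 / 2)) * (\<Prod>j\<in>S. m j u))"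
    have R0: "R \<ge> 0" using z(2) norm_ge_zero order_trans by blast
    have m_le: "norm (m j u) \<le> A / u" if "j \<le> d" "u > 0" for j u
    proof -
      have pos: "\<mu> * \<rho> * u > 0" using \<mu> \<rho> that by simp
      have "\<mu> * \<rho> * u \<le> Re (of_real (\<tau> j) * \<zeta> * of_real u)"
        using \<mu> \<rho> z that by (auto intro!: mult_mono mult_right_mono less_imp_le[OF \<tau>])
      then have "norm (m j u) \<le> 1 / (\<mu> * \<rho> * u)"
        unfolding m_def using pos by (intro order_trans[OF norm_mills_le] divide_left_mono) auto
      also have "\<dots> = 1 / (\<mu> * \<rho>) / u" by simp
      also have "\<dots> \<le> A / u" using A that by (intro divide_right_mono) auto
      finally show ?thesis .
    qed
    have m_le_A: "norm (m j u) \<le> A" if "j \<le> d" "u \<ge> 1" for j u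
    proof -
      have "norm (m j u) \<le> A / u" using m_le that by simp
      also have "\<dots> \<le> A / 1" using A that by (intro divide_left_mono) auto
      finally show ?thesis by simp
    qed
    have dm: "(m j has_vector_derivative (of_real (\<tau> j) * \<zeta>) * deriv mills (of_real (\<tau> j) * \<zeta> * of_real u)) (at u within X)" for j u X
    proof -
      have "(mills has_field_derivative deriv mills (of_real (\<tau> j) * \<zeta> * of_real u)) (at (of_real (\<tau> j) * \<zeta> * of_real u))"
        using holomorphic_derivI[OF holomorphic_on_mills[of UNIV]] by simp
      then have "((\<lambda>x. mills (of_real (\<tau> j) * \<zeta> * x)) has_field_derivative
          deriv mills (of_real (\<tau> j) * \<zeta> * of_real u) * (of_real (\<tau> j) * \<zeta>)) (at (of_real u))"
        by (rule DERIV_chain2) (auto intro!: derivative_eq_intros)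
      from has_vector_derivative_real_field[OF this] show ?thesis by (simp add: m_def mult.commute)
    qed
    have dm_le: "norm ((of_real (\<tau> j) * \<zeta>) * deriv mills (of_real (\<tau> j) * \<zeta> * of_real u)) \<le> G / u" if "j \<le> d" "u \<ge> 1" for j u
    proof -
      have pos: "\<mu> * \<rho> * u > 0" using \<mu> \<rho> that by simp
      have le: "\<mu> * \<rho> * u \<le> Re (of_real (\<tau> j) * \<zeta> * of_real u)"
        using \<mu> \<rho> z that by (auto intro!: mult_mono mult_right_mono less_imp_le[OF \<tau>])
      have "norm (deriv mills (of_real (\<tau> j) * \<zeta> * of_real u)) \<le> 4 / (\<mu> * \<rho> * u)\<^sup>2"
      proof -
        define y where "y = Re (of_real (\<tau> j) * \<zeta> * of_real u)"
        have y: "0 < y" "\<mu> * \<rho> * u \<le> y" using pos le by (auto simp only: y_def)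
        have "norm (deriv mills (of_real (\<tau> j) * \<zeta> * of_real u)) \<le> 4 / y\<^sup>2"
          using norm_deriv_mills_le y(1) unfolding y_def .
        also have "\<dots> \<le> 4 / (\<mu> * \<rho> * u)\<^sup>2"
          using y pos by (intro divide_left_mono power_mono) (auto simp only: zero_less_power mult_pos_pos less_imp_le)
        finally show ?thesis .
      qed
      also have "\<dots> = 4 * (1 / (\<mu> * \<rho>))\<^sup>2 / u\<^sup>2" by (simp add: power_mult_distrib power_divide)
      also have "\<dots> \<le> 4 * A\<^sup>2 / u\<^sup>2" using A \<mu> \<rho> by (intro divide_right_mono mult_left_mono power_mono) auto
      also have "\<dots> \<le> 4 * A\<^sup>2 / u" using that self_le_power[of u 2] by (intro divide_left_mono) auto
      finally have 1: "norm (deriv mills (of_real (\<tau> j) * \<zeta> * of_real u)) \<le> 4 * A\<^sup>2 / u" .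
      have "norm ((of_real (\<tau> j) * \<zeta>) * deriv mills (of_real (\<tau> j) * \<zeta> * of_real u)) \<le> (M * R) * (4 * A\<^sup>2 / u)"
        unfolding norm_mult using \<tau>[OF that(1)] M[OF that(1)] z R0 M0 1 by (intro mult_mono) auto
      also have "\<dots> = 4 * M * \<bar>R\<bar> * A\<^sup>2 / u" using R0 by simp
      also have "\<dots> \<le> G / u" using AG that by (intro divide_right_mono) auto
      finally show ?thesis .
    qed
    \<comment> \<open>\<open>\<alpha> S\<close> is the convex combination, with weight \<sigma> / s,
      of the two extreme exponents.\<close>
    have Re\<alpha>: "Re (\<alpha> S) \<ge> 0" if "S \<subseteq> {..d}" for S
    proof -
      define s \<sigma> where "s = (\<Sum>j\<le>d. (\<tau> j)\<^sup>2)" and "\<sigma> = (\<Sum>j\<in>S. (\<tau> j)\<^sup>2)"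
      have \<sigma>: "0 \<le> \<sigma>" "\<sigma> \<le> s" unfolding s_def \<sigma>_def using that by (auto intro!: sum_nonneg sum_mono2)
      have s0: "s > 0" unfolding s_def by (intro sum_pos zero_less_power \<tau>) auto
      define z2 where "z2 = \<zeta>\<^sup>2"
      have "Re (\<alpha> S) = (1 - \<sigma> / s) * Re w2 + \<sigma> / s * Re (w2 + of_real s * \<zeta>\<^sup>2)"
        unfolding \<alpha>_def \<sigma>_def[symmetric] z2_def[symmetric] using s0 by (simp add: field_simps)
      also have "\<dots> \<ge> 0" using \<sigma> s0 w unfolding s_def[symmetric] by (intro add_nonneg_nonneg mult_nonneg_nonneg) auto
      finally show ?thesis .
    qed
    have contT: "continuous_on {B..B'} (T S)" for S
      unfolding T_def by (intro continuous_intros continuous_on_vector_derivative[OF dm]) auto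
    have intT: "T S integrable_on {B..B'}" for S
      by (rule integrable_continuous_real[OF contT])
    \<comment> \<open>Two Mills factors already give the integrable bound 1 / u^2. With none or one,
      oscillation is needed: the exponent is then \<open>w2\<close> or \<open>w2\<close> +
      \<tau>_j^2 \<zeta>^2, both at least \<rho> in modulus.\<close>
    have T_le: "norm (integral {B..B'} (T S)) \<le> (4 * G / \<rho> + G) / B" if S: "S \<subseteq> {..d}" for S
    proof (cases "card S \<ge> 2")
      case True
      have finS: "finite S" using S finite_subset by blast
      have "norm (integral {B..B'} (T S)) \<le> G / B"
      proof (rule norm_integral_inverse_square_le[OF _ B(2) intT])
        fix u assume u: "u \<in> {B..B'}"
        then have u1: "u \<ge> 1" using B by simp
        have "norm (T S u) \<le> 1 * (\<Prod>j\<in>S. norm (m j u))"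
          unfolding T_def norm_mult prod_norm[symmetric] using Re\<alpha>[OF S]
          by (intro mult_right_mono) (auto simp: prod_nonneg simp flip: of_real_power)
        also have "\<dots> \<le> 1 * (\<Prod>j\<in>S. A / u)"
          using u1 S by (intro mult_left_mono prod_mono) (auto intro!: m_le)
        also have "\<dots> = A ^ card S / u ^ card S" by (simp add: power_divide)
        also have "\<dots> \<le> A ^ Suc d / u ^ 2"
          using A u1 True card_mono[OF _ S] by (intro frac_le power_increasing) auto
        also have "\<dots> \<le> G / u\<^sup>2" using AG by (intro divide_right_mono) auto
        finally show "norm (T S u) \<le> G / u\<^sup>2" .
      qed (use B AG in auto)
      also have "\<dots> \<le> (4 * G / \<rho> + G) / B" using AG \<rho> B by (intro divide_right_mono) auto
      finally show ?thesis .
    next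
      case False
      have finS: "finite S" using S finite_subset by blast
      define g where "g = (\<lambda>u. \<Prod>j\<in>S. m j u)"
      have "\<exists>g'. (\<forall>u\<in>{B..B'}. (g has_vector_derivative g' u) (at u within {B..B'}) \<and> norm (g u) \<le> G \<and> norm (g' u) \<le> G / u) \<and> norm (\<alpha> S) \<ge> \<rho>"
      proof (cases "S = {}")
        case True
        then show ?thesis using AG B w by (intro exI[of _ "\<lambda>_. 0"]) (auto simp: g_def \<alpha>_def)
      next
        case False
        with \<open>\<not> card S \<ge> 2\<close> finS have "card S = 1" by (simp add: card_gt_0_iff le_Suc_eq not_le less_Suc_eq numeral_2_eq_2)
        then obtain j where j: "S = {j}" using card_1_singletonE by blast
        then have jd: "j \<le> d" using S by auto
        have "g = m j" by (auto simp: g_def j)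
        then show ?thesis using dm dm_le[OF jd] order_trans[OF m_le_A[OF jd] AG(1)] B wj[OF jd]
          by (intro exI[of _ "\<lambda>u. (of_real (\<tau> j) * \<zeta>) * deriv mills (of_real (\<tau> j) * \<zeta> * of_real u)"])
            (auto simp: \<alpha>_def j)
      qed
      then obtain g' where g': "\<And>u. u \<in> {B..B'} \<Longrightarrow> (g has_vector_derivative g' u) (at u within {B..B'})"
          "\<And>u. u \<in> {B..B'} \<Longrightarrow> norm (g u) \<le> G" "\<And>u. u \<in> {B..B'} \<Longrightarrow> norm (g' u) \<le> G / u" and \<alpha>: "norm (\<alpha> S) \<ge> \<rho>"
        by blast
      have Tg: "T S = (\<lambda>u. exp (- (\<alpha> S * (of_real u)\<^sup>2 / 2)) * g u)"
        by (simp add: T_def g_def)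
      have "norm (integral {B..B'} (T S)) \<le> 4 * G / (norm (\<alpha> S) * B)"
        unfolding Tg
        by (rule oscillatory_tail_le[OF _ Re\<alpha>[OF S] _ B(2) g']) (use \<alpha> \<rho> B in auto)
      also have "\<dots> \<le> 4 * G / (\<rho> * B)"
        using \<alpha> \<rho> B AG less_le_trans[OF \<rho> \<alpha>] by (intro divide_left_mono mult_right_mono mult_pos_pos) auto
      also have "\<dots> = (4 * G / \<rho>) / B" by simp
      also have "\<dots> \<le> (4 * G / \<rho> + G) / B" using AG \<rho> B by (intro divide_right_mono) auto
      finally show ?thesis .
    qed
    have prod_exp: "(\<Prod>j\<in>S. exp (- ((of_real (\<tau> j) * \<zeta> * of_real u)\<^sup>2 / 2))) * exp (- (w2 * (of_real u)\<^sup>2 / 2)) = exp (- (\<alpha> S * (of_real u)\<^sup>2 / 2))" if "finite S" for S u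
    proof -
      have "(\<Sum>j\<in>S. - ((of_real (\<tau> j) * \<zeta> * of_real u)\<^sup>2 / 2)) = - (of_real (\<Sum>j\<in>S. (\<tau> j)\<^sup>2) * (\<zeta>\<^sup>2 * (of_real u)\<^sup>2 / 2))"
        unfolding of_real_sum sum_distrib_right sum_negf by (simp add: power_mult_distrib mult.assoc)
      then show ?thesis
        unfolding exp_sum[OF that, symmetric] exp_add[symmetric] \<alpha>_def by (simp add: algebra_simps add_divide_distrib)
    qed
    have trm: "(\<Prod>j\<in>S. Phi (- (of_real (\<tau> j) * \<zeta> * of_real u))) * exp (- (w2 * (of_real u)\<^sup>2 / 2)) = T S u" if "finite S" for S u
      unfolding T_def prod_exp[OF that, symmetric] m_def
      by (simp only: Phi_minus_eq_mills prod.distrib) (simp only: mult_ac)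
    \<comment> \<open>The first product is expanded over subsets after Phi (z) = 1 - Phi (- z). The
      reflected product is already the single term with S = {..d}, which has at least two factors
      since d >= 1.\<close>
    have "ray_fun d \<tau> \<zeta> w2 u =
        (\<Sum>S\<in>Pow {..d}. (-1) ^ card S * T S u) + T {..d} u" for u
    proof -
      have "(\<Prod>j\<le>d. Phi (of_real (\<tau> j) * \<zeta> * of_real u)) = (\<Prod>j\<le>d. - Phi (- (of_real (\<tau> j) * \<zeta> * of_real u)) + 1)"
        by (simp add: Phi_minus)
      also have "\<dots> = (\<Sum>S\<in>Pow {..d}. (-1) ^ card S * (\<Prod>j\<in>S. Phi (- (of_real (\<tau> j) * \<zeta> * of_real u))))"
        by (subst prod_add) (simp_all add: prod_uminus)
      finally have "(\<Prod>j\<le>d. Phi (of_real (\<tau> j) * \<zeta> * of_real u)) * exp (- (w2 * (of_real u)\<^sup>2 / 2)) =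
          (\<Sum>S\<in>Pow {..d}. (-1) ^ card S * ((\<Prod>j\<in>S. Phi (- (of_real (\<tau> j) * \<zeta> * of_real u))) * exp (- (w2 * (of_real u)\<^sup>2 / 2))))"
        by (simp only: sum_distrib_right mult.assoc)
      also have "\<dots> = (\<Sum>S\<in>Pow {..d}. (-1) ^ card S * T S u)"
        by (intro sum.cong refl arg_cong2[where f="(*)"] trm) (auto dest: finite_subset)
      finally show ?thesis unfolding ray_fun_def distrib_right trm[OF finite_atMost] by simp
    qed
    then have eq: "ray_fun d \<tau> \<zeta> w2 = (\<lambda>u. (\<Sum>S\<in>Pow {..d}. (-1) ^ card S * T S u) + T {..d} u)"
      by (rule ext)
    have "norm (integral {B..B'} (ray_fun d \<tau> \<zeta> w2)) =
        norm ((\<Sum>S\<in>Pow {..d}. (-1) ^ card S * integral {B..B'} (T S)) + integral {B..B'} (T {..d}))"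
      unfolding eq by (simp add: Henstock_Kurzweil_Integration.integral_add Henstock_Kurzweil_Integration.integral_sum
        integrable_sum Henstock_Kurzweil_Integration.integrable_on_mult_right intT)
    also have "\<dots> \<le> (\<Sum>S\<in>Pow {..d}. norm ((-1) ^ card S * integral {B..B'} (T S))) + norm (integral {B..B'} (T {..d}))"
      by (intro order_trans[OF norm_triangle_ineq] add_mono norm_sum order_refl)
    also have "\<dots> \<le> (\<Sum>S\<in>Pow {..d}. (4 * G / \<rho> + G) / B) + (4 * G / \<rho> + G) / B"
      using T_le by (intro add_mono sum_mono) (auto simp: norm_mult norm_power)
    also have "\<dots> = C / B"
    proof -
      define Y where "Y = 4 * G / \<rho> + G"
      show ?thesis unfolding C_def Y_def[symmetric] by (simp add: card_Pow distrib_right add_divide_distrib)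
    qed
    finally show "norm (integral {B..B'} (ray_fun d \<tau> \<zeta> w2)) \<le> C / B" .
  qed
qed

section \<open>Product integrals and linear substitutions\<close>

lemma
  fixes f :: "'a::euclidean_space \<Rightarrow> real \<Rightarrow> 'b::{real_normed_field,banach,second_countable_topology}"
  assumes "\<And>b. b \<in> Basis \<Longrightarrow> integrable lborel (f b)"
  shows integrable_prod_Basis: "integrable lborel (\<lambda>x::'a. \<Prod>b\<in>Basis. f b (x \<bullet> b))"
    and integral_prod_Basis: "(\<integral>x. (\<Prod>b\<in>Basis. f b (x \<bullet> b)) \<partial>lborel) = (\<Prod>b\<in>Basis. integral\<^sup>L lborel (f b))"
proof -
  interpret product_sigma_finite "\<lambda>_::'a. lborel :: real measure" by unfold_locales
  have m: "(\<lambda>x::'a. \<Prod>b\<in>Basis. f b (x \<bullet> b)) \<in> borel_measurable borel"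
  proof (rule borel_measurable_prod)
    fix b :: 'a assume "b \<in> Basis"
    then have [measurable]: "f b \<in> borel_measurable borel" using borel_measurable_integrable[OF assms] by simp
    show "(\<lambda>x. f b (x \<bullet> b)) \<in> borel_measurable borel" by measurable
  qed
  have T: "(\<lambda>f. \<Sum>b\<in>(Basis::'a set). f b *\<^sub>R b) \<in> (\<Pi>\<^sub>M b\<in>Basis. lborel) \<rightarrow>\<^sub>M borel"
    by measurable
  show "integrable lborel (\<lambda>x::'a. \<Prod>b\<in>Basis. f b (x \<bullet> b))"
    unfolding lborel_eq[where 'a='a]
    by (subst integrable_distr_eq[OF T m])
      (simp add: inner_sum_left_Basis product_integrable_prod assms cong: prod.cong)
  show "(\<integral>x. (\<Prod>b\<in>Basis. f b (x \<bullet> b)) \<partial>lborel) = (\<Prod>b\<in>Basis. integral\<^sup>L lborel (f b))"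
    unfolding lborel_eq[where 'a='a]
    by (subst integral_distr[OF T m])
      (simp add: inner_sum_left_Basis product_integral_prod assms cong: prod.cong)
qed

lemma
  fixes f :: "'n::finite \<Rightarrow> real \<Rightarrow> 'b::{real_normed_field,banach,second_countable_topology}"
  assumes "\<And>i. integrable lborel (f i)"
  shows integrable_prod_vec: "integrable lborel (\<lambda>x::real^'n. \<Prod>i\<in>UNIV. f i (x $ i))"
    and integral_prod_vec: "(\<integral>x. (\<Prod>i\<in>UNIV. f i (x $ i)) \<partial>(lborel :: (real^'n) measure)) = (\<Prod>i\<in>UNIV. integral\<^sup>L lborel (f i))"
proof -
  define ax :: "'n \<Rightarrow> real^'n" where "ax = (\<lambda>i. axis i 1)"
  have inj: "inj ax" by (auto simp: ax_def inj_on_def axis_eq_axis)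
  have B: "Basis = range ax" by (auto simp: ax_def Basis_vec_def)
  define F where "F = (\<lambda>b. f (inv ax b))"
  have F: "F (ax i) = f i" for i by (simp add: F_def inj)
  have inn: "x \<bullet> ax i = x $ i" for x :: "real^'n" and i by (simp add: ax_def inner_axis)
  have eq: "(\<Prod>b\<in>Basis. F b (x \<bullet> b)) = (\<Prod>i\<in>UNIV. f i (x $ i))" for x :: "real^'n"
    unfolding B by (subst prod.reindex[OF inj]) (simp add: F inn)
  have eq2: "(\<Prod>b\<in>(Basis::(real^'n) set). integral\<^sup>L lborel (F b)) = (\<Prod>i\<in>UNIV. integral\<^sup>L lborel (f i))"
    unfolding B by (subst prod.reindex[OF inj]) (simp add: F)
  have int: "integrable lborel (F b)" if "b \<in> Basis" for b using assms by (simp add: F_def)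
  show "integrable lborel (\<lambda>x::real^'n. \<Prod>i\<in>UNIV. f i (x $ i))"
    using integrable_prod_Basis[of F, OF int] by (simp add: eq)
  show "(\<integral>x. (\<Prod>i\<in>UNIV. f i (x $ i)) \<partial>(lborel :: (real^'n) measure)) = (\<Prod>i\<in>UNIV. integral\<^sup>L lborel (f i))"
    using integral_prod_Basis[of F, OF int] by (simp add: eq eq2)
qed

lemma
  fixes f :: "'a::euclidean_space \<Rightarrow> 'c::{real_normed_field,banach,second_countable_topology}" and g :: "'b::euclidean_space \<Rightarrow> 'c"
  assumes f: "integrable lborel f" and g: "integrable lborel g"
  shows integrable_lborel_times: "integrable lborel (\<lambda>z::'a \<times> 'b. f (fst z) * g (snd z))"
    and integral_lborel_times: "(\<integral>z. f (fst z) * g (snd z) \<partial>lborel) = integral\<^sup>L lborel f * integral\<^sup>L lborel g"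
proof -
  have [measurable]: "f \<in> borel_measurable borel" "g \<in> borel_measurable borel"
    using borel_measurable_integrable[OF f] borel_measurable_integrable[OF g] by simp_all
  have i: "integrable (lborel \<Otimes>\<^sub>M lborel) (\<lambda>z. f (fst z) * g (snd z))"
  proof (rule lborel_pair.Fubini_integrable)
    show "integrable lborel (\<lambda>x. LINT y|lborel. norm (f (fst (x, y)) * g (snd (x, y))))"
      using f g by (simp add: norm_mult)
    show "AE x in lborel. integrable lborel (\<lambda>y. f (fst (x, y)) * g (snd (x, y)))"
      using g by simp
  qed measurable
  then show "integrable lborel (\<lambda>z::'a \<times> 'b. f (fst z) * g (snd z))"
    by (simp add: lborel_prod)
  have "(\<integral>z. f (fst z) * g (snd z) \<partial>(lborel \<Otimes>\<^sub>M lborel)) = (\<integral>x. \<integral>y. f x * g y \<partial>lborel \<partial>lborel)"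
    using lborel_pair.integral_fst'[OF i] by simp
  then show "(\<integral>z. f (fst z) * g (snd z) \<partial>lborel) = integral\<^sup>L lborel f * integral\<^sup>L lborel g"
    by (simp add: lborel_prod)
qed

lemma integral_lborel_swap:
  fixes f :: "'a::euclidean_space \<Rightarrow> 'b::euclidean_space \<Rightarrow> 'c::{banach,second_countable_topology}"
  assumes "integrable lborel (\<lambda>z. f (fst z) (snd z))"
  shows "(\<integral>x. \<integral>y. f x y \<partial>lborel \<partial>lborel) = (\<integral>y. \<integral>x. f x y \<partial>lborel \<partial>lborel)"
    and "(\<integral>x. \<integral>y. f x y \<partial>lborel \<partial>lborel) = (\<integral>z. f (fst z) (snd z) \<partial>lborel)"
proof -
  have i: "integrable (lborel \<Otimes>\<^sub>M lborel) (\<lambda>(x, y). f x y)"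
    using assms by (simp add: lborel_prod split_beta')
  show "(\<integral>x. \<integral>y. f x y \<partial>lborel \<partial>lborel) = (\<integral>y. \<integral>x. f x y \<partial>lborel \<partial>lborel)"
    using lborel_pair.Fubini_integral[OF i] by simp
  show "(\<integral>x. \<integral>y. f x y \<partial>lborel \<partial>lborel) = (\<integral>z. f (fst z) (snd z) \<partial>lborel)"
    using lborel_pair.integral_fst'[OF i] by (simp add: lborel_prod split_beta')
qed

section \<open>Translations, linear substitutions and scalings of Lebesgue measure\<close>

lemma nn_integral_lborel_translate:
  fixes f :: "'a::euclidean_space \<Rightarrow> ennreal"
  assumes [measurable]: "f \<in> borel_measurable borel"
  shows "(\<integral>\<^sup>+x. f (t + x) \<partial>lborel) = (\<integral>\<^sup>+x. f x \<partial>lborel)"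
    and "(\<integral>\<^sup>+x. f (t - x) \<partial>lborel) = (\<integral>\<^sup>+x. f x \<partial>lborel)"
proof -
  have "(\<integral>\<^sup>+x. f x \<partial>lborel) = (\<integral>\<^sup>+x. f (t + c *\<^sub>R x) \<partial>lborel)" if "\<bar>c\<bar> = 1" for c
  proof -
    have "c \<noteq> 0" using that by auto
    from lborel_affine[OF this, of t] that
    have "(lborel :: 'a measure) = density (distr lborel borel (\<lambda>x. t + c *\<^sub>R x)) (\<lambda>_. 1)" by simp
    then have "(\<integral>\<^sup>+x. f x \<partial>lborel) = (\<integral>\<^sup>+x. f x \<partial>density (distr lborel borel (\<lambda>x. t + c *\<^sub>R x)) (\<lambda>_. 1))" by simp
    also have "\<dots> = (\<integral>\<^sup>+x. f (t + c *\<^sub>R x) \<partial>lborel)"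
      by (simp add: nn_integral_density nn_integral_distr)
    finally show ?thesis .
  qed
  from this[of 1] this[of "-1"]
  show "(\<integral>\<^sup>+x. f (t + x) \<partial>lborel) = (\<integral>\<^sup>+x. f x \<partial>lborel)"
    "(\<integral>\<^sup>+x. f (t - x) \<partial>lborel) = (\<integral>\<^sup>+x. f x \<partial>lborel)" by simp_all
qed

text \<open>The uniqueness argument for Haar measure, applied to Lebesgue measure and its image under \<open>g\<close>;
  it determines the Jacobian of \<open>g\<close> from one test function \<open>h\<close>, without computing a determinant.\<close>

lemma nn_integral_lborel_linear_ratio:
  fixes g :: "'a::euclidean_space \<Rightarrow> 'a" and f h :: "'a \<Rightarrow> ennreal"
  assumes g: "linear g" "inj g" and [measurable]: "f \<in> borel_measurable borel" "h \<in> borel_measurable borel"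
  shows "(\<integral>\<^sup>+x. f (g x) \<partial>lborel) * (\<integral>\<^sup>+y. h y \<partial>lborel) = (\<integral>\<^sup>+y. f y \<partial>lborel) * (\<integral>\<^sup>+x. h (g x) \<partial>lborel)"
proof -
  obtain i where i: "linear i" "\<And>x. i (g x) = x" "\<And>x. g (i x) = x"
    using linear_injective_isomorphism[OF g] by auto
  have [measurable]: "g \<in> borel_measurable borel" "i \<in> borel_measurable borel"
    using g(1) i(1) by (auto intro!: borel_measurable_continuous_onI linear_continuous_on simp: linear_conv_bounded_linear)
  have "(\<integral>\<^sup>+x. f (g x) \<partial>lborel) * (\<integral>\<^sup>+y. h y \<partial>lborel) = (\<integral>\<^sup>+y. (\<integral>\<^sup>+x. f (g x) * h y \<partial>lborel) \<partial>lborel)"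
    by (simp add: nn_integral_cmult nn_integral_multc)
  also have "\<dots> = (\<integral>\<^sup>+y. (\<integral>\<^sup>+x. f (g x + y) * h y \<partial>lborel) \<partial>lborel)"
  proof (rule nn_integral_cong)
    fix y
    show "(\<integral>\<^sup>+x. f (g x) * h y \<partial>lborel) = (\<integral>\<^sup>+x. f (g x + y) * h y \<partial>lborel)"
      using nn_integral_lborel_translate(1)[of "\<lambda>x. f (g x) * h y" "i y"]
      by (simp add: linear_add[OF g(1)] i add.commute)
  qed
  also have "\<dots> = (\<integral>\<^sup>+x. (\<integral>\<^sup>+y. f (g x + y) * h y \<partial>lborel) \<partial>lborel)"
    by (rule lborel_pair.Fubini') simp
  also have "\<dots> = (\<integral>\<^sup>+x. (\<integral>\<^sup>+y. f y * h (y - g x) \<partial>lborel) \<partial>lborel)"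
  proof (rule nn_integral_cong)
    fix x
    show "(\<integral>\<^sup>+y. f (g x + y) * h y \<partial>lborel) = (\<integral>\<^sup>+y. f y * h (y - g x) \<partial>lborel)"
      using nn_integral_lborel_translate(1)[of "\<lambda>y. f y * h (y - g x)" "g x"] by simp
  qed
  also have "\<dots> = (\<integral>\<^sup>+y. (\<integral>\<^sup>+x. f y * h (y - g x) \<partial>lborel) \<partial>lborel)"
    by (rule lborel_pair.Fubini'[symmetric]) simp
  also have "\<dots> = (\<integral>\<^sup>+y. (\<integral>\<^sup>+x. f y * h (g x) \<partial>lborel) \<partial>lborel)"
  proof (rule nn_integral_cong)
    fix y
    show "(\<integral>\<^sup>+x. f y * h (y - g x) \<partial>lborel) = (\<integral>\<^sup>+x. f y * h (g x) \<partial>lborel)"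
      using nn_integral_lborel_translate(2)[of "\<lambda>x. f y * h (g x)" "i y"]
      by (simp add: linear_diff[OF g(1)] i)
  qed
  also have "\<dots> = (\<integral>\<^sup>+y. f y \<partial>lborel) * (\<integral>\<^sup>+x. h (g x) \<partial>lborel)"
    by (simp add: nn_integral_cmult nn_integral_multc)
  finally show ?thesis .
qed

text \<open>The test function \<open>h\<close> calibrates the Jacobian: a / b is the ratio of its
  integrals without and with the substitution, and the ratio lemma for indicators transports this
  factor to all Borel sets.\<close>

lemma integral_lborel_linear:
  fixes g :: "'a::euclidean_space \<Rightarrow> 'a" and f :: "'a \<Rightarrow> 'b::{banach,second_countable_topology}" and h :: "'a \<Rightarrow> real"
  assumes g: "linear g" "inj g" and f [measurable]: "f \<in> borel_measurable borel"
    and h: "\<And>x. h x \<ge> 0" "has_bochner_integral lborel h a" "has_bochner_integral lborel (\<lambda>x. h (g x)) b" "a > 0" "b > 0"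
  shows "(\<integral>x. f x \<partial>lborel) = (a / b) *\<^sub>R (\<integral>x. f (g x) \<partial>lborel)"
proof -
  have [measurable]: "g \<in> borel_measurable borel"
    using g(1) by (intro borel_measurable_continuous_onI linear_continuous_on) (simp add: linear_conv_bounded_linear)
  have [measurable]: "h \<in> borel_measurable borel"
    using borel_measurable_has_bochner_integral[OF h(2)] by simp
  have ab: "(\<integral>\<^sup>+x. ennreal (h x) \<partial>lborel) = ennreal a" "(\<integral>\<^sup>+x. ennreal (h (g x)) \<partial>lborel) = ennreal b"
    using h by (auto simp: has_bochner_integral_iff nn_integral_eq_integral)
  have "(lborel :: 'a measure) = density (distr lborel borel g) (\<lambda>_. ennreal (a / b))" (is "_ = ?D")
  proof (rule measure_eqI)
    fix A :: "'a set" assume "A \<in> sets lborel"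
    then have A [measurable]: "A \<in> sets borel" by simp
    have gA: "g -` A \<in> sets borel" using measurable_sets_borel[of g borel A] by simp
    have "emeasure lborel (g -` A) * ennreal a = emeasure lborel A * ennreal b"
      using nn_integral_lborel_linear_ratio[OF g, of "indicator A" "\<lambda>x. ennreal (h x)"] A gA
      by (simp add: ab indicator_vimage[symmetric] del: indicator_vimage)
    then have "emeasure lborel A * ennreal b * ennreal (1 / b) = emeasure lborel (g -` A) * ennreal a * ennreal (1 / b)" by simp
    then have "emeasure lborel A = ennreal (a / b) * emeasure lborel (g -` A)"
      using h by (simp add: mult.assoc ennreal_mult[symmetric]) (simp add: mult.commute)
    also have "\<dots> = emeasure ?D A"
      by (simp add: emeasure_density nn_integral_cmult emeasure_distr)
    finally show "emeasure lborel A = emeasure ?D A" .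
  qed simp
  then have "(\<integral>x. f x \<partial>lborel) = (\<integral>x. f x \<partial>?D)" by simp
  also have "\<dots> = (a / b) *\<^sub>R (\<integral>x. f (g x) \<partial>lborel)"
    using h by (subst integral_density) (simp_all add: integral_distr)
  finally show ?thesis .
qed

lemma integral_lborel_scale:
  fixes f :: "'a::euclidean_space \<Rightarrow> 'b::{banach,second_countable_topology}"
  assumes "c \<noteq> 0" and f [measurable]: "f \<in> borel_measurable borel"
  shows "(\<integral>x. f x \<partial>lborel) = \<bar>c\<bar> ^ DIM('a) *\<^sub>R (\<integral>x. f (t + c *\<^sub>R x) \<partial>lborel)"
  by (subst lborel_affine[OF assms(1), of t], subst integral_density) (simp_all add: integral_distr)

section \<open>Orthocentric simplices\<close>

lemma sum_eq_0_if_nonneg: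
  fixes f :: "'a \<Rightarrow> real"
  assumes "finite A" "\<And>i. i \<in> A \<Longrightarrow> 0 \<le> f i" "sum f A \<le> 0" "i \<in> A"
  shows "f i = 0"
  using sum_nonneg_eq_0_iff[of A f] assms sum_nonneg[of A f] by force

lemma borel_measurable_vec_nth [measurable]: "(\<lambda>x::real^'n. x $ i) \<in> borel_measurable borel"
  by (intro borel_measurable_continuous_onI continuous_intros)

text \<open>\<open>idx\<close> numbers the coordinates by 1, ..., d, so that \<open>x $ i\<close>
  can carry the weight of the vertex \<open>v (idx i)\<close>. The vertex \<open>v 0\<close> is the
  base point, and \<open>g\<close> combines the edges leaving it.\<close>

locale orthocentric_simplex =
  fixes d :: nat and \<tau> :: "nat \<Rightarrow> real" and v :: "nat \<Rightarrow> real^'n" and idx :: "'n \<Rightarrow> nat"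
  assumes d_ge_2: "d \<ge> 2" and idx: "bij_betw idx UNIV {1..d}"
    and \<tau>_pos: "\<And>j. j \<le> d \<Longrightarrow> \<tau> j > 0"
    and ortho: "orthocentric d \<tau> v"
begin

definition "s = (\<Sum>j\<le>d. (\<tau> j)\<^sup>2)"
definition "Q = convex hull (v ` {0..d})"
definition "g x = (\<Sum>i\<in>UNIV. (x $ i) *\<^sub>R (v (idx i) - v 0))"

lemma card_n: "CARD('n) = d"
  using bij_betw_same_card[OF idx] by simp

lemma s_pos: "s > 0"
  unfolding s_def by (intro sum_pos zero_less_power \<tau>_pos) auto

lemma prod_\<tau>_pos: "(\<Prod>j\<le>d. \<tau> j) > 0"
  by (intro prod_pos \<tau>_pos) auto

lemma idx_range: "idx i \<in> {1..d}" "idx i \<le> d" "idx i \<noteq> 0"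
proof -
  show 1: "idx i \<in> {1..d}" using bij_betwE[OF idx] by blast
  show "idx i \<le> d" "idx i \<noteq> 0" using 1 by auto
qed

lemma atMost_idx: "{..d} = insert 0 {1..d}" by auto

lemma sum_idx: "(\<Sum>j\<le>d. F j) = F 0 + (\<Sum>i\<in>UNIV. F (idx i))"
  for F :: "nat \<Rightarrow> 'b::comm_monoid_add"
  unfolding atMost_idx using sum.reindex_bij_betw[OF idx, of F] by simp

lemma prod_idx: "(\<Prod>j\<le>d. F j) = F 0 * (\<Prod>i\<in>UNIV. F (idx i))"
  for F :: "nat \<Rightarrow> 'b::comm_monoid_mult"
  unfolding atMost_idx using prod.reindex_bij_betw[OF idx, of F] by simp

lemma inner_v: "j \<le> d \<Longrightarrow> k \<le> d \<Longrightarrow> v j \<bullet> v k = - 1 / s + (if j = k then 1 / (\<tau> j)\<^sup>2 else 0)"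
  using ortho by (auto simp: orthocentric_def s_def Let_def power2_norm_eq_inner)

text \<open>The Gram matrix is diagonal minus the rank-one matrix with all entries 1 / s.\<close>

lemma norm_comb: "(norm (\<Sum>j\<le>d. l j *\<^sub>R v j))\<^sup>2 = - (\<Sum>j\<le>d. l j)\<^sup>2 / s + (\<Sum>j\<le>d. (l j)\<^sup>2 / (\<tau> j)\<^sup>2)"
proof -
  have "(norm (\<Sum>j\<le>d. l j *\<^sub>R v j))\<^sup>2 = (\<Sum>j\<le>d. \<Sum>k\<le>d. l j * (l k * (v j \<bullet> v k)))"
    unfolding power2_norm_eq_inner by (simp add: inner_sum_left inner_sum_right sum_distrib_left inner_commute)
      (intro sum.cong refl, simp only: mult.left_commute)
  also have "\<dots> = (\<Sum>j\<le>d. \<Sum>k\<le>d. (l j * l k) * (- 1 / s) + (if j = k then (l j)\<^sup>2 / (\<tau> j)\<^sup>2 else 0))"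
    by (intro sum.cong refl) (auto simp: inner_v power2_eq_square algebra_simps)
  also have "\<dots> = (\<Sum>j\<le>d. \<Sum>k\<le>d. l j * l k) * (- 1 / s) + (\<Sum>j\<le>d. (l j)\<^sup>2 / (\<tau> j)\<^sup>2)"
    unfolding sum.distrib sum_distrib_right by simp
  also have "(\<Sum>j\<le>d. \<Sum>k\<le>d. l j * l k) = (\<Sum>j\<le>d. l j)\<^sup>2"
    by (simp add: power2_eq_square sum_product)
  finally show ?thesis by simp
qed

text \<open>The coefficients on the right add up to t, so the rank-one part of the quadratic form
  sees t only.\<close>

lemma g_comb: "t *\<^sub>R v 0 + g x = (\<Sum>j\<le>d. (if j = 0 then t - (\<Sum>i\<in>UNIV. x $ i) else x $ (inv idx j)) *\<^sub>R v j)"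
proof -
  have inj: "inj idx" using idx by (simp add: bij_betw_def)
  show ?thesis unfolding sum_idx
    by (simp add: idx_range(3) inj g_def scaleR_diff_right sum_subtractf scaleR_diff_left scaleR_left.sum)
qed

lemma norm_cone: "(norm (t *\<^sub>R v 0 + g x))\<^sup>2 =
   - t\<^sup>2 / s + (t - (\<Sum>i\<in>UNIV. x $ i))\<^sup>2 / (\<tau> 0)\<^sup>2 + (\<Sum>i\<in>UNIV. (x $ i)\<^sup>2 / (\<tau> (idx i))\<^sup>2)"
proof -
  have inj: "inj idx" using idx by (simp add: bij_betw_def)
  show ?thesis by (subst g_comb, subst norm_comb) (simp add: sum_idx inj idx_range(3))
qed

lemma linear_g: "linear g"
  by (rule linearI) (simp_all add: g_def scaleR_left_distrib sum.distrib scaleR_sum_right)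

text \<open>At t = 0 the negative term of \<open>norm_cone\<close> disappears and a positive
  definite form remains.\<close>

lemma inj_g: "inj g"
proof -
  have "x = 0" if "g x = 0" for x
  proof -
    have "0 = (\<Sum>i\<in>UNIV. x $ i)\<^sup>2 / (\<tau> 0)\<^sup>2 + (\<Sum>i\<in>UNIV. (x $ i)\<^sup>2 / (\<tau> (idx i))\<^sup>2)"
      using norm_cone[of 0 x] that by simp
    moreover have "(\<Sum>i\<in>UNIV. x $ i)\<^sup>2 / (\<tau> 0)\<^sup>2 \<ge> 0" by simp
    ultimately have "(\<Sum>i\<in>UNIV. (x $ i)\<^sup>2 / (\<tau> (idx i))\<^sup>2) \<le> 0" by linarith
    then have "(x $ i)\<^sup>2 / (\<tau> (idx i))\<^sup>2 = 0" for i
      by (intro sum_eq_0_if_nonneg[where A=UNIV and f="\<lambda>i. (x $ i)\<^sup>2 / (\<tau> (idx i))\<^sup>2"]) auto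
    then show "x = 0" using \<tau>_pos[OF idx_range(2)] by (auto simp: vec_eq_iff less_le)
  qed
  then show ?thesis using linear_g by (simp add: linear_injective_0)
qed

lemma g_measurable [measurable]: "g \<in> borel_measurable borel"
  using linear_g by (intro borel_measurable_continuous_onI linear_continuous_on) (simp add: linear_conv_bounded_linear)

lemma Q_eq: "Q = {v 0 + g p |p. (\<forall>i. 0 \<le> p $ i) \<and> (\<Sum>i\<in>UNIV. p $ i) \<le> 1}" (is "_ = ?S")
proof
  have inj: "inj idx" using idx by (simp add: bij_betw_def)
  show "Q \<subseteq> ?S" unfolding Q_def
  proof (rule hull_minimal)
    show "v ` {0..d} \<subseteq> ?S"
    proof (clarsimp)
      fix j assume j: "j \<le> d"
      show "\<exists>p. v j = v 0 + g p \<and> (\<forall>i. 0 \<le> p $ i) \<and> (\<Sum>i\<in>UNIV. p $ i) \<le> 1"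
      proof (cases "j = 0")
        case True
        then show ?thesis by (intro exI[of _ 0]) (simp add: g_def)
      next
        case False
        then have "j \<in> idx ` UNIV" using idx j by (auto simp: bij_betw_def)
        then obtain i where i: "j = idx i" by blast
        show ?thesis
          by (intro exI[of _ "axis i 1"]) (simp add: g_def i axis_def if_distrib[of "\<lambda>x. x *\<^sub>R _"] cong: if_cong)
      qed
    qed
    show "convex ?S"
    proof (rule convexI)
      fix x y and a b :: real assume xy: "x \<in> ?S" "y \<in> ?S" and ab: "0 \<le> a" "0 \<le> b" "a + b = 1"
      obtain p q :: "real^'n" where p: "x = v 0 + g p" "\<And>i. 0 \<le> p $ i" "(\<Sum>i\<in>UNIV. p $ i) \<le> 1"
        and q: "y = v 0 + g q" "\<And>i. 0 \<le> q $ i" "(\<Sum>i\<in>UNIV. q $ i) \<le> 1" using xy by blast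
      have "a *\<^sub>R x + b *\<^sub>R y = (a + b) *\<^sub>R v 0 + (a *\<^sub>R g p + b *\<^sub>R g q)"
        by (simp add: p q algebra_simps)
      also have "\<dots> = v 0 + g (a *\<^sub>R p + b *\<^sub>R q)"
        using ab by (simp add: linear_add[OF linear_g] linear_scale[OF linear_g])
      finally have "a *\<^sub>R x + b *\<^sub>R y = v 0 + g (a *\<^sub>R p + b *\<^sub>R q)" .
      moreover have "(\<Sum>i\<in>UNIV. (a *\<^sub>R p + b *\<^sub>R q) $ i) = a * (\<Sum>i\<in>UNIV. p $ i) + b * (\<Sum>i\<in>UNIV. q $ i)"
        by (simp add: sum.distrib sum_distrib_left)
      moreover have "a * (\<Sum>i\<in>UNIV. p $ i) + b * (\<Sum>i\<in>UNIV. q $ i) \<le> 1"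
        using p(3) q(3) ab by (intro convex_bound_le) auto
      ultimately show "a *\<^sub>R x + b *\<^sub>R y \<in> ?S" using p(2) q(2) ab
        by (intro CollectI exI[of _ "a *\<^sub>R p + b *\<^sub>R q"] conjI) auto
    qed
  qed
  show "?S \<subseteq> Q"
  proof clarify
    fix p :: "real^'n" assume p: "\<forall>i. 0 \<le> p $ i" "(\<Sum>i\<in>UNIV. p $ i) \<le> 1"
    have "v 0 + g p = (\<Sum>j\<le>d. (if j = 0 then 1 - (\<Sum>i\<in>UNIV. p $ i) else p $ (inv idx j)) *\<^sub>R v j)"
      using g_comb[of 1 p] by simp
    also have "\<dots> \<in> Q" unfolding Q_def
    proof (rule convex_sum[OF _ convex_convex_hull])
      show "(\<Sum>j\<le>d. if j = 0 then 1 - (\<Sum>i\<in>UNIV. p $ i) else p $ (inv idx j)) = 1"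
        unfolding sum_idx by (simp add: inj idx_range(3))
    qed (use p in \<open>auto intro: hull_inc\<close>)
    finally show "v 0 + g p \<in> Q" .
  qed
qed

lemma mem_Q_iff: "v 0 + g p \<in> Q \<longleftrightarrow> (\<forall>i. 0 \<le> p $ i) \<and> (\<Sum>i\<in>UNIV. p $ i) \<le> 1"
  unfolding Q_eq using inj_g by (auto simp: inj_def)

lemma Q_compact: "compact Q" unfolding Q_def
  by (intro finite_imp_compact_convex_hull) auto

lemma Q_borel [measurable]: "Q \<in> sets borel"
  using Q_compact by (simp add: compact_imp_closed)

section \<open>The Jacobian of the edge map \<open>g\<close>\<close>

lemma gaussian_vec: "has_bochner_integral lborel (\<lambda>y::real^'n. exp (- (norm y)\<^sup>2 / 2)) (sqrt (2 * pi) ^ d)"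
proof -
  let ?f = "\<lambda>t::real. sqrt (2 * pi) * std_normal_density t"
  have i: "integrable lborel ?f" "integral\<^sup>L lborel ?f = sqrt (2 * pi)"
    by (auto intro!: integrable_mult_right)
  have eq: "exp (- (norm y)\<^sup>2 / 2) = (\<Prod>i\<in>UNIV. ?f (y $ i))" for y :: "real^'n"
  proof -
    have "(norm y)\<^sup>2 = (\<Sum>i\<in>UNIV. (y $ i)\<^sup>2)"
      unfolding power2_norm_eq_inner inner_vec_def by (simp add: power2_eq_square)
    then show ?thesis by (simp add: std_normal_density_def exp_sum[symmetric] sum_negf sum_divide_distrib)
  qed
  show ?thesis unfolding eq
    using integrable_prod_vec[of "\<lambda>_::'n. ?f", OF i(1)] integral_prod_vec[of "\<lambda>_::'n. ?f", OF i(1)]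
    by (simp add: has_bochner_integral_iff i card_n)
qed

text \<open>The term (\<Sum> x_i)^2 / \<tau>_0^2 in |g x|^2 keeps the integral from factoring. Its
  exponential is a Gaussian integral in u with purely imaginary linear term; for fixed u the
  x-integral is a product, and what remains is exp (- s u^2 / (2 \<tau>_0^2)), because the other
  squares add up to s - \<tau>_0^2.\<close>

lemma gaussian_vec_g: "has_bochner_integral lborel (\<lambda>x. exp (- (norm (g x))\<^sup>2 / 2)) (sqrt (2 * pi) ^ d * ((\<Prod>j\<le>d. \<tau> j) / sqrt s))"
proof -
  define H where "H = (\<lambda>(u::real) (x::real^'n). exp (0 * complex_of_real u - 1\<^sup>2 * (of_real u)\<^sup>2 / 2) *
    (\<Prod>i\<in>UNIV. exp ((\<i> * of_real (u / \<tau> 0)) * of_real (x $ i) - (of_real (1 / \<tau> (idx i)))\<^sup>2 * (of_real (x $ i))\<^sup>2 / 2)))"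
  have t0: "\<tau> 0 > 0" and ti: "\<And>i. \<tau> (idx i) > 0" using \<tau>_pos idx_range by auto
  have int: "integrable lborel (\<lambda>z. H (fst z) (snd z))"
  proof (rule Bochner_Integration.integrable_bound)
    show "integrable lborel (\<lambda>z::real \<times> (real^'n). exp (- (1/2 * (fst z)\<^sup>2)) *
      (\<Prod>i\<in>UNIV. exp (- (1 / (2 * (\<tau> (idx i))\<^sup>2) * (snd z $ i)\<^sup>2))))"
      by (rule integrable_lborel_times[OF integrable_exp_neg_square integrable_prod_vec[OF integrable_exp_neg_square]])
        (use ti in \<open>auto intro!: divide_pos_pos simp: less_imp_neq[THEN not_sym]\<close>)
    show "AE z in lborel. norm (H (fst z) (snd z)) \<le> norm (exp (- (1/2 * (fst z)\<^sup>2)) *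
      (\<Prod>i\<in>UNIV. exp (- (1 / (2 * (\<tau> (idx i))\<^sup>2) * (snd z $ i)\<^sup>2))))"
      by (intro AE_I2) (simp add: H_def norm_mult prod_norm[symmetric] power_divide abs_mult abs_prod mult.commute flip: of_real_power of_real_divide)
    show "(\<lambda>z. H (fst z) (snd z)) \<in> borel_measurable lborel"
    proof -
      have "(\<lambda>z. H (fst z) (snd z)) \<in> borel_measurable (borel \<Otimes>\<^sub>M borel)"
        unfolding H_def by measurable
      then show ?thesis by (simp add: borel_prod)
    qed
  qed
  have Hx: "(\<integral>u. H u x \<partial>lborel) = of_real (sqrt (2 * pi) * exp (- (norm (g x))\<^sup>2 / 2))" for x
  proof -
    define T where "T = (\<Sum>i\<in>UNIV. x $ i)"
    define E where "E = exp (- (\<Sum>i\<in>UNIV. (x $ i)\<^sup>2 / (\<tau> (idx i))\<^sup>2) / 2)"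
    have "H u x = exp ((\<i> * of_real (T / \<tau> 0)) * of_real u - 1\<^sup>2 * (of_real u)\<^sup>2 / 2) * of_real E" for u
      unfolding H_def E_def T_def exp_of_real[symmetric] exp_sum[OF finite, symmetric] exp_add[symmetric]
      by (simp add: sum_subtractf sum_distrib_left sum_distrib_right sum_divide_distrib power_divide algebra_simps sum_negf)
    then have "(\<integral>u. H u x \<partial>lborel) = of_real (sqrt (2 * pi)) * exp ((\<i> * of_real (T / \<tau> 0))\<^sup>2 / 2) * of_real E"
      using gaussian_line[of 1 "\<i> * of_real (T / \<tau> 0)"] by (simp add: has_bochner_integral_iff)
    also have "exp ((\<i> * of_real (T / \<tau> 0))\<^sup>2 / 2) = of_real (exp (- (T / \<tau> 0)\<^sup>2 / 2))"
      by (simp add: power_mult_distrib power_divide exp_of_real[symmetric])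
    also have "of_real (sqrt (2 * pi)) * complex_of_real (exp (- (T / \<tau> 0)\<^sup>2 / 2)) * of_real E =
       of_real (sqrt (2 * pi) * exp (- (norm (g x))\<^sup>2 / 2))"
    proof -
      define S where "S = (\<Sum>i\<in>UNIV. (x $ i)\<^sup>2 / (\<tau> (idx i))\<^sup>2)"
      have n: "(norm (g x))\<^sup>2 = (T / \<tau> 0)\<^sup>2 + S"
        using norm_cone[of 0 x] by (simp add: T_def S_def power_divide)
      have "exp (- (norm (g x))\<^sup>2 / 2) = exp (- (T / \<tau> 0)\<^sup>2 / 2) * E"
        unfolding n E_def S_def[symmetric] exp_add[symmetric] by (simp add: add_divide_distrib)
      then show ?thesis by simp
    qed
    finally show ?thesis .
  qed
  have Hu: "(\<integral>x. H u x \<partial>lborel) = of_real (sqrt (2 * pi) ^ d * (\<Prod>i\<in>UNIV. \<tau> (idx i))) * exp (0 * complex_of_real u - (of_real (sqrt s / \<tau> 0))\<^sup>2 * (of_real u)\<^sup>2 / 2)" for u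
  proof -
    let ?b = "\<i> * of_real (u / \<tau> 0)"
    let ?f = "\<lambda>i (t::real). exp (?b * of_real t - (of_real (1 / \<tau> (idx i)))\<^sup>2 * (of_real t)\<^sup>2 / 2)"
    have f: "has_bochner_integral lborel (?f i) (of_real (sqrt (2 * pi)) / of_real (1 / \<tau> (idx i)) * exp (?b\<^sup>2 / (2 * (of_real (1 / \<tau> (idx i)))\<^sup>2)))" for i
      by (rule gaussian_line) (use ti[of i] in \<open>auto simp flip: of_real_power\<close>)
    have "(\<integral>x. H u x \<partial>lborel) = exp (0 * complex_of_real u - 1\<^sup>2 * (of_real u)\<^sup>2 / 2) * (\<Prod>i\<in>UNIV. integral\<^sup>L lborel (?f i))"
      unfolding H_def using f by (subst integral_mult_right_zero) (subst integral_prod_vec, auto simp: has_bochner_integral_iff)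
    also have "(\<Prod>i\<in>UNIV. integral\<^sup>L lborel (?f i)) = (\<Prod>i\<in>UNIV. of_real (sqrt (2 * pi) * \<tau> (idx i)) * exp (of_real (- (u / \<tau> 0)\<^sup>2 * (\<tau> (idx i))\<^sup>2 / 2)))"
    proof (rule prod.cong[OF refl])
      fix i
      have "integral\<^sup>L lborel (?f i) = of_real (sqrt (2 * pi)) / of_real (1 / \<tau> (idx i)) * exp (?b\<^sup>2 / (2 * (of_real (1 / \<tau> (idx i)))\<^sup>2))"
        using f[of i] by (simp add: has_bochner_integral_iff)
      also have "?b\<^sup>2 / (2 * (of_real (1 / \<tau> (idx i)))\<^sup>2) = of_real (- (u / \<tau> 0)\<^sup>2 * (\<tau> (idx i))\<^sup>2 / 2)"
        using ti[of i] by (simp add: power_mult_distrib power_divide field_simps)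
      finally show "integral\<^sup>L lborel (?f i) = of_real (sqrt (2 * pi) * \<tau> (idx i)) * exp (of_real (- (u / \<tau> 0)\<^sup>2 * (\<tau> (idx i))\<^sup>2 / 2))"
        using ti[of i] by simp
    qed
    also have "\<dots> = of_real (sqrt (2 * pi) ^ d * (\<Prod>i\<in>UNIV. \<tau> (idx i))) * exp (of_real (- (u / \<tau> 0)\<^sup>2 * (\<Sum>i\<in>UNIV. (\<tau> (idx i))\<^sup>2) / 2))"
      unfolding prod.distrib exp_sum[OF finite, symmetric] of_real_mult of_real_sum[symmetric] 
      by (simp add: prod.distrib card_n sum_distrib_left sum_divide_distrib)
    also have "(\<Sum>i\<in>UNIV. (\<tau> (idx i))\<^sup>2) = s - (\<tau> 0)\<^sup>2"
      unfolding s_def sum_idx by simp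
    finally have *: "(\<integral>x. H u x \<partial>lborel) = of_real (sqrt (2 * pi) ^ d * (\<Prod>i\<in>UNIV. \<tau> (idx i))) *
       (exp (0 * complex_of_real u - 1\<^sup>2 * (of_real u)\<^sup>2 / 2) * exp (of_real (- (u / \<tau> 0)\<^sup>2 * (s - (\<tau> 0)\<^sup>2) / 2)))"
      by (simp only: mult_ac)
    have "0 * complex_of_real u - 1\<^sup>2 * (of_real u)\<^sup>2 / 2 + of_real (- (u / \<tau> 0)\<^sup>2 * (s - (\<tau> 0)\<^sup>2) / 2)
      = of_real (- u\<^sup>2 / 2 + - (u / \<tau> 0)\<^sup>2 * (s - (\<tau> 0)\<^sup>2) / 2)" by simp
    also have "- u\<^sup>2 / 2 + - (u / \<tau> 0)\<^sup>2 * (s - (\<tau> 0)\<^sup>2) / 2 = - ((sqrt s / \<tau> 0)\<^sup>2 * u\<^sup>2 / 2)"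
      using t0 s_pos by (simp add: power_divide field_simps)
    also have "complex_of_real (- ((sqrt s / \<tau> 0)\<^sup>2 * u\<^sup>2 / 2)) = 0 * complex_of_real u - (of_real (sqrt s / \<tau> 0))\<^sup>2 * (of_real u)\<^sup>2 / 2" by simp
    finally show ?thesis unfolding * exp_add[symmetric] by simp
  qed
  have "of_real (\<integral>x. sqrt (2 * pi) * exp (- (norm (g x))\<^sup>2 / 2) \<partial>lborel) = (\<integral>x. \<integral>u. H u x \<partial>lborel \<partial>lborel)"
    unfolding Hx by simp
  also have "\<dots> = (\<integral>u. \<integral>x. H u x \<partial>lborel \<partial>lborel)"
    by (rule integral_lborel_swap(1)[OF int, symmetric])
  also have "\<dots> = of_real (sqrt (2 * pi) ^ d * (\<Prod>i\<in>UNIV. \<tau> (idx i))) * (of_real (sqrt (2 * pi)) / of_real (sqrt s / \<tau> 0))"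
    unfolding Hu using gaussian_line[of "of_real (sqrt s / \<tau> 0)" 0] s_pos t0
    by (simp add: has_bochner_integral_iff flip: of_real_power)
  also have "\<dots> = of_real (sqrt (2 * pi) ^ d * (\<Prod>i\<in>UNIV. \<tau> (idx i)) * (sqrt (2 * pi) / (sqrt s / \<tau> 0)))"
    by simp
  finally have "(\<integral>x. sqrt (2 * pi) * exp (- (norm (g x))\<^sup>2 / 2) \<partial>lborel) = sqrt (2 * pi) ^ d * (\<Prod>i\<in>UNIV. \<tau> (idx i)) * (sqrt (2 * pi) / (sqrt s / \<tau> 0))"
    unfolding of_real_eq_iff .
  then have "sqrt (2 * pi) * (\<integral>x. exp (- (norm (g x))\<^sup>2 / 2) \<partial>lborel) = sqrt (2 * pi) * (sqrt (2 * pi) ^ d * ((\<Prod>j\<le>d. \<tau> j) / sqrt s))"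
    unfolding prod_idx by (simp add: field_simps)
  then have val: "(\<integral>x. exp (- (norm (g x))\<^sup>2 / 2) \<partial>lborel) = sqrt (2 * pi) ^ d * ((\<Prod>j\<le>d. \<tau> j) / sqrt s)"
    by (subst (asm) mult_left_cancel) auto
  moreover have "sqrt (2 * pi) ^ d * ((\<Prod>j\<le>d. \<tau> j) / sqrt s) > 0"
    by (intro mult_pos_pos divide_pos_pos zero_less_power prod_\<tau>_pos) (use s_pos in auto)
  \<comment> \<open>Again the nonzero value of the Bochner integral yields integrability.\<close>
  ultimately have "integrable lborel (\<lambda>x. exp (- (norm (g x))\<^sup>2 / 2))"
    by (metis not_integrable_integral_eq less_irrefl)
  with val show ?thesis by (simp add: has_bochner_integral_iff)
qed

text \<open>The constant is the absolute determinant of \<open>g\<close>, read off from the two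
  Gaussian integrals.\<close>

lemma integral_lborel_g:
  fixes f :: "real^'n \<Rightarrow> complex"
  assumes [measurable]: "f \<in> borel_measurable borel"
  shows "(\<integral>y. f y \<partial>lborel) = (sqrt s / (\<Prod>j\<le>d. \<tau> j)) *\<^sub>R (\<integral>x. f (g x) \<partial>lborel)"
proof -
  have b: "sqrt (2 * pi) ^ d * ((\<Prod>j\<le>d. \<tau> j) / sqrt s) > 0"
    by (intro mult_pos_pos divide_pos_pos zero_less_power prod_\<tau>_pos) (use s_pos in auto)
  have "(\<integral>y. f y \<partial>lborel) = (sqrt (2 * pi) ^ d / (sqrt (2 * pi) ^ d * ((\<Prod>j\<le>d. \<tau> j) / sqrt s))) *\<^sub>R (\<integral>x. f (g x) \<partial>lborel)"
    by (rule integral_lborel_linear[OF linear_g inj_g assms _ gaussian_vec gaussian_vec_g _ b]) auto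
  also have "sqrt (2 * pi) ^ d / (sqrt (2 * pi) ^ d * ((\<Prod>j\<le>d. \<tau> j) / sqrt s)) = sqrt s / (\<Prod>j\<le>d. \<tau> j)"
    by simp
  finally show ?thesis .
qed

end

section \<open>From the simplex to the orthant\<close>

lemma sum_squares_le_square_sum:
  fixes f :: "'a \<Rightarrow> real"
  assumes "finite A" "\<And>i. i \<in> A \<Longrightarrow> 0 \<le> f i"
  shows "(\<Sum>i\<in>A. (f i)\<^sup>2) \<le> (\<Sum>i\<in>A. f i)\<^sup>2"
proof -
  have "(\<Sum>i\<in>A. (f i)\<^sup>2) \<le> (\<Sum>i\<in>A. f i * sum f A)"
    unfolding power2_eq_square using assms by (intro sum_mono mult_left_mono member_le_sum) auto
  also have "\<dots> = (\<Sum>i\<in>A. f i)\<^sup>2" by (simp add: sum_distrib_right power2_eq_square)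
  finally show ?thesis .
qed

context orthocentric_simplex
begin

text \<open>In a pair (x, l), l is the coefficient of \<open>v 0\<close> in the cone and x lists the
  coefficients of the other vertices.\<close>

definition orthant :: "((real^'n) \<times> real) set" where
  "orthant = {z. (\<forall>i. 0 \<le> fst z $ i) \<and> 0 \<le> snd z}"

definition total :: "(real^'n) \<times> real \<Rightarrow> real" where
  "total z = snd z + (\<Sum>i\<in>UNIV. fst z $ i)"

text \<open>The diagonal part of the form: the cone point with coefficients z has squared norm
  \<open>wsquare z\<close> - (\<open>total z\<close>)^2 / s.\<close>

definition wsquare :: "(real^'n) \<times> real \<Rightarrow> real" where
  "wsquare z = (snd z)\<^sup>2 / (\<tau> 0)\<^sup>2 + (\<Sum>i\<in>UNIV. (fst z $ i)\<^sup>2 / (\<tau> (idx i))\<^sup>2)"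

lemma measurable_orthant [measurable]: "orthant \<in> sets borel"
proof -
  have "closed orthant" unfolding orthant_def
    by (intro closed_Collect_conj closed_Collect_all closed_Collect_le continuous_intros)
  then show ?thesis by simp
qed

lemma continuous_total: "continuous_on UNIV total"
  and continuous_wsquare: "continuous_on UNIV wsquare"
  unfolding total_def[abs_def] wsquare_def[abs_def] using \<tau>_pos idx_range
  by (auto intro!: continuous_intros simp: less_imp_neq[THEN not_sym])

lemma measurable_total [measurable]: "total \<in> borel_measurable borel"
  and measurable_wsquare [measurable]: "wsquare \<in> borel_measurable borel"
  by (intro borel_measurable_continuous_onI continuous_total continuous_wsquare)+

text \<open>For each y this is \<open>radial_gaussian_moment\<close> with p = P + K |y|^2. Since Re
  K > 0, the decay coming from P alone is a bound for all y, and Q has finite volume, so the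
  integrals may be swapped.\<close>

lemma integral_Q_eq_radial:
  fixes P K :: complex
  assumes P: "Re P > 0" and K: "Re K > 0"
  shows "(of_real (sqrt (2 * pi))) ^ Suc d * (\<integral>y. indicator Q y *\<^sub>R (1 / csqrt (P + K * of_real ((norm y)\<^sup>2))) ^ Suc d \<partial>lborel)
   = of_real (sphere_area (Suc d)) * (\<integral>r. \<integral>y. indicator {0..} r *\<^sub>R indicator Q y *\<^sub>R
        (of_real r ^ d * exp (- ((P + K * of_real ((norm y)\<^sup>2)) * (of_real r)\<^sup>2 / 2))) \<partial>lborel \<partial>lborel)"
proof -
  define A where "A = (\<lambda>r y. indicator {0..} r *\<^sub>R indicator Q y *\<^sub>R
        (complex_of_real r ^ d * exp (- ((P + K * of_real ((norm y)\<^sup>2)) * (of_real r)\<^sup>2 / 2))))"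
  have int: "integrable lborel (\<lambda>z. A (fst z) (snd z))"
  proof (rule Bochner_Integration.integrable_bound)
    have i: "integrable lborel (indicator Q :: _ \<Rightarrow> real)"
      using emeasure_compact_finite[OF Q_compact] by (intro integrable_real_indicator) auto
    have j: "integrable lborel (\<lambda>t. t ^ d * exp (- (Re P / 2 * t\<^sup>2)))"
      by (rule integrable_power_exp_neg_square) (use P in auto)
    show "integrable lborel (\<lambda>z. (fst z ^ d * exp (- (Re P / 2 * (fst z)\<^sup>2))) * indicator Q (snd z) :: real)"
      by (rule integrable_lborel_times[OF j i])
    show "AE z in lborel. norm (A (fst z) (snd z)) \<le> norm ((fst z ^ d * exp (- (Re P / 2 * (fst z)\<^sup>2))) * indicator Q (snd z))"
    proof (rule AE_I2)
      fix z :: "real \<times> (real^'n)"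
      have "Re P * (fst z)\<^sup>2 \<le> (Re P + Re K * (norm (snd z))\<^sup>2) * (fst z)\<^sup>2"
        using K by (intro mult_right_mono) auto
      then show "norm (A (fst z) (snd z)) \<le> norm ((fst z ^ d * exp (- (Re P / 2 * (fst z)\<^sup>2))) * indicator Q (snd z))"
        by (auto simp: A_def indicator_def norm_mult norm_power abs_mult power_abs simp flip: of_real_power intro!: mult_left_mono)
    qed
    have "(\<lambda>z. A (fst z) (snd z)) \<in> borel_measurable (borel \<Otimes>\<^sub>M borel)"
      unfolding A_def by measurable
    then show "(\<lambda>z. A (fst z) (snd z)) \<in> borel_measurable lborel" by (simp add: borel_prod)
  qed
  have "(of_real (sqrt (2 * pi))) ^ Suc d * (indicator Q y *\<^sub>R (1 / csqrt (P + K * of_real ((norm y)\<^sup>2))) ^ Suc d)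
    = of_real (sphere_area (Suc d)) * (\<integral>r. A r y \<partial>lborel)" for y
  proof -
    have "Re (P + K * of_real ((norm y)\<^sup>2)) > 0" using P K by (simp add: add_pos_nonneg)
    from radial_gaussian_moment[OF this, of d]
    have "of_real (sqrt (2 * pi)) ^ Suc d * (1 / csqrt (P + K * of_real ((norm y)\<^sup>2))) ^ Suc d = of_real (sphere_area (Suc d)) *
      (\<integral>t. indicator {0..} t *\<^sub>R (of_real t ^ d * exp (- ((P + K * of_real ((norm y)\<^sup>2)) * (of_real t)\<^sup>2 / 2))) \<partial>lborel)"
      by (simp only: power_divide power_one times_divide_eq_right mult_1_right)
    then show ?thesis by (auto simp: A_def indicator_def[of Q])
  qed
  then have "(of_real (sqrt (2 * pi))) ^ Suc d * (\<integral>y. indicator Q y *\<^sub>R (1 / csqrt (P + K * of_real ((norm y)\<^sup>2))) ^ Suc d \<partial>lborel)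
    = (\<integral>y. of_real (sphere_area (Suc d)) * (\<integral>r. A r y \<partial>lborel) \<partial>lborel)"
    by (simp only: integral_mult_right_zero[symmetric])
  also have "\<dots> = of_real (sphere_area (Suc d)) * (\<integral>y. \<integral>r. A r y \<partial>lborel \<partial>lborel)"
    by simp
  also have "(\<integral>y. \<integral>r. A r y \<partial>lborel \<partial>lborel) = (\<integral>r. \<integral>y. A r y \<partial>lborel \<partial>lborel)"
    by (rule integral_lborel_swap(1)[OF int, symmetric])
  finally show ?thesis unfolding A_def .
qed

text \<open>Substitution y = v 0 + g (x / r); the Jacobian of the scaling cancels the radial weight
  r^d.\<close>

lemma integral_Q_slice:
  fixes P K :: complex
  assumes r: "r > 0"
  shows "(\<integral>y. indicator Q y *\<^sub>R (of_real r ^ d * exp (- ((P + K * of_real ((norm y)\<^sup>2)) * (of_real r)\<^sup>2 / 2))) \<partial>lborel)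
   = (sqrt s / (\<Prod>j\<le>d. \<tau> j)) *\<^sub>R (\<integral>x. indicator {x. (\<forall>i. 0 \<le> x $ i) \<and> (\<Sum>i\<in>UNIV. x $ i) \<le> r} x *\<^sub>R
        exp (- ((P * of_real (r\<^sup>2) + K * of_real ((norm (r *\<^sub>R v 0 + g x))\<^sup>2)) / 2)) \<partial>lborel)"
proof -
  define \<phi> where "\<phi> = (\<lambda>y. indicator Q y *\<^sub>R (complex_of_real r ^ d * exp (- ((P + K * of_real ((norm y)\<^sup>2)) * (of_real r)\<^sup>2 / 2))))"
  define S where "S = {x::real^'n. (\<forall>i. 0 \<le> x $ i) \<and> (\<Sum>i\<in>UNIV. x $ i) \<le> r}"
  define \<psi> where "\<psi> = (\<lambda>x. indicator S x *\<^sub>R exp (- ((P * of_real (r\<^sup>2) + K * of_real ((norm (r *\<^sub>R v 0 + g x))\<^sup>2)) / 2)))"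
  have "closed S" unfolding S_def
    by (intro closed_Collect_conj closed_Collect_all closed_Collect_le continuous_intros)
  then have [measurable]: "S \<in> sets borel" by simp
  have m [measurable]: "\<phi> \<in> borel_measurable borel" "\<psi> \<in> borel_measurable borel"
    unfolding \<phi>_def \<psi>_def by measurable
  have eq: "\<phi> (v 0 + g p) = (r ^ d) *\<^sub>R \<psi> (0 + r *\<^sub>R p)" for p
  proof -
    have S: "r *\<^sub>R p \<in> S \<longleftrightarrow> v 0 + g p \<in> Q"
      using r unfolding mem_Q_iff S_def by (simp add: sum_distrib_left[symmetric] zero_le_mult_iff)
    have n: "r *\<^sub>R v 0 + g (r *\<^sub>R p) = r *\<^sub>R (v 0 + g p)"
      by (simp add: linear_scale[OF linear_g] scaleR_add_right)
    have e: "(P + K * of_real ((norm (v 0 + g p))\<^sup>2)) * (of_real r)\<^sup>2 / 2 =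
       (P * of_real (r\<^sup>2) + K * of_real ((norm (r *\<^sub>R (v 0 + g p)))\<^sup>2)) / 2"
    proof -
      have "(norm (r *\<^sub>R (v 0 + g p)))\<^sup>2 = r\<^sup>2 * (norm (v 0 + g p))\<^sup>2"
        by (simp only: norm_scaleR power_mult_distrib power2_abs)
      then show ?thesis by (simp add: algebra_simps del: scaleR_add_right)
    qed
    show ?thesis unfolding \<phi>_def \<psi>_def add_0_left n e using S by (auto simp: indicator_def scaleR_conv_of_real)
  qed
  have "(\<integral>y. \<phi> y \<partial>lborel) = (\<integral>y. \<phi> (v 0 + y) \<partial>lborel)"
    using integral_lborel_scale[of 1 \<phi> "v 0"] by simp
  also have "\<dots> = (sqrt s / (\<Prod>j\<le>d. \<tau> j)) *\<^sub>R (\<integral>p. \<phi> (v 0 + g p) \<partial>lborel)"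
    by (rule integral_lborel_g) measurable
  also have "(\<integral>p. \<phi> (v 0 + g p) \<partial>lborel) = (\<integral>x. \<psi> x \<partial>lborel)"
    unfolding eq using integral_lborel_scale[of r \<psi> 0] r by (simp add: card_n)
  finally show ?thesis unfolding \<phi>_def \<psi>_def S_def .
qed

lemma sum_le_total_squares:
  fixes x :: "real^'n"
  assumes "\<forall>i. 0 \<le> x $ i" "0 \<le> l"
  shows "l\<^sup>2 + (\<Sum>i\<in>UNIV. (x $ i)\<^sup>2) \<le> (l + (\<Sum>i\<in>UNIV. x $ i))\<^sup>2"
proof -
  have "(\<Sum>i\<in>UNIV. (x $ i)\<^sup>2) \<le> (\<Sum>i\<in>UNIV. x $ i)\<^sup>2"
    by (rule sum_squares_le_square_sum) (use assms in auto)
  moreover have "(l + (\<Sum>i\<in>UNIV. x $ i))\<^sup>2 = l\<^sup>2 + (\<Sum>i\<in>UNIV. x $ i)\<^sup>2 + 2 * l * (\<Sum>i\<in>UNIV. x $ i)"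
    by (simp add: power2_sum)
  moreover have "0 \<le> 2 * l * (\<Sum>i\<in>UNIV. x $ i)" using assms by (auto intro!: mult_nonneg_nonneg sum_nonneg)
  ultimately show ?thesis by linarith
qed

lemma integrable_gaussian_vec:
  assumes "c > 0"
  shows "integrable lborel (\<lambda>x::real^'n. \<Prod>i\<in>UNIV. exp (- (c * (x $ i)\<^sup>2)))"
  by (rule integrable_prod_vec[OF integrable_exp_neg_square[OF assms]])

text \<open>For fixed x the shift r = l + \<Sum> x_i exchanges the radius for the coefficient l of
  \<open>v 0\<close>; the constraint \<Sum> x_i <= r becomes l >= 0, so the cone turns into an
  orthant.\<close>

lemma integral_Q_eq_orthant:
  fixes P K :: complex
  assumes P: "Re P > 0" and K: "Re K > 0"
  shows "(of_real (sqrt (2 * pi))) ^ Suc d * (\<integral>y. indicator Q y *\<^sub>R (1 / csqrt (P + K * of_real ((norm y)\<^sup>2))) ^ Suc d \<partial>lborel)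
   = of_real (sphere_area (Suc d) * (sqrt s / (\<Prod>j\<le>d. \<tau> j))) *
      (\<integral>z. indicator orthant z *\<^sub>R exp (- (((P - K / of_real s) * of_real ((total z)\<^sup>2) + K * of_real (wsquare z)) / 2)) \<partial>lborel)"
proof -
  let ?e = "\<lambda>r x. exp (- ((P * of_real (r\<^sup>2) + K * of_real ((norm (r *\<^sub>R v 0 + g x))\<^sup>2)) / 2))"
  \<comment> \<open>Separable majorants. In (x, r) half of the decay exp (- Re P r^2 / 2) is passed
    on to x, as \<Sum> x_i^2 <= r^2 on the cone; this gives a = 4. In (x, l) the total dominates all
    coordinates together, and a = 2 is enough.\<close>
  let ?G = "\<lambda>a (z::(real^'n) \<times> real). (\<Prod>i\<in>UNIV. exp (- (Re P / a * (fst z $ i)\<^sup>2))) * exp (- (Re P / a * (snd z)\<^sup>2))"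
  let ?S = "\<lambda>r. {x::real^'n. (\<forall>i. 0 \<le> x $ i) \<and> (\<Sum>i\<in>UNIV. x $ i) \<le> r}"
  define B where "B = (\<lambda>(x::real^'n) r. indicator {z. 0 < snd z \<and> (\<forall>i. 0 \<le> fst z $ i) \<and> (\<Sum>i\<in>UNIV. fst z $ i) \<le> snd z} (x, r) *\<^sub>R ?e r x)"
  have norm_e: "norm (?e r x) \<le> exp (- (Re P / 2 * r\<^sup>2))" for r x
    using K by simp
  have "{z::(real^'n) \<times> real. 0 < snd z \<and> (\<forall>i. 0 \<le> fst z $ i) \<and> (\<Sum>i\<in>UNIV. fst z $ i) \<le> snd z} =
    {z. 0 < snd z} \<inter> {z. (\<forall>i. 0 \<le> fst z $ i) \<and> (\<Sum>i\<in>UNIV. fst z $ i) \<le> snd z}" by auto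
  also have "\<dots> \<in> sets borel"
    by (intro sets.Int borel_open borel_closed open_Collect_less closed_Collect_conj closed_Collect_all closed_Collect_le continuous_intros)
  finally have mC: "{z::(real^'n) \<times> real. 0 < snd z \<and> (\<forall>i. 0 \<le> fst z $ i) \<and> (\<Sum>i\<in>UNIV. fst z $ i) \<le> snd z} \<in> sets borel" .
  have cg: "continuous_on X (\<lambda>z. g (f z))" if "continuous_on X f" for X :: "((real^'n) \<times> real) set" and f
    using linear_g by (intro linear_continuous_on_compose[OF that]) 
  have me: "(\<lambda>z. ?e (snd z) (fst z)) \<in> borel_measurable borel"
    by (intro borel_measurable_continuous_onI continuous_intros cg) auto
  have intB: "integrable lborel (\<lambda>z. B (fst z) (snd z))"
  proof (rule Bochner_Integration.integrable_bound)
    show "integrable lborel (\<lambda>z::(real^'n) \<times> real. ?G 4 z)"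
      by (rule integrable_lborel_times[OF integrable_gaussian_vec integrable_exp_neg_square]) (use P in auto)
    show "AE z in lborel. norm (B (fst z) (snd z)) \<le> norm (?G 4 z)"
    proof (rule AE_I2)
      fix z :: "(real^'n) \<times> real"
      show "norm (B (fst z) (snd z)) \<le> norm (?G 4 z)"
      proof (cases "0 < snd z \<and> (\<forall>i. 0 \<le> fst z $ i) \<and> (\<Sum>i\<in>UNIV. fst z $ i) \<le> snd z")
        case True
        have "(\<Sum>i\<in>UNIV. (fst z $ i)\<^sup>2) \<le> (\<Sum>i\<in>UNIV. fst z $ i)\<^sup>2"
          using sum_le_total_squares[of "fst z" 0] True by simp
        also have "\<dots> \<le> (snd z)\<^sup>2" using True by (intro power_mono sum_nonneg) auto
        finally have "Re P / 4 * (\<Sum>i\<in>UNIV. (fst z $ i)\<^sup>2) \<le> Re P / 4 * (snd z)\<^sup>2" using P by (intro mult_left_mono) auto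
        then have e: "exp (- (Re P / 2 * (snd z)\<^sup>2)) \<le> exp (- (Re P / 4 * (\<Sum>i\<in>UNIV. (fst z $ i)\<^sup>2)) + - (Re P / 4 * (snd z)\<^sup>2))"
          by simp
        have "norm (B (fst z) (snd z)) = norm (?e (snd z) (fst z))" using True by (simp add: B_def)
        also have "\<dots> \<le> exp (- (Re P / 2 * (snd z)\<^sup>2))" by (rule norm_e)
        also note e
        also have "exp (- (Re P / 4 * (\<Sum>i\<in>UNIV. (fst z $ i)\<^sup>2)) + - (Re P / 4 * (snd z)\<^sup>2)) =
           norm (?G 4 z)"
          unfolding exp_add by (simp add: exp_sum[symmetric] sum_distrib_left sum_negf)
        finally show ?thesis .
      qed (auto simp: B_def)
    qed
    show "(\<lambda>z. B (fst z) (snd z)) \<in> borel_measurable lborel"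
      unfolding B_def using mC me by simp
  qed
  define D where "D = (\<lambda>z. indicator (orthant \<inter> {z. 0 < total z}) z *\<^sub>R ?e (total z) (fst z))"
  have De: "?e (total z) (fst z) = exp (- (((P - K / of_real s) * of_real ((total z)\<^sup>2) + K * of_real (wsquare z)) / 2))" for z
  proof -
    have n: "(norm (total z *\<^sub>R v 0 + g (fst z)))\<^sup>2 = wsquare z - (total z)\<^sup>2 / s"
      unfolding norm_cone by (simp add: wsquare_def total_def)
    show ?thesis unfolding n by (simp add: algebra_simps)
  qed
  have mD: "D \<in> borel_measurable borel" unfolding D_def De by measurable
  have intD: "integrable lborel (\<lambda>z. D (fst z, snd z))"
  proof (rule Bochner_Integration.integrable_bound)
    show "integrable lborel (\<lambda>z::(real^'n) \<times> real. ?G 2 z)"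
      by (rule integrable_lborel_times[OF integrable_gaussian_vec integrable_exp_neg_square]) (use P in auto)
    show "AE z in lborel. norm (D (fst z, snd z)) \<le> norm (?G 2 z)"
    proof (rule AE_I2)
      fix z :: "(real^'n) \<times> real"
      show "norm (D (fst z, snd z)) \<le> norm (?G 2 z)"
      proof (cases "z \<in> orthant")
        case True
        then have "(snd z)\<^sup>2 + (\<Sum>i\<in>UNIV. (fst z $ i)\<^sup>2) \<le> (total z)\<^sup>2"
          unfolding total_def orthant_def by (intro sum_le_total_squares) auto
        then have "Re P / 2 * ((snd z)\<^sup>2 + (\<Sum>i\<in>UNIV. (fst z $ i)\<^sup>2)) \<le> Re P / 2 * (total z)\<^sup>2" using P by (intro mult_left_mono) auto
        then have e: "exp (- (Re P / 2 * (total z)\<^sup>2)) \<le> exp (- (Re P / 2 * (\<Sum>i\<in>UNIV. (fst z $ i)\<^sup>2)) + - (Re P / 2 * (snd z)\<^sup>2))"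
          unfolding exp_le_cancel_iff distrib_left by linarith
        have "norm (D (fst z, snd z)) \<le> norm (?e (total z) (fst z))" by (simp add: D_def indicator_def)
        also have "\<dots> \<le> exp (- (Re P / 2 * (total z)\<^sup>2))" by (rule norm_e)
        also note e
        also have "exp (- (Re P / 2 * (\<Sum>i\<in>UNIV. (fst z $ i)\<^sup>2)) + - (Re P / 2 * (snd z)\<^sup>2)) =
           norm (?G 2 z)"
          unfolding exp_add by (simp add: exp_sum[symmetric] sum_distrib_left sum_negf)
        finally show ?thesis .
      qed (auto simp: D_def)
    qed
    show "(\<lambda>z. D (fst z, snd z)) \<in> borel_measurable lborel"
      using mD by simp
  qed
  have slice: "(\<integral>y. indicator {0..} r *\<^sub>R indicator Q y *\<^sub>R
        (of_real r ^ d * exp (- ((P + K * of_real ((norm y)\<^sup>2)) * (of_real r)\<^sup>2 / 2))) \<partial>lborel) =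
      of_real (sqrt s / (\<Prod>j\<le>d. \<tau> j)) * (\<integral>x. B x r \<partial>lborel)" for r
  proof (cases "r > 0")
    case True
    have "B x r = indicator (?S r) x *\<^sub>R ?e r x" for x using True by (auto simp: B_def indicator_def)
    then show ?thesis using integral_Q_slice[OF True, of P K] True by (simp add: scaleR_conv_of_real)
  next
    \<comment> \<open>The left side vanishes at r = 0 too, by the factor r^d with d > 0; this
      matches the strict inequality in \<open>B\<close>.\<close>
    case False
    then have B0: "B x r = 0" for x by (auto simp: B_def)
    have A0: "indicator {0..} r *\<^sub>R indicator Q y *\<^sub>R
        (of_real r ^ d * exp (- ((P + K * of_real ((norm y)\<^sup>2)) * (of_real r)\<^sup>2 / 2))) = 0" for y
      using False d_ge_2 by (cases "r = 0") (auto simp: indicator_def)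
    show ?thesis unfolding A0 B0 by simp
  qed
  have shift: "(\<integral>r. B x r \<partial>lborel) = (\<integral>l. D (x, l) \<partial>lborel)" for x
  proof -
    have "(\<integral>r. B x r \<partial>lborel) = (\<integral>l. B x ((\<Sum>i\<in>UNIV. x $ i) + 1 * l) \<partial>lborel)"
      using lborel_integral_real_affine[of 1 "B x" "\<Sum>i\<in>UNIV. x $ i"] by simp
    also have "\<dots> = (\<integral>l. D (x, l) \<partial>lborel)"
      by (rule Bochner_Integration.integral_cong[OF refl]) (auto simp: B_def D_def indicator_def orthant_def total_def add.commute)
    finally show ?thesis .
  qed
  have "(\<integral>r. \<integral>y. indicator {0..} r *\<^sub>R indicator Q y *\<^sub>R
        (of_real r ^ d * exp (- ((P + K * of_real ((norm y)\<^sup>2)) * (of_real r)\<^sup>2 / 2))) \<partial>lborel \<partial>lborel)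
    = of_real (sqrt s / (\<Prod>j\<le>d. \<tau> j)) * (\<integral>r. \<integral>x. B x r \<partial>lborel \<partial>lborel)"
    unfolding slice by simp
  also have "(\<integral>r. \<integral>x. B x r \<partial>lborel \<partial>lborel) = (\<integral>x. \<integral>r. B x r \<partial>lborel \<partial>lborel)"
    by (rule integral_lborel_swap(1)[OF intB, symmetric])
  also have "\<dots> = (\<integral>z. D (fst z, snd z) \<partial>lborel)"
    unfolding shift by (rule integral_lborel_swap(2)[OF intD])
  also have "\<dots> = (\<integral>z. indicator orthant z *\<^sub>R exp (- (((P - K / of_real s) * of_real ((total z)\<^sup>2) + K * of_real (wsquare z)) / 2)) \<partial>lborel)"
  proof (rule integral_cong_AE)
    \<comment> \<open>The condition \<open>0 < total z\<close> left over from r > 0 removes nothing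
      but the origin from the orthant.\<close>
    have pos: "total z > 0" if "z \<noteq> 0" "z \<in> orthant" for z
    proof -
      have "0 \<le> (\<Sum>i\<in>UNIV. fst z $ i)" "0 \<le> snd z" using that by (auto simp: orthant_def intro!: sum_nonneg)
      moreover have "total z \<noteq> 0"
      proof
        assume "total z = 0"
        then have "snd z = 0" "(\<Sum>i\<in>UNIV. fst z $ i) = 0" using calculation by (auto simp: total_def)
        then have "fst z $ i = 0" for i using that(2) by (subst (asm) sum_nonneg_eq_0_iff) (auto simp: orthant_def)
        with \<open>snd z = 0\<close> that(1) show False by (auto simp: prod_eq_iff vec_eq_iff)
      qed
      ultimately show ?thesis by (simp add: total_def)
    qed
    show "AE z in lborel. D (fst z, snd z) = indicator orthant z *\<^sub>R exp (- (((P - K / of_real s) * of_real ((total z)\<^sup>2) + K * of_real (wsquare z)) / 2))"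
      using AE_lborel_singleton[of "0::(real^'n) \<times> real"]
    proof eventually_elim
      case (elim z)
      have "indicator (orthant \<inter> {z. 0 < total z}) z = (indicator orthant z :: real)"
        using pos[OF elim] by (auto simp: indicator_def)
      then show ?case unfolding D_def De prod.collapse by simp
    qed
  qed (use mD in \<open>simp, measurable\<close>)
  finally show ?thesis unfolding integral_Q_eq_radial[OF P K] by (simp add: mult.assoc)
qed

end

section \<open>Linearisation of the square\<close>

lemma sum_squared_le_weighted:
  fixes x w :: "'a \<Rightarrow> real"
  assumes "finite A" "\<And>i. i \<in> A \<Longrightarrow> w i \<noteq> 0"
  shows "(\<Sum>i\<in>A. x i)\<^sup>2 \<le> (\<Sum>i\<in>A. (w i)\<^sup>2) * (\<Sum>i\<in>A. (x i)\<^sup>2 / (w i)\<^sup>2)"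
proof -
  have "(\<Sum>i\<in>A. x i) = (\<Sum>i\<in>A. w i * (x i / w i))"
    using assms by (intro sum.cong) auto
  then show ?thesis
    using Cauchy_Schwarz_ineq_sum[of w "\<lambda>i. x i / w i" A] by (simp add: power_divide)
qed

text \<open>\<rho> is the correlation coefficient of the form: by the arithmetic-geometric mean
  inequality the cross term is at most \<rho> (A W + X u^2) / 2, and the fraction \<delta> = 1 -
  \<rho> of the definite part is left.\<close>

lemma cross_term_le:
  fixes A X c s T W u :: real
  assumes A: "A > 0" and X: "X > 0" and s: "s > 0" and c: "s * c\<^sup>2 < A * X"
  obtains \<delta> where "\<delta> > 0" "\<And>T W u. 0 \<le> W \<Longrightarrow> T\<^sup>2 \<le> s * W \<Longrightarrow> c * T * u - X * u\<^sup>2 / 2 - A * W / 2 \<le> - (\<delta> * (A * W + X * u\<^sup>2) / 2)"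
proof -
  define \<rho> where "\<rho> = sqrt (s * c\<^sup>2 / (A * X))"
  have \<rho>: "0 \<le> \<rho>" "\<rho> < 1" using A X s c by (auto simp: \<rho>_def)
  have \<rho>2: "\<rho>\<^sup>2 * (A * X) = s * c\<^sup>2" using A X s by (simp add: \<rho>_def)
  show ?thesis
  proof (rule that[of "1 - \<rho>"])
    fix T W u :: real assume W: "0 \<le> W" "T\<^sup>2 \<le> s * W"
    have "(c * T * u)\<^sup>2 = c\<^sup>2 * u\<^sup>2 * T\<^sup>2" by (simp add: power_mult_distrib)
    also have "\<dots> \<le> c\<^sup>2 * u\<^sup>2 * (s * W)" using W by (intro mult_left_mono) auto
    also have "\<dots> = \<rho>\<^sup>2 * (4 * ((A * W) * (X * u\<^sup>2))) / 4" using \<rho>2 by (simp add: field_simps)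
    also have "\<dots> \<le> \<rho>\<^sup>2 * (A * W + X * u\<^sup>2)\<^sup>2 / 4"
    proof (intro divide_right_mono mult_left_mono)
      have "0 \<le> (A * W - X * u\<^sup>2)\<^sup>2" by simp
      then show "4 * ((A * W) * (X * u\<^sup>2)) \<le> (A * W + X * u\<^sup>2)\<^sup>2" by (simp add: power2_eq_square algebra_simps)
    qed auto
    also have "\<dots> = (\<rho> * (A * W + X * u\<^sup>2) / 2)\<^sup>2" by (simp add: power_mult_distrib power_divide)
    finally have "c * T * u \<le> \<rho> * (A * W + X * u\<^sup>2) / 2"
      by (rule power2_le_imp_le) (use \<rho> A X W in auto)
    then show "c * T * u - X * u\<^sup>2 / 2 - A * W / 2 \<le> - ((1 - \<rho>) * (A * W + X * u\<^sup>2) / 2)"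
      by (simp add: field_simps)
  qed (use \<rho> in auto)
qed

text \<open>Folding u with - u is the origin of the two products with opposite signs in the
  formula.\<close>

lemma integral_lborel_even_part:
  fixes f :: "real \<Rightarrow> complex"
  assumes f: "integrable lborel f"
  shows "integrable lborel (\<lambda>u. indicator {0..} u *\<^sub>R (f u + f (- u)))"
    and "(\<integral>u. f u \<partial>lborel) = (\<integral>u. indicator {0..} u *\<^sub>R (f u + f (- u)) \<partial>lborel)"
proof -
  have f': "integrable lborel (\<lambda>u. f (- u))"
    using lborel_integrable_real_affine[OF f, of "-1" 0] by simp
  have 1: "integrable lborel (\<lambda>u. indicator {0..} u *\<^sub>R f u)" "integrable lborel (\<lambda>u. indicator {0..} u *\<^sub>R f (- u))"
    by (intro integrable_mult_indicator f f'; simp)+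
  show "integrable lborel (\<lambda>u. indicator {0..} u *\<^sub>R (f u + f (- u)))"
    using Bochner_Integration.integrable_add[OF 1] by (simp add: scaleR_add_right)
  have "has_bochner_integral lborel f ((\<integral>u. indicator {0..} u *\<^sub>R f u \<partial>lborel) + (\<integral>u. indicator {0..} u *\<^sub>R f (- u) \<partial>lborel))"
    by (rule has_bochner_integral_split_half_lines) (use 1 in \<open>auto simp: has_bochner_integral_iff\<close>)
  then have "(\<integral>u. f u \<partial>lborel) = (\<integral>u. indicator {0..} u *\<^sub>R f u \<partial>lborel) + (\<integral>u. indicator {0..} u *\<^sub>R f (- u) \<partial>lborel)"
    by (simp add: has_bochner_integral_iff)
  also have "\<dots> = (\<integral>u. indicator {0..} u *\<^sub>R (f u + f (- u)) \<partial>lborel)"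
    unfolding scaleR_add_right by (rule Bochner_Integration.integral_add[OF 1, symmetric])
  finally show "(\<integral>u. f u \<partial>lborel) = (\<integral>u. indicator {0..} u *\<^sub>R (f u + f (- u)) \<partial>lborel)" .
qed

context orthocentric_simplex
begin

text \<open>Cauchy-Schwarz with weights \<tau>_j, whose squares add up to s.\<close>

lemma total_squared_le: "(total z)\<^sup>2 \<le> s * wsquare z"
proof -
  define l where "l = (\<lambda>j. if j = 0 then snd z else fst z $ (inv idx j))"
  have inj: "inj idx" using idx by (simp add: bij_betw_def)
  have "(\<Sum>j\<le>d. l j)\<^sup>2 \<le> (\<Sum>j\<le>d. (\<tau> j)\<^sup>2) * (\<Sum>j\<le>d. (l j)\<^sup>2 / (\<tau> j)\<^sup>2)"
    by (rule sum_squared_le_weighted) (use \<tau>_pos in \<open>auto simp: less_imp_neq[THEN not_sym]\<close>)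
  then show ?thesis unfolding s_def[symmetric] total_def wsquare_def
    by (simp add: sum_idx l_def inj idx_range(3))
qed

lemma wsquare_nonneg: "0 \<le> wsquare z"
  unfolding wsquare_def by (intro add_nonneg_nonneg sum_nonneg divide_nonneg_nonneg) auto

text \<open>The hypothesis on \<open>a * q\<close> says that the quadratic form in \<open>(total z, sqrt (wsquare z), u)\<close> which governs the
  linearised integrand stays negative definite, so that Fubini applies; \<open>u\<close> runs over the line through \<open>q\<close>.\<close>

lemma integral_Q_eq_Phi:
  fixes k q a :: complex
  assumes k: "Re k > 0" "Re (k\<^sup>2) > 0" and q: "Re q > 0" "Re (q\<^sup>2) > 0"
    and P: "Re (k\<^sup>2 / of_real s - a\<^sup>2) > 0" and c: "s * (Re (a * q))\<^sup>2 < Re (k\<^sup>2) * Re (q\<^sup>2)"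
  defines "\<zeta> \<equiv> a * q / k"
  defines "F \<equiv> (\<lambda>u. (\<Prod>j\<le>d. Phi (of_real (\<tau> j) * \<zeta> * of_real u)) * exp (- ((q\<^sup>2 - of_real s * \<zeta>\<^sup>2) * (of_real u)\<^sup>2 / 2)))"
  shows "integrable lborel F"
    and "(\<integral>y. indicator Q y *\<^sub>R (1 / csqrt ((k\<^sup>2 / of_real s - a\<^sup>2) + k\<^sup>2 * of_real ((norm y)\<^sup>2))) ^ Suc d \<partial>lborel) =
      of_real (sphere_area (Suc d) * sqrt s / sqrt (2 * pi)) * (q / k ^ Suc d) * (\<integral>u. F u \<partial>lborel)"
proof -
  let ?E = "\<lambda>z. exp (- (((k\<^sup>2 / of_real s - a\<^sup>2 - k\<^sup>2 / of_real s) * of_real ((total z)\<^sup>2) + k\<^sup>2 * of_real (wsquare z)) / 2))"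
  have k0: "k \<noteq> 0" and q0: "q \<noteq> 0" using k q by auto
  have ti: "\<tau> (idx i) > 0" and t0: "\<tau> 0 > 0" for i using \<tau>_pos idx_range by auto
  define f where "f = (\<lambda>j u (t::real). indicator {0..} t *\<^sub>R exp ((a * q * of_real u) * of_real t - (k / of_real (\<tau> j))\<^sup>2 * (of_real t)\<^sup>2 / 2))"
  \<comment> \<open>Integrating out u gives back exp (a^2 T^2 / 2) with T = \<open>total z\<close>,
    since P - K / s = - a^2; for fixed u the integrand is a product over the cone
    coordinates.\<close>
  define H where "H = (\<lambda>(z::(real^'n) \<times> real) (u::real). indicator orthant z *\<^sub>R
     (exp ((a * of_real (total z) * q) * of_real u - q\<^sup>2 * (of_real u)\<^sup>2 / 2) * exp (- (k\<^sup>2 * of_real (wsquare z) / 2))))"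
  obtain \<delta> where \<delta>: "\<delta> > 0" "\<And>T W u. 0 \<le> W \<Longrightarrow> T\<^sup>2 \<le> s * W \<Longrightarrow> Re (a * q) * T * u - Re (q\<^sup>2) * u\<^sup>2 / 2 - Re (k\<^sup>2) * W / 2
      \<le> - (\<delta> * (Re (k\<^sup>2) * W + Re (q\<^sup>2) * u\<^sup>2) / 2)"
    using cross_term_le[OF k(2) q(2) s_pos c] by metis
  have int: "integrable lborel (\<lambda>p. H (fst p) (snd p))"
  proof (rule Bochner_Integration.integrable_bound)
    let ?A = "\<lambda>j. \<delta> * Re (k\<^sup>2) / (2 * (\<tau> j)\<^sup>2)"
    let ?G = "\<lambda>z u. ((\<Prod>i\<in>UNIV. exp (- (?A (idx i) * (fst z $ i)\<^sup>2))) * exp (- (?A 0 * (snd z)\<^sup>2))) * exp (- (\<delta> * Re (q\<^sup>2) / 2 * u\<^sup>2))"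
    have A: "?A j > 0" if "j \<le> d" for j using \<delta> k \<tau>_pos[OF that] by (intro divide_pos_pos mult_pos_pos) auto
    have X: "\<delta> * Re (q\<^sup>2) / 2 > 0" using \<delta> q by simp
    show "integrable lborel (\<lambda>p::((real^'n) \<times> real) \<times> real. ?G (fst p) (snd p))"
      by (rule integrable_lborel_times[OF integrable_lborel_times[OF integrable_prod_vec[OF integrable_exp_neg_square[OF A]] integrable_exp_neg_square[OF A]] integrable_exp_neg_square[OF X]])
        (auto intro: idx_range)
    show "AE p in lborel. norm (H (fst p) (snd p)) \<le> norm (?G (fst p) (snd p))"
    proof (rule AE_I2)
      fix p :: "((real^'n) \<times> real) \<times> real"
      define z u where "z = fst p" and "u = snd p"
      have "norm (H z u) \<le> exp (Re ((a * of_real (total z) * q) * of_real u - q\<^sup>2 * (of_real u)\<^sup>2 / 2)) * exp (Re (- (k\<^sup>2 * of_real (wsquare z) / 2)))"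
        unfolding H_def by (simp only: norm_scaleR norm_mult norm_exp_eq_Re) (simp add: indicator_def)
      also have "\<dots> = exp (Re (a * q) * total z * u - Re (q\<^sup>2) * u\<^sup>2 / 2 - Re (k\<^sup>2) * wsquare z / 2)"
        unfolding exp_add[symmetric] by (simp add: algebra_simps flip: of_real_power)
      also have "\<dots> \<le> exp (- (\<delta> * (Re (k\<^sup>2) * wsquare z + Re (q\<^sup>2) * u\<^sup>2) / 2))"
        unfolding exp_le_cancel_iff by (rule \<delta>(2)[OF wsquare_nonneg total_squared_le])
      also have "- (\<delta> * (Re (k\<^sup>2) * wsquare z + Re (q\<^sup>2) * u\<^sup>2) / 2) =
         (\<Sum>i\<in>UNIV. - (?A (idx i) * (fst z $ i)\<^sup>2)) + - (?A 0 * (snd z)\<^sup>2) + - (\<delta> * Re (q\<^sup>2) / 2 * u\<^sup>2)"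
      proof -
        have "(\<Sum>i\<in>UNIV. - (?A (idx i) * (fst z $ i)\<^sup>2)) = - (\<delta> * Re (k\<^sup>2) / 2) * (\<Sum>i\<in>UNIV. (fst z $ i)\<^sup>2 / (\<tau> (idx i))\<^sup>2)"
          unfolding sum_distrib_left by (intro sum.cong refl) simp
        then show ?thesis unfolding wsquare_def by (simp add: algebra_simps add_divide_distrib)
      qed
      also have "exp \<dots> = norm (?G z u)"
        unfolding exp_add exp_sum[OF finite] by (simp add: abs_mult abs_prod)
      finally show "norm (H (fst p) (snd p)) \<le> norm (?G (fst p) (snd p))"
        unfolding z_def u_def .
    qed
    have "(\<lambda>p. H (fst p) (snd p)) \<in> borel_measurable (borel \<Otimes>\<^sub>M borel)"
      unfolding H_def by measurable
    then show "(\<lambda>p. H (fst p) (snd p)) \<in> borel_measurable lborel" by (simp add: borel_prod)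
  qed
  have Hz: "(\<integral>u. H z u \<partial>lborel) = of_real (sqrt (2 * pi)) / q * (indicator orthant z *\<^sub>R
      ?E z)" for z
  proof -
    have "(\<integral>u. H z u \<partial>lborel) = indicator orthant z *\<^sub>R (of_real (sqrt (2 * pi)) / q * exp ((a * of_real (total z) * q)\<^sup>2 / (2 * q\<^sup>2)) * exp (- (k\<^sup>2 * of_real (wsquare z) / 2)))"
      unfolding H_def using gaussian_line[OF q, of "a * of_real (total z) * q"]
      by (simp only: integral_scaleR_right integral_mult_left_zero has_bochner_integral_iff)
    also have "(a * of_real (total z) * q)\<^sup>2 / (2 * q\<^sup>2) = a\<^sup>2 * of_real ((total z)\<^sup>2) / 2"
      using q0 by (simp add: power_mult_distrib)
    also have "of_real (sqrt (2 * pi)) / q * exp (a\<^sup>2 * of_real ((total z)\<^sup>2) / 2) * exp (- (k\<^sup>2 * of_real (wsquare z) / 2)) =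
      of_real (sqrt (2 * pi)) / q * ?E z"
      unfolding mult.assoc exp_add[symmetric] by (simp add: algebra_simps add_divide_distrib diff_divide_distrib)
    finally show ?thesis by simp
  qed
  have f: "has_bochner_integral lborel (f j u) (of_real (sqrt (2 * pi)) / k * of_real (\<tau> j) *
      exp ((a * q * of_real u)\<^sup>2 * of_real ((\<tau> j)\<^sup>2) / (2 * k\<^sup>2)) * Phi (of_real (\<tau> j) * \<zeta> * of_real u))" if "j \<le> d" for j u
  proof -
    have tj: "\<tau> j > 0" using \<tau>_pos that by simp
    have "Re (k / of_real (\<tau> j)) > 0" "Re ((k / of_real (\<tau> j))\<^sup>2) > 0"
      using k tj by (simp_all add: power_divide flip: of_real_power)
    from gaussian_half_line[OF this, of "a * q * of_real u"]
    show ?thesis unfolding f_def \<zeta>_def using tj k0 by (simp add: power_divide mult_ac)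
  qed
  have Hu: "(\<integral>z. H z u \<partial>lborel) = (of_real (sqrt (2 * pi)) / k) ^ Suc d * of_real (\<Prod>j\<le>d. \<tau> j) * F u" for u
  proof -
    have "H z u = exp (- (q\<^sup>2 * (of_real u)\<^sup>2 / 2)) * ((\<Prod>i\<in>UNIV. f (idx i) u (fst z $ i)) * f 0 u (snd z))" for z
    proof (cases "z \<in> orthant")
      case True
      then have nn: "fst z $ i \<ge> 0" "snd z \<ge> 0" for i by (auto simp: orthant_def)
      have "exp (- (q\<^sup>2 * (of_real u)\<^sup>2 / 2)) * ((\<Prod>i\<in>UNIV. f (idx i) u (fst z $ i)) * f 0 u (snd z)) =
        exp (- (q\<^sup>2 * (of_real u)\<^sup>2 / 2) + ((\<Sum>i\<in>UNIV. (a * q * of_real u) * of_real (fst z $ i) - (k / of_real (\<tau> (idx i)))\<^sup>2 * (of_real (fst z $ i))\<^sup>2 / 2)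
          + ((a * q * of_real u) * of_real (snd z) - (k / of_real (\<tau> 0))\<^sup>2 * (of_real (snd z))\<^sup>2 / 2)))"
        unfolding exp_add exp_sum[OF finite] using nn by (simp add: f_def)
      also have "(\<Sum>i\<in>UNIV. (a * q * of_real u) * of_real (fst z $ i) - (k / of_real (\<tau> (idx i)))\<^sup>2 * (of_real (fst z $ i))\<^sup>2 / 2)
        = (a * q * of_real u) * of_real (\<Sum>i\<in>UNIV. fst z $ i) - k\<^sup>2 / 2 * of_real (\<Sum>i\<in>UNIV. (fst z $ i)\<^sup>2 / (\<tau> (idx i))\<^sup>2)"
        unfolding sum_subtractf of_real_sum sum_distrib_left by (simp add: power_divide mult.commute)
      also have "- (q\<^sup>2 * (of_real u)\<^sup>2 / 2) + ((a * q * of_real u) * of_real (\<Sum>i\<in>UNIV. fst z $ i) - k\<^sup>2 / 2 * of_real (\<Sum>i\<in>UNIV. (fst z $ i)\<^sup>2 / (\<tau> (idx i))\<^sup>2)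
         + ((a * q * of_real u) * of_real (snd z) - (k / of_real (\<tau> 0))\<^sup>2 * (of_real (snd z))\<^sup>2 / 2))
        = ((a * of_real (total z) * q) * of_real u - q\<^sup>2 * (of_real u)\<^sup>2 / 2) + - (k\<^sup>2 * of_real (wsquare z) / 2)"
        unfolding total_def wsquare_def by (simp add: power_divide algebra_simps add_divide_distrib)
      finally show ?thesis using True unfolding H_def exp_add by simp
    next
      case False
      then have "(\<exists>i. \<not> 0 \<le> fst z $ i) \<or> \<not> 0 \<le> snd z" by (auto simp: orthant_def)
      then have "(\<Prod>i\<in>UNIV. f (idx i) u (fst z $ i)) * f 0 u (snd z) = 0"
        by (auto simp: f_def indicator_def)
      then show ?thesis using False by (simp add: H_def)
    qed
    then have "(\<integral>z. H z u \<partial>lborel) = exp (- (q\<^sup>2 * (of_real u)\<^sup>2 / 2)) * (\<integral>z. (\<Prod>i\<in>UNIV. f (idx i) u (fst z $ i)) * f 0 u (snd z) \<partial>lborel)"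
      by simp
    also have "(\<integral>z. (\<Prod>i\<in>UNIV. f (idx i) u (fst z $ i)) * f 0 u (snd z) \<partial>lborel) = (\<Prod>i\<in>UNIV. integral\<^sup>L lborel (f (idx i) u)) * integral\<^sup>L lborel (f 0 u)"
    proof -
      have i: "integrable lborel (f (idx i) u)" "integrable lborel (f 0 u)" for i
        using f[OF idx_range(2)] f[of 0] by (auto simp: has_bochner_integral_iff)
      show ?thesis
        by (subst integral_lborel_times[OF integrable_prod_vec[OF i(1)] i(2)]) (simp add: integral_prod_vec[OF i(1)])
    qed
    also have "\<dots> = (\<Prod>j\<le>d. integral\<^sup>L lborel (f j u))" by (simp add: prod_idx mult.commute)
    also have "\<dots> = (\<Prod>j\<le>d. of_real (sqrt (2 * pi)) / k * of_real (\<tau> j) *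
      exp ((a * q * of_real u)\<^sup>2 * of_real ((\<tau> j)\<^sup>2) / (2 * k\<^sup>2)) * Phi (of_real (\<tau> j) * \<zeta> * of_real u))"
      using f by (intro prod.cong) (auto simp: has_bochner_integral_iff)
    also have "\<dots> = (of_real (sqrt (2 * pi)) / k) ^ Suc d * of_real (\<Prod>j\<le>d. \<tau> j) *
       exp (\<Sum>j\<le>d. (a * q * of_real u)\<^sup>2 * of_real ((\<tau> j)\<^sup>2) / (2 * k\<^sup>2)) * (\<Prod>j\<le>d. Phi (of_real (\<tau> j) * \<zeta> * of_real u))"
      unfolding prod.distrib exp_sum[OF finite_atMost] by (simp add: prod_dividef)
    \<comment> \<open>The exponents produced by completing the square in each coordinate add up to s
      \<zeta>^2 u^2 / 2 and lower q^2 to q^2 - s \<zeta>^2.\<close>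
    also have "(\<Sum>j\<le>d. (a * q * of_real u)\<^sup>2 * of_real ((\<tau> j)\<^sup>2) / (2 * k\<^sup>2)) = of_real s * \<zeta>\<^sup>2 * (of_real u)\<^sup>2 / 2"
    proof -
      have "(\<Sum>j\<le>d. (a * q * of_real u)\<^sup>2 * of_real ((\<tau> j)\<^sup>2) / (2 * k\<^sup>2)) = (a * q * of_real u)\<^sup>2 * of_real s / (2 * k\<^sup>2)"
        unfolding s_def of_real_sum sum_distrib_left sum_divide_distrib ..
      then show ?thesis by (simp add: \<zeta>_def power_mult_distrib power_divide mult_ac)
    qed
    finally have "(\<integral>z. H z u \<partial>lborel) = (of_real (sqrt (2 * pi)) / k) ^ Suc d * of_real (\<Prod>j\<le>d. \<tau> j) * ((\<Prod>j\<le>d. Phi (of_real (\<tau> j) * \<zeta> * of_real u)) *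
       (exp (- (q\<^sup>2 * (of_real u)\<^sup>2 / 2)) * exp (of_real s * \<zeta>\<^sup>2 * (of_real u)\<^sup>2 / 2)))"
      by (simp only: mult_ac)
    also have "exp (- (q\<^sup>2 * (of_real u)\<^sup>2 / 2)) * exp (of_real s * \<zeta>\<^sup>2 * (of_real u)\<^sup>2 / 2) = exp (- ((q\<^sup>2 - of_real s * \<zeta>\<^sup>2) * (of_real u)\<^sup>2 / 2))"
      unfolding exp_add[symmetric] by (simp add: algebra_simps diff_divide_distrib)
    finally show ?thesis unfolding F_def .
  qed
  define C where "C = (of_real (sqrt (2 * pi)) / k) ^ Suc d * of_real (\<Prod>j\<le>d. \<tau> j)"
  have prod0: "complex_of_real (\<Prod>j\<le>d. \<tau> j) \<noteq> 0"
    using prod_\<tau>_pos unfolding of_real_eq_0_iff by linarith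
  have C0: "C \<noteq> 0" unfolding C_def using k0 prod0 by (simp del: of_real_prod)
  \<comment> \<open>\<open>F\<close> is a nonzero constant times a Fubini marginal of
    \<open>H\<close>, hence integrable.\<close>
  have "integrable lborel (\<lambda>u. \<integral>z. H z u \<partial>lborel)"
  proof -
    have "integrable (lborel \<Otimes>\<^sub>M lborel) (\<lambda>(z, u). H z u)"
      using int by (simp add: lborel_prod split_beta')
    from lborel_pair.integrable_snd[OF this] show ?thesis .
  qed
  then have "integrable lborel (\<lambda>u. C * F u)" unfolding Hu C_def .
  then have "integrable lborel (\<lambda>u. inverse C * (C * F u))" by (rule integrable_mult_right)
  then show "integrable lborel F" using C0 by (simp add: mult.assoc[symmetric])
  have "(\<integral>z. \<integral>u. H z u \<partial>lborel \<partial>lborel) = (\<integral>u. \<integral>z. H z u \<partial>lborel \<partial>lborel)"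
    by (rule integral_lborel_swap(1)[OF int])
  then have "of_real (sqrt (2 * pi)) / q * (\<integral>z. indicator orthant z *\<^sub>R
      ?E z \<partial>lborel)
      = C * (\<integral>u. F u \<partial>lborel)"
    unfolding Hz Hu C_def[symmetric] by (simp only: integral_mult_right_zero)
  then have I: "(\<integral>z. indicator orthant z *\<^sub>R
      ?E z \<partial>lborel)
      = q / of_real (sqrt (2 * pi)) * (C * (\<integral>u. F u \<partial>lborel))"
    using q0 by (simp add: field_simps)
  define V where "V = (\<integral>y. indicator Q y *\<^sub>R (1 / csqrt ((k\<^sup>2 / of_real s - a\<^sup>2) + k\<^sup>2 * of_real ((norm y)\<^sup>2))) ^ Suc d \<partial>lborel)"
  have "of_real (sqrt (2 * pi)) ^ Suc d * V = of_real (sphere_area (Suc d) * (sqrt s / (\<Prod>j\<le>d. \<tau> j))) * (q / of_real (sqrt (2 * pi)) * (C * (\<integral>u. F u \<partial>lborel)))"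
    unfolding V_def integral_Q_eq_orthant[OF P k(2)] I ..
  also have "\<dots> = of_real (sqrt (2 * pi)) ^ Suc d * (of_real (sphere_area (Suc d) * sqrt s / sqrt (2 * pi)) * (q / k ^ Suc d) * (\<integral>u. F u \<partial>lborel))"
  proof -
    have "k ^ Suc d \<noteq> 0" using k0 by simp
    with prod0 show ?thesis unfolding C_def power_divide of_real_mult of_real_divide
      by (simp add: field_simps del: power_Suc of_real_prod)
  qed
  finally have "V = of_real (sphere_area (Suc d) * sqrt s / sqrt (2 * pi)) * (q / k ^ Suc d) * (\<integral>u. F u \<partial>lborel)"
    by (subst (asm) mult_left_cancel) auto
  then show "(\<integral>y. indicator Q y *\<^sub>R (1 / csqrt ((k\<^sup>2 / of_real s - a\<^sup>2) + k\<^sup>2 * of_real ((norm y)\<^sup>2))) ^ Suc d \<partial>lborel) =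
      of_real (sphere_area (Suc d) * sqrt s / sqrt (2 * pi)) * (q / k ^ Suc d) * (\<integral>u. F u \<partial>lborel)"
    unfolding V_def .
qed

end

section \<open>Integrability of the density at ideal vertices\<close>

lemma integrable_abs_powr:
  assumes "0 < \<gamma>" "\<gamma> < 1" "R \<ge> 0"
  shows "integrable lborel (\<lambda>t::real. indicator {-R..R} (t - c) * \<bar>t - c\<bar> powr (- \<gamma>))"
proof -
  have "((\<lambda>x. x powr (- \<gamma>)) has_integral (R powr (- \<gamma> + 1) / (- \<gamma> + 1))) {0..R}"
    by (rule has_integral_powr_from_0) (use assms in auto)
  then have "(\<lambda>x. x powr (- \<gamma>)) absolutely_integrable_on {0..R}"
    by (intro nonnegative_absolutely_integrable_1) (auto simp: has_integral_integrable)
  then have "integrable lebesgue (\<lambda>x. indicator {0..R} x *\<^sub>R x powr (- \<gamma>))"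
    by (simp add: set_integrable_def)
  then have h: "integrable lborel (\<lambda>x. indicator {0..R} x *\<^sub>R x powr (- \<gamma>))"
    by (subst (asm) integrable_completion) auto
  have "integrable lborel (\<lambda>x. indicator {0..R} (- x) *\<^sub>R (- x) powr (- \<gamma>))"
    using lborel_integrable_real_affine[OF h, of "-1" 0] by simp
  from Bochner_Integration.integrable_add[OF h this]
  have "integrable lborel (\<lambda>x. indicator {0..R} x *\<^sub>R x powr (- \<gamma>) + indicator {0..R} (- x) *\<^sub>R (- x) powr (- \<gamma>))" .
  then have "integrable lborel (\<lambda>x. indicator {-R..R} x * \<bar>x\<bar> powr (- \<gamma>))"
    by (rule Bochner_Integration.integrable_bound) (auto simp: indicator_def abs_if)
  from lborel_integrable_real_affine[OF this, of 1 "- c"] show ?thesis by simp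
qed

context orthocentric_simplex
begin

lemma v_in_Q: "j \<le> d \<Longrightarrow> v j \<in> Q"
  unfolding Q_def by (rule hull_inc) auto

lemma Q_barycentric:
  assumes "y \<in> Q"
  obtains p where "\<And>j. j \<le> d \<Longrightarrow> 0 \<le> p j" "(\<Sum>j\<le>d. p j) = 1" "y = (\<Sum>j\<le>d. p j *\<^sub>R v j)"
proof -
  have inj: "inj idx" using idx by (simp add: bij_betw_def)
  obtain x :: "real^'n" where x: "y = v 0 + g x" "\<forall>i. 0 \<le> x $ i" "(\<Sum>i\<in>UNIV. x $ i) \<le> 1" using assms unfolding Q_eq by blast
  define p where "p = (\<lambda>j. if j = 0 then 1 - (\<Sum>i\<in>UNIV. x $ i) else x $ (inv idx j))"
  show ?thesis
  proof (rule that[of p])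
    show "(\<Sum>j\<le>d. p j) = 1" unfolding sum_idx p_def by (simp add: inj idx_range(3))
    show "y = (\<Sum>j\<le>d. p j *\<^sub>R v j)" using g_comb[of 1 x] x(1) by (simp add: p_def)
  qed (use x in \<open>auto simp: p_def\<close>)
qed

text \<open>A common bound for all edge lengths; the summand 1 keeps it positive, as it serves as a
  divisor.\<close>

definition spread :: real where
  "spread = 1 + (\<Sum>j\<le>d. \<Sum>m\<le>d. norm (v j - v m))"

lemma norm_le_spread: "j \<le> d \<Longrightarrow> m \<le> d \<Longrightarrow> norm (v j - v m) \<le> spread"
proof -
  assume jm: "j \<le> d" "m \<le> d"
  have "norm (v j - v m) \<le> (\<Sum>m\<le>d. norm (v j - v m))"
    using jm by (intro member_le_sum[where f="\<lambda>m. norm (v j - v m)"]) auto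
  also have "\<dots> \<le> (\<Sum>j\<le>d. \<Sum>m\<le>d. norm (v j - v m))"
    using jm by (intro member_le_sum[where f="\<lambda>j. \<Sum>m\<le>d. norm (v j - v m)"]) (auto intro: sum_nonneg)
  finally show ?thesis by (simp add: spread_def)
qed

lemma spread_pos: "spread > 0"
  unfolding spread_def by (intro add_pos_nonneg sum_nonneg) auto

text \<open>The inequality 1 + \<kappa> |v j|^2 >= 0 with the orthocentric value of |v j|^2
  inserted; equality marks an ideal vertex.\<close>

lemma vertex_bound:
  assumes "\<kappa> < 0" "Q \<subseteq> klein_cball \<kappa>" "j \<le> d"
  shows "- \<kappa> / (\<tau> j)\<^sup>2 \<le> 1 - \<kappa> / s"
proof -
  have "norm (v j) \<le> 1 / sqrt (- \<kappa>)" using v_in_Q[OF assms(3)] assms by (auto simp: klein_cball_def)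
  then have "(norm (v j))\<^sup>2 \<le> (1 / sqrt (- \<kappa>))\<^sup>2" by (intro power_mono) auto
  also have "(1 / sqrt (- \<kappa>))\<^sup>2 = 1 / (- \<kappa>)" using assms by (simp add: power_divide)
  finally have "- \<kappa> * (norm (v j))\<^sup>2 \<le> 1" using assms by (simp add: field_simps)
  moreover have "(norm (v j))\<^sup>2 = - 1 / s + 1 / (\<tau> j)\<^sup>2"
    using inner_v[OF assms(3) assms(3)] by (simp add: power2_norm_eq_inner)
  ultimately show ?thesis by (simp add: algebra_simps)
qed

text \<open>Let m carry the largest barycentric weight p m. Then \<Sum> p_j^2 <= p m, and
  \<open>vertex_bound\<close> gives 1 + \<kappa> |y|^2 >= (1 - p m) (1 - \<kappa> / s) >= 1 - p m,
  while |y - v m| is at most (1 - p m) times \<open>spread\<close>. So inside Q the form cannot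
  vanish faster than linearly in the distance to an ideal vertex.\<close>

lemma klein_form_ge_dist:
  assumes \<kappa>: "\<kappa> < 0" "Q \<subseteq> klein_cball \<kappa>" and y: "y \<in> Q"
  obtains m where "m \<le> d" "norm (y - v m) \<le> spread * (1 + \<kappa> * (norm y)\<^sup>2)" "norm (y - v m) \<le> spread"
proof -
  obtain p where p: "\<And>j. j \<le> d \<Longrightarrow> 0 \<le> p j" "(\<Sum>j\<le>d. p j) = 1" "y = (\<Sum>j\<le>d. p j *\<^sub>R v j)"
    using Q_barycentric[OF y] by blast
  have "\<exists>m\<in>{..d}. p m = Max (p ` {..d})" 
    using Max_in[of "p ` {..d}"] by (metis atMost_iff empty_iff finite_atMost finite_imageI imageE imageI le0)
  then obtain m where m: "m \<le> d" "\<And>j. j \<le> d \<Longrightarrow> p j \<le> p m"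
    by (metis Max_ge atMost_iff finite_atMost finite_imageI imageI)
  have pm1: "p m \<le> 1" using member_le_sum[of m "{..d}" p] p m by simp
  have "(\<Sum>j\<le>d. (p j)\<^sup>2) \<le> (\<Sum>j\<le>d. p m * p j)"
    unfolding power2_eq_square using m p by (intro sum_mono mult_right_mono) auto
  also have "\<dots> = p m" using p(2) by (simp add: sum_distrib_left[symmetric])
  finally have sq: "(\<Sum>j\<le>d. (p j)\<^sup>2) \<le> p m" .
  have "(\<Sum>j\<le>d. (p j)\<^sup>2 * (- \<kappa> / (\<tau> j)\<^sup>2)) \<le> (\<Sum>j\<le>d. (p j)\<^sup>2 * (1 - \<kappa> / s))"
    using vertex_bound[OF \<kappa>] by (intro sum_mono mult_left_mono) auto
  also have "\<dots> \<le> p m * (1 - \<kappa> / s)"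
    unfolding sum_distrib_right[symmetric] using sq \<kappa> s_pos by (intro mult_right_mono) (auto simp: divide_nonpos_pos)
  finally have 1: "(\<Sum>j\<le>d. (p j)\<^sup>2 * (- \<kappa> / (\<tau> j)\<^sup>2)) \<le> p m * (1 - \<kappa> / s)" .
  have "1 + \<kappa> * (norm y)\<^sup>2 = (1 - \<kappa> / s) - (\<Sum>j\<le>d. (p j)\<^sup>2 * (- \<kappa> / (\<tau> j)\<^sup>2))"
    unfolding p(3) norm_comb p(2) by (simp add: algebra_simps sum_distrib_left sum_negf)
  also have "\<dots> \<ge> (1 - p m) * (1 - \<kappa> / s)" using 1 by (simp only: left_diff_distrib mult_1_left)
  finally have 2: "(1 - p m) * (1 - \<kappa> / s) \<le> 1 + \<kappa> * (norm y)\<^sup>2" .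
  have "(1 - p m) * 1 \<le> (1 - p m) * (1 - \<kappa> / s)" using pm1 \<kappa> s_pos
    by (intro mult_left_mono) (auto simp: divide_nonpos_pos)
  with 2 have 3: "1 - p m \<le> 1 + \<kappa> * (norm y)\<^sup>2" by simp
  have "y - v m = (\<Sum>j\<le>d. p j *\<^sub>R v j) - (\<Sum>j\<le>d. p j) *\<^sub>R v m" using p by simp
  also have "\<dots> = (\<Sum>j\<le>d. p j *\<^sub>R (v j - v m))"
    by (simp add: scaleR_left.sum sum_subtractf scaleR_diff_right)
  also have "\<dots> = (\<Sum>j\<in>{..d} - {m}. p j *\<^sub>R (v j - v m))"
    using m(1) by (subst sum.remove[of _ m]) auto
  finally have "norm (y - v m) \<le> (\<Sum>j\<in>{..d} - {m}. norm (p j *\<^sub>R (v j - v m)))"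
    using norm_sum by metis
  also have "\<dots> \<le> (\<Sum>j\<in>{..d} - {m}. p j * spread)"
    using p(1) norm_le_spread m(1) by (intro sum_mono) (auto intro!: mult_left_mono)
  also have "\<dots> = (1 - p m) * spread"
    using p(2) m(1) by (simp add: sum_distrib_right[symmetric] sum_diff1)
  finally have 4: "norm (y - v m) \<le> (1 - p m) * spread" .
  show ?thesis
  proof (rule that[OF m(1)])
    have "(1 - p m) * spread \<le> (1 + \<kappa> * (norm y)\<^sup>2) * spread" using 3 spread_pos by (intro mult_right_mono) auto
    with 4 show "norm (y - v m) \<le> spread * (1 + \<kappa> * (norm y)\<^sup>2)" by (simp add: mult.commute)
    have "(1 - p m) * spread \<le> 1 * spread" using p(1)[OF m(1)] spread_pos by (intro mult_right_mono) auto
    with 4 show "norm (y - v m) \<le> spread" by simp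
  qed
qed

text \<open>Since \<open>0 powr a = 0\<close>, a product of negative powers of coordinate distances
  is no majorant where y shares a coordinate with a vertex; these hyperplanes are null sets.\<close>

lemma AE_coordinate_ne: "AE y in lborel. (y::real^'n) $ i \<noteq> c"
proof -
  have "{y::real^'n. y $ i = c} = {y. axis i 1 \<bullet> y = c}" by (simp add: inner_axis' inner_axis)
  moreover have "negligible {y::real^'n. axis i 1 \<bullet> y = c}"
    by (rule negligible_hyperplane) (auto simp: axis_eq_0_iff)
  ultimately have "{y::real^'n. y $ i = c} \<in> null_sets lebesgue" by (simp add: negligible_iff_null_sets)
  moreover have "closed {y::real^'n. y $ i = c}"
    by (intro closed_Collect_eq continuous_intros)
  ultimately have "{y::real^'n. y $ i = c} \<in> null_sets lborel"
    by (auto simp: null_sets_completion_iff)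
  then show ?thesis by (rule AE_I') auto
qed

text \<open>At an ideal vertex the density blows up like the power \<open>- (d + 1) / 2\<close> of the distance; this is dominated by
  a product of one-dimensional powers with exponent \<open>- (d + 1) / (2 * d) > - 1\<close>, which is where \<open>d \<ge> 2\<close> enters.\<close>

lemma klein_density_integrable:
  assumes "Q \<subseteq> klein_cball \<kappa>"
  shows "integrable lborel (\<lambda>y. indicator Q y *\<^sub>R klein_density \<kappa> y)"
proof (cases "\<kappa> \<ge> 0")
  case True
  have pos: "1 + \<kappa> * (norm y)\<^sup>2 > 0" for y :: "real^'n" using True by (simp add: add_pos_nonneg)
  have "continuous_on Q (klein_density \<kappa>)"
    unfolding klein_density_def using pos by (auto intro!: continuous_intros simp: less_imp_neq[THEN not_sym])
  then show ?thesis by (rule borel_integrable_compact[OF Q_compact])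
next
  case False
  then have \<kappa>: "\<kappa> < 0" by simp
  define \<beta> \<gamma> where "\<beta> = (real d + 1) / 2" and "\<gamma> = \<beta> / real d"
  have \<gamma>: "0 < \<gamma>" "\<gamma> < 1" using d_ge_2 by (auto simp: \<gamma>_def \<beta>_def field_simps)
  have \<beta>: "\<beta> > 0" by (simp add: \<beta>_def)
  let ?h = "\<lambda>m i t. indicator {-spread..spread} (t - v m $ i) * \<bar>t - v m $ i\<bar> powr (- \<gamma>) :: real"
  show ?thesis
  proof (rule Bochner_Integration.integrable_bound)
    show "integrable lborel (\<lambda>y::real^'n. spread powr \<beta> * (\<Sum>m\<le>d. \<Prod>i\<in>UNIV. ?h m i (y $ i)))"
      using \<gamma> spread_pos by (intro integrable_mult_right Bochner_Integration.integrable_sum integrable_prod_vec integrable_abs_powr) auto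
    show "(\<lambda>y. indicator Q y *\<^sub>R klein_density \<kappa> y) \<in> borel_measurable lborel"
      unfolding klein_density_def by measurable
    have "AE y in lborel. \<forall>i\<in>UNIV. \<forall>m\<in>{..d}. (y::real^'n) $ i \<noteq> v m $ i"
      by (intro AE_finite_allI AE_coordinate_ne) auto
    then show "AE y in lborel. norm (indicator Q y *\<^sub>R klein_density \<kappa> y) \<le> norm (spread powr \<beta> * (\<Sum>m\<le>d. \<Prod>i\<in>UNIV. ?h m i (y $ i)))"
    proof eventually_elim
      case (elim y)
      have h0: "0 \<le> (\<Prod>i\<in>UNIV. ?h m i (y $ i))" for m by (intro prod_nonneg) auto
      show ?case
      proof (cases "y \<in> Q")
        case True
        obtain m where m: "m \<le> d" "norm (y - v m) \<le> spread * (1 + \<kappa> * (norm y)\<^sup>2)" "norm (y - v m) \<le> spread"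
          using klein_form_ge_dist[OF \<kappa> assms True] by blast
        have c: "0 < \<bar>y $ i - v m $ i\<bar>" "\<bar>y $ i - v m $ i\<bar> \<le> norm (y - v m)" for i
          using elim m(1) component_le_norm_cart[of "y - v m" i] by auto
        have n0: "norm (y - v m) > 0" using c less_le_trans by blast
        have e: "(- real d - 1) / 2 = - \<beta>" unfolding \<beta>_def by (simp add: diff_divide_distrib add_divide_distrib)
        have "norm (indicator Q y *\<^sub>R klein_density \<kappa> y) = (1 + \<kappa> * (norm y)\<^sup>2) powr (- \<beta>)"
          using True by (simp add: klein_density_def card_n e)
        also have "\<dots> \<le> (norm (y - v m) / spread) powr (- \<beta>)"
          using m(2) n0 spread_pos \<beta> by (intro powr_mono2') (auto simp: field_simps)
        also have "\<dots> = spread powr \<beta> * norm (y - v m) powr (- \<beta>)"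
          using n0 spread_pos by (simp add: powr_divide powr_minus field_simps)
        \<comment> \<open>The exponent is shared equally among the d coordinates; each coordinate
          distance is at most the norm, so its negative power is at least as large.\<close>
        also have "norm (y - v m) powr (- \<beta>) = (\<Prod>i\<in>(UNIV::'n set). norm (y - v m) powr (- \<gamma>))"
          using d_ge_2 n0 by (simp add: card_n powr_power \<gamma>_def)
        also have "\<dots> \<le> (\<Prod>i\<in>UNIV. ?h m i (y $ i))"
        proof (rule prod_mono, safe)
          fix i
          have "\<bar>y $ i - v m $ i\<bar> \<le> spread" using c[of i] m(3) by linarith
          then have "?h m i (y $ i) = \<bar>y $ i - v m $ i\<bar> powr (- \<gamma>)" by (simp add: indicator_def abs_le_iff)
          then show "norm (y - v m) powr (- \<gamma>) \<le> ?h m i (y $ i)"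
            using c[of i] \<gamma> by (auto intro!: powr_mono2')
        qed auto
        also have "\<dots> \<le> (\<Sum>m\<le>d. \<Prod>i\<in>UNIV. ?h m i (y $ i))"
          using m(1) h0 by (intro member_le_sum[where f="\<lambda>m. \<Prod>i\<in>UNIV. ?h m i (y $ i)"]) auto
        finally have "norm (indicator Q y *\<^sub>R klein_density \<kappa> y) \<le> spread powr \<beta> * (\<Sum>m\<le>d. \<Prod>i\<in>UNIV. ?h m i (y $ i))"
          by (simp add: mult_left_mono)
        then show ?thesis by simp
      qed simp
    qed
  qed
qed

end

section \<open>Removing the regularisation\<close>

text \<open>The candidate squares to the right number, and its positive real part selects the
  principal branch.\<close>

lemma csqrt_imaginary:
  assumes "x > 0" "\<bar>\<sigma>\<bar> = 1"
  shows "csqrt (\<i> * of_real (\<sigma> * x)) = of_real (sqrt x / sqrt 2) * (1 + \<i> * of_real \<sigma>)"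
proof (rule csqrt_unique)
  have "\<sigma>\<^sup>2 = 1" using assms(2) by (metis power2_abs one_power2)
  then have "(1 + \<i> * of_real \<sigma>)\<^sup>2 = 2 * \<i> * complex_of_real \<sigma>"
    by (simp add: power2_sum power_mult_distrib flip: of_real_power)
  moreover have "(complex_of_real (sqrt x / sqrt 2))\<^sup>2 = of_real (x / 2)"
    using assms by (simp only: of_real_power[symmetric] power_divide) simp
  ultimately show "(of_real (sqrt x / sqrt 2) * (1 + \<i> * of_real \<sigma>))\<^sup>2 = \<i> * of_real (\<sigma> * x)"
    unfolding power_mult_distrib by simp
qed (use assms in simp)

lemma tendsto_Phi [tendsto_intros]: "(f \<longlongrightarrow> l) F \<Longrightarrow> ((\<lambda>x. Phi (f x)) \<longlongrightarrow> Phi l) F"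
  by (rule isCont_tendsto_compose[OF DERIV_isCont[OF Phi_has_field_derivative]])

context orthocentric_simplex
begin

lemma continuous_ray_fun: "continuous_on S (ray_fun d \<tau> \<zeta> w2)"
  unfolding ray_fun_def[abs_def] by (intro continuous_intros) auto

lemma ray_fun_tendsto:
  assumes "\<zeta> \<longlonglongrightarrow> \<zeta>0" "w2 \<longlonglongrightarrow> w0"
  shows "(\<lambda>n. ray_fun d \<tau> (\<zeta> n) (w2 n) u) \<longlonglongrightarrow> ray_fun d \<tau> \<zeta>0 w0 u"
  unfolding ray_fun_def by (intro tendsto_intros assms) auto

text \<open>Convergent parameter sequences are bounded, so all functions of the sequence are
  sections of one continuous function on a compact set.\<close>

lemma ray_fun_bounded:
  assumes "\<zeta> \<longlonglongrightarrow> \<zeta>0" "w2 \<longlonglongrightarrow> w0"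
  shows "\<exists>M. \<forall>n. \<forall>u\<in>{0..B}. norm (ray_fun d \<tau> (\<zeta> n) (w2 n) u) \<le> M"
proof -
  obtain R where R: "\<And>n. norm (\<zeta> n) \<le> R" using convergent_imp_Bseq[of \<zeta>] assms(1) by (auto simp: convergent_def Bseq_def)
  obtain R' where R': "\<And>n. norm (w2 n) \<le> R'" using convergent_imp_Bseq[of w2] assms(2) by (auto simp: convergent_def Bseq_def)
  let ?K = "cball (0::complex) R \<times> cball (0::complex) R' \<times> {0..B}"
  have "continuous_on ?K (\<lambda>p. ray_fun d \<tau> (fst p) (fst (snd p)) (snd (snd p)))"
    unfolding ray_fun_def by (intro continuous_intros) auto
  moreover have "compact ?K" by (intro compact_Times) auto
  ultimately have "bounded ((\<lambda>p. ray_fun d \<tau> (fst p) (fst (snd p)) (snd (snd p))) ` ?K)"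
    by (intro compact_imp_bounded compact_continuous_image)
  then obtain M where M: "\<And>p. p \<in> ?K \<Longrightarrow> norm (ray_fun d \<tau> (fst p) (fst (snd p)) (snd (snd p))) \<le> M"
    unfolding bounded_iff by blast
  have "norm (ray_fun d \<tau> (\<zeta> n) (w2 n) u) \<le> M" if "u \<in> {0..B}" for n u
    using M[of "(\<zeta> n, w2 n, u)"] R R' that by simp
  then show ?thesis by blast
qed

lemma ray_fun_tail:
  assumes \<zeta>: "\<zeta> \<longlonglongrightarrow> \<zeta>0" and w: "w2 \<longlonglongrightarrow> w0" and w0: "w0 \<noteq> 0"
    and re: "\<And>n. Re (w2 n) \<ge> 0" "\<And>n. Re (w2 n + of_real s * (\<zeta> n)\<^sup>2) \<ge> 0"
    and z0: "(\<forall>n. \<zeta> n = 0) \<or> Re \<zeta>0 > 0"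
    and nz: "\<And>j. j \<le> d \<Longrightarrow> w0 + of_real ((\<tau> j)\<^sup>2) * \<zeta>0\<^sup>2 \<noteq> 0"
  shows "\<exists>N C. \<forall>n\<ge>N. \<forall>B B'. 1 \<le> B \<longrightarrow> B \<le> B' \<longrightarrow> norm (integral {B..B'} (ray_fun d \<tau> (\<zeta> n) (w2 n))) \<le> C / B"
proof (cases "\<forall>n. \<zeta> n = 0")
  case True
  have "\<forall>\<^sub>F n in sequentially. norm (w2 n) > norm w0 / 2"
    by (rule order_tendstoD(1)[OF tendsto_norm[OF w]]) (use w0 in auto)
  then obtain N where N: "\<And>n. n \<ge> N \<Longrightarrow> norm (w2 n) > norm w0 / 2" by (auto simp: eventually_sequentially)
  let ?G = "1 :: real"
  show ?thesis
  proof (intro exI allI impI)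
    fix n and B B' :: real assume n: "n \<ge> N" and B: "1 \<le> B" "B \<le> B'"
    have eq: "ray_fun d \<tau> (\<zeta> n) (w2 n) = (\<lambda>u. exp (- (w2 n * (of_real u)\<^sup>2 / 2)) * (1 / 2) ^ d)"
      using True by (auto simp: ray_fun_def power_divide fun_eq_iff)
    have "norm (integral {B..B'} (ray_fun d \<tau> (\<zeta> n) (w2 n))) \<le> 4 * 1 / (norm (w2 n) * B)"
      unfolding eq
    proof (rule oscillatory_tail_le[where g'="\<lambda>_. 0"])
      show "w2 n \<noteq> 0" using N[OF n] by auto
    qed (use re B in \<open>auto simp: norm_power norm_divide power_le_one\<close>)
    also have "\<dots> \<le> 4 * 1 / (norm w0 / 2 * B)"
    proof (rule divide_left_mono)
      show "norm w0 / 2 * B \<le> norm (w2 n) * B" using N[OF n] B by (intro mult_right_mono) auto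
      show "0 < norm (w2 n) * B * (norm w0 / 2 * B)" using N[OF n] B w0 by (intro mult_pos_pos) (auto intro: le_less_trans[rotated])
    qed auto
    also have "\<dots> = (8 / norm w0) / B" by simp
    finally show "norm (integral {B..B'} (ray_fun d \<tau> (\<zeta> n) (w2 n))) \<le> (8 / norm w0) / B" .
  qed
next
  case False
  then have rz: "Re \<zeta>0 > 0" using z0 by blast
  define A where "A = insert (Re \<zeta>0) (insert (norm w0) ((\<lambda>j. norm (w0 + of_real ((\<tau> j)\<^sup>2) * \<zeta>0\<^sup>2)) ` {..d}))"
  have A: "finite A" "A \<noteq> {}" by (auto simp: A_def)
  define \<rho> where "\<rho> = Min A / 2"
  have "0 < Min A" unfolding Min_gr_iff[OF A] using rz w0 nz by (auto simp: A_def)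
  then have \<rho>: "0 < \<rho>" and \<rho>2: "\<rho> < 2 * \<rho>" by (auto simp: \<rho>_def)
  have min: "2 * \<rho> \<le> x" if "x \<in> A" for x using Min_le[OF A(1) that] by (simp add: \<rho>_def)
  have le: "2 * \<rho> \<le> Re \<zeta>0" "2 * \<rho> \<le> norm w0" "\<And>j. j \<le> d \<Longrightarrow> 2 * \<rho> \<le> norm (w0 + of_real ((\<tau> j)\<^sup>2) * \<zeta>0\<^sup>2)"
    by (auto intro!: min simp: A_def)
  define R where "R = norm \<zeta>0 + 1"
  obtain C where C: "\<And>\<zeta> w2 B B'. \<lbrakk>Re \<zeta> \<ge> \<rho>; norm \<zeta> \<le> R; Re w2 \<ge> 0;
      Re (w2 + of_real (\<Sum>j\<le>d. (\<tau> j)\<^sup>2) * \<zeta>\<^sup>2) \<ge> 0; norm w2 \<ge> \<rho>;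
      \<And>j. j \<le> d \<Longrightarrow> norm (w2 + of_real ((\<tau> j)\<^sup>2) * \<zeta>\<^sup>2) \<ge> \<rho>; 1 \<le> B; B \<le> B'\<rbrakk> \<Longrightarrow>
      norm (integral {B..B'} (ray_fun d \<tau> \<zeta> w2)) \<le> C / B"
    using product_tail_le[of d \<tau> \<rho> R thesis] d_ge_2 \<tau>_pos \<rho> by auto
  have "\<forall>\<^sub>F n in sequentially. \<rho> < Re (\<zeta> n)"
    by (rule order_tendstoD(1)[OF tendsto_Re[OF \<zeta>]]) (use le \<rho>2 in linarith)
  moreover have "\<forall>\<^sub>F n in sequentially. norm (\<zeta> n) < R"
    by (rule order_tendstoD(2)[OF tendsto_norm[OF \<zeta>]]) (simp add: R_def)
  moreover have "\<forall>\<^sub>F n in sequentially. \<rho> < norm (w2 n)"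
    by (rule order_tendstoD(1)[OF tendsto_norm[OF w]]) (use le \<rho>2 in linarith)
  moreover have "\<forall>\<^sub>F n in sequentially. \<forall>j\<in>{..d}. \<rho> < norm (w2 n + of_real ((\<tau> j)\<^sup>2) * (\<zeta> n)\<^sup>2)"
  proof (rule eventually_ball_finite; safe)
    fix j assume "j \<le> d"
    show "\<forall>\<^sub>F n in sequentially. \<rho> < norm (w2 n + of_real ((\<tau> j)\<^sup>2) * (\<zeta> n)\<^sup>2)"
    proof (rule order_tendstoD(1))
      show "(\<lambda>n. norm (w2 n + of_real ((\<tau> j)\<^sup>2) * (\<zeta> n)\<^sup>2)) \<longlonglongrightarrow> norm (w0 + of_real ((\<tau> j)\<^sup>2) * \<zeta>0\<^sup>2)"
        by (intro tendsto_intros w \<zeta>)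
      show "\<rho> < norm (w0 + of_real ((\<tau> j)\<^sup>2) * \<zeta>0\<^sup>2)"
        using le(3)[OF \<open>j \<le> d\<close>] \<rho>2 by linarith
    qed
  qed
  ultimately have "\<forall>\<^sub>F n in sequentially. \<rho> < Re (\<zeta> n) \<and> norm (\<zeta> n) < R \<and> \<rho> < norm (w2 n) \<and> (\<forall>j\<in>{..d}. \<rho> < norm (w2 n + of_real ((\<tau> j)\<^sup>2) * (\<zeta> n)\<^sup>2))"
    by eventually_elim blast
  then obtain N where N: "\<And>n. n \<ge> N \<Longrightarrow> \<rho> < Re (\<zeta> n) \<and> norm (\<zeta> n) < R \<and> \<rho> < norm (w2 n) \<and> (\<forall>j\<in>{..d}. \<rho> < norm (w2 n + of_real ((\<tau> j)\<^sup>2) * (\<zeta> n)\<^sup>2))"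
    unfolding eventually_sequentially by blast
  show ?thesis
  proof (intro exI allI impI)
    fix n and B B' :: real assume n: "n \<ge> N" and B: "1 \<le> B" "B \<le> B'"
    show "norm (integral {B..B'} (ray_fun d \<tau> (\<zeta> n) (w2 n))) \<le> C / B"
      by (rule C) (use N[OF n] B re[of n] in \<open>auto simp: s_def less_imp_le\<close>)
  qed
qed

text \<open>The imaginary parts are kept at exactly \<sigma> and \<sigma> \<kappa>, so that the form
  has imaginary part of modulus 1 + \<kappa> |y|^2 at every stage. Its own modulus is thus at least
  that, and the density itself dominates, also near ideal vertices. The limit carries the constant e
  with e^2 = \<i> \<sigma>.\<close>

lemma regularised_volume_tendsto:
  fixes P K :: "nat \<Rightarrow> complex"
  assumes Q: "Q \<subseteq> klein_cball \<kappa>" and \<sigma>: "\<bar>\<sigma>\<bar> = 1"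
    and re: "\<And>n. Re (P n) > 0" "\<And>n. Re (K n) > 0"
    and im: "\<And>n. Im (P n) = \<sigma>" "\<And>n. Im (K n) = \<sigma> * \<kappa>"
    and lim: "P \<longlonglongrightarrow> \<i> * of_real \<sigma>" "K \<longlonglongrightarrow> \<i> * of_real (\<sigma> * \<kappa>)"
  shows "(\<lambda>n. \<integral>y. indicator Q y *\<^sub>R (1 / csqrt (P n + K n * of_real ((norm y)\<^sup>2))) ^ Suc d \<partial>lborel)
    \<longlonglongrightarrow> of_real (klein_vol \<kappa> Q) * (of_real (sqrt 2) / (1 + \<i> * of_real \<sigma>)) ^ Suc d"
proof -
  define e where "e = (1 + \<i> * complex_of_real \<sigma>) / of_real (sqrt 2)"
  have pos: "1 + \<kappa> * (norm y)\<^sup>2 > 0" if "y \<in> Q" "y \<notin> v ` {..d}" for y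
  proof (cases "\<kappa> \<ge> 0")
    case True then show ?thesis by (simp add: add_pos_nonneg)
  next
    case False
    then have "\<kappa> < 0" by simp
    obtain m where m: "m \<le> d" "norm (y - v m) \<le> spread * (1 + \<kappa> * (norm y)\<^sup>2)"
      by (rule klein_form_ge_dist[OF \<open>\<kappa> < 0\<close> Q \<open>y \<in> Q\<close>])
    then have "0 < norm (y - v m)" using that by auto
    with m(2) have "0 < spread * (1 + \<kappa> * (norm y)\<^sup>2)" by linarith
    with spread_pos show ?thesis by (simp add: zero_less_mult_iff)
  qed
  have dens: "(1 / sqrt x) ^ Suc d = x powr (- (real d + 1) / 2)" if "x > 0" for x :: real
  proof -
    have "1 / sqrt x = x powr (- (1/2))"
      using that by (simp only: powr_minus_divide powr_half_sqrt less_imp_le)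
    then have "(1 / sqrt x) ^ Suc d = x powr (- (1/2) * real (Suc d))"
      using that by (simp only: powr_power) simp
    also have "- (1/2) * real (Suc d) = - (real d + 1) / 2" by (simp add: add_divide_distrib diff_divide_distrib)
    finally show ?thesis .
  qed
  have ae: "AE y in lborel. y \<notin> v ` {..d}"
  proof -
    have "AE y in lborel. \<forall>j\<in>{..d}. y \<noteq> v j" by (intro AE_finite_allI AE_lborel_singleton) auto
    then show ?thesis by eventually_elim auto
  qed
  have dint: "integrable lborel (\<lambda>y. indicator Q y *\<^sub>R klein_density \<kappa> y)" by (rule klein_density_integrable[OF Q])
  have kd: "klein_density \<kappa> y = (1 / sqrt (1 + \<kappa> * (norm y)\<^sup>2)) ^ Suc d" if "y \<in> Q" "y \<notin> v ` {..d}" for y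
    unfolding dens[OF pos[OF that]] by (simp add: klein_density_def card_n)
  have "(\<lambda>n. \<integral>y. indicator Q y *\<^sub>R (1 / csqrt (P n + K n * of_real ((norm y)\<^sup>2))) ^ Suc d \<partial>lborel)
    \<longlonglongrightarrow> (\<integral>y. of_real (indicator Q y *\<^sub>R klein_density \<kappa> y) * (1 / e) ^ Suc d \<partial>lborel)"
  proof (rule integral_dominated_convergence[where w="\<lambda>y. indicator Q y *\<^sub>R klein_density \<kappa> y"])
    show "(\<lambda>y. complex_of_real (indicator Q y *\<^sub>R klein_density \<kappa> y) * (1 / e) ^ Suc d) \<in> borel_measurable lborel"
      using borel_measurable_integrable[OF dint] by measurable
    show "(\<lambda>y. indicator Q y *\<^sub>R (1 / csqrt (P n + K n * of_real ((norm y)\<^sup>2))) ^ Suc d) \<in> borel_measurable lborel" for n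
    proof -
      have "Re (P n + K n * of_real ((norm y)\<^sup>2)) > 0" for y :: "real^'n"
        using re[of n] by (simp add: add_pos_nonneg)
      then have "isCont (\<lambda>y::real^'n. csqrt (P n + K n * of_real ((norm y)\<^sup>2))) y" for y
        by (intro isCont_o2[OF _ continuous_at_csqrt] continuous_intros)
          (metis complex_nonpos_Reals_iff not_le)
      then have [measurable]: "(\<lambda>y::real^'n. csqrt (P n + K n * of_real ((norm y)\<^sup>2))) \<in> borel_measurable borel"
        by (intro borel_measurable_continuous_onI continuous_at_imp_continuous_on) auto
      show ?thesis by measurable
    qed
    show "AE y in lborel. (\<lambda>n. indicator Q y *\<^sub>R (1 / csqrt (P n + K n * of_real ((norm y)\<^sup>2))) ^ Suc d)
       \<longlonglongrightarrow> of_real (indicator Q y *\<^sub>R klein_density \<kappa> y) * (1 / e) ^ Suc d"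
      using ae
    proof eventually_elim
      case (elim y)
      show ?case
      proof (cases "y \<in> Q")
        case True
        define x where "x = 1 + \<kappa> * (norm y)\<^sup>2"
        have x: "x > 0" using pos[OF True elim] by (simp add: x_def)
        have \<sigma>0: "\<sigma> \<noteq> 0" using \<sigma> by auto
        have c: "csqrt (\<i> * of_real (\<sigma> * x)) = of_real (sqrt x) * e"
          unfolding csqrt_imaginary[OF x \<sigma>] e_def by simp
        have e0: "e \<noteq> 0" unfolding e_def by (auto simp: complex_eq_iff)
        have "(\<lambda>n. P n + K n * of_real ((norm y)\<^sup>2)) \<longlonglongrightarrow> \<i> * of_real \<sigma> + \<i> * of_real (\<sigma> * \<kappa>) * of_real ((norm y)\<^sup>2)"
          by (intro tendsto_intros lim)
        also have "\<i> * of_real \<sigma> + \<i> * of_real (\<sigma> * \<kappa>) * of_real ((norm y)\<^sup>2) = \<i> * of_real (\<sigma> * x)"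
          by (simp add: x_def algebra_simps)
        finally have "(\<lambda>n. csqrt (P n + K n * of_real ((norm y)\<^sup>2))) \<longlonglongrightarrow> csqrt (\<i> * of_real (\<sigma> * x))"
          by (intro isCont_tendsto_compose[OF continuous_at_csqrt]) (use x \<sigma>0 in \<open>auto simp: complex_nonpos_Reals_iff\<close>)
        then have "(\<lambda>n. (1 / csqrt (P n + K n * of_real ((norm y)\<^sup>2))) ^ Suc d) \<longlonglongrightarrow> (1 / (of_real (sqrt x) * e)) ^ Suc d"
          unfolding c by (intro tendsto_intros) (use x e0 in auto)
        also have "(1 / (of_real (sqrt x) * e)) ^ Suc d = of_real (klein_density \<kappa> y) * (1 / e) ^ Suc d"
          unfolding kd[OF True elim] x_def[symmetric] by (simp add: power_mult_distrib power_divide)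
        finally show ?thesis using True by simp
      qed simp
    qed
    show "AE y in lborel. norm (indicator Q y *\<^sub>R (1 / csqrt (P n + K n * of_real ((norm y)\<^sup>2))) ^ Suc d) \<le> indicator Q y *\<^sub>R klein_density \<kappa> y" for n
      using ae
    proof eventually_elim
      case (elim y)
      show ?case
      proof (cases "y \<in> Q")
        case True
        define x where "x = 1 + \<kappa> * (norm y)\<^sup>2"
        define z where "z = P n + K n * of_real ((norm y)\<^sup>2)"
        have x: "x > 0" using pos[OF True elim] by (simp add: x_def)
        have "Im z = \<sigma> * x" by (simp add: z_def x_def im algebra_simps)
        then have "\<bar>Im z\<bar> = x" using \<sigma> x by (simp add: abs_mult)
        then have xz: "x \<le> norm z" using abs_Im_le_cmod[of z] by simp
        have "norm ((1 / csqrt z) ^ Suc d) = (1 / sqrt (norm z)) ^ Suc d"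
          by (simp add: norm_power norm_divide)
        also have "\<dots> \<le> (1 / sqrt x) ^ Suc d"
          using x xz by (intro power_mono divide_left_mono mult_pos_pos) auto
        also have "\<dots> = klein_density \<kappa> y" unfolding kd[OF True elim] x_def ..
        finally show ?thesis using True by (simp add: z_def)
      qed simp
    qed
  qed (rule dint)
  also have "(\<integral>y. of_real (indicator Q y *\<^sub>R klein_density \<kappa> y) * (1 / e) ^ Suc d \<partial>lborel) = of_real (klein_vol \<kappa> Q) * (1 / e) ^ Suc d"
    by (simp only: integral_mult_left_zero integral_complex_of_real klein_vol_def set_lebesgue_integral_def)
  finally show ?thesis by (simp add: e_def)
qed

text \<open>Both sides of \<open>integral_Q_eq_Phi\<close> are followed along the regularisation:
  the volume side converges by domination, the \<open>Phi\<close> side by the uniform tail bound,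
  and the limits agree. The hypotheses \<open>w\<close>, \<open>nz\<close> and \<open>z0\<close>
  serve the tail bound; \<open>c\<close> serves Fubini.\<close>

lemma volume_formula_limit:
  fixes k q a :: "nat \<Rightarrow> complex"
  assumes Q: "Q \<subseteq> klein_cball \<kappa>" and \<sigma>: "\<bar>\<sigma>\<bar> = 1"
    and k: "\<And>n. Re (k n) > 0" "\<And>n. Re ((k n)\<^sup>2) > 0" and q: "\<And>n. Re (q n) > 0" "\<And>n. Re ((q n)\<^sup>2) > 0"
    and P: "\<And>n. Re ((k n)\<^sup>2 / of_real s - (a n)\<^sup>2) > 0"
    and c: "\<And>n. s * (Re (a n * q n))\<^sup>2 < Re ((k n)\<^sup>2) * Re ((q n)\<^sup>2)"
    and im: "\<And>n. Im ((k n)\<^sup>2 / of_real s - (a n)\<^sup>2) = \<sigma>" "\<And>n. Im ((k n)\<^sup>2) = \<sigma> * \<kappa>"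
    and lim: "k \<longlonglongrightarrow> k0" "q \<longlonglongrightarrow> q0" "a \<longlonglongrightarrow> a0" and k0: "k0 \<noteq> 0"
    and P0: "k0\<^sup>2 / of_real s - a0\<^sup>2 = \<i> * of_real \<sigma>" and K0: "k0\<^sup>2 = \<i> * of_real (\<sigma> * \<kappa>)"
    and w: "\<And>n. Re ((q n)\<^sup>2 - of_real s * (a n * q n / k n)\<^sup>2) \<ge> 0"
    and \<zeta>0: "\<zeta>0 = a0 * q0 / k0" and w0: "q0\<^sup>2 - of_real s * \<zeta>0\<^sup>2 = - 2 * \<i>"
    and z0: "(\<forall>n. a n = 0) \<or> Re \<zeta>0 > 0"
    and nz: "\<And>j. j \<le> d \<Longrightarrow> - 2 * \<i> + of_real ((\<tau> j)\<^sup>2) * \<zeta>0\<^sup>2 \<noteq> 0"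
  obtains L where "((\<lambda>B. integral {0..B} (ray_fun d \<tau> \<zeta>0 (- 2 * \<i>))) \<longlongrightarrow> L) at_top"
    and "of_real (klein_vol \<kappa> Q) * (of_real (sqrt 2) / (1 + \<i> * of_real \<sigma>)) ^ Suc d =
      of_real (sphere_area (Suc d) * sqrt s / sqrt (2 * pi)) * (q0 / k0 ^ Suc d) * L"
proof -
  define \<zeta> where "\<zeta> = (\<lambda>n. a n * q n / k n)"
  define w2 where "w2 = (\<lambda>n. (q n)\<^sup>2 - of_real s * (\<zeta> n)\<^sup>2)"
  have lz: "\<zeta> \<longlonglongrightarrow> \<zeta>0" unfolding \<zeta>_def \<zeta>0 by (intro tendsto_intros lim k0)
  have lw: "w2 \<longlonglongrightarrow> - 2 * \<i>" unfolding w2_def w0[symmetric] by (intro tendsto_intros lim lz)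
  have "\<exists>N C. \<forall>n\<ge>N. \<forall>B B'. 1 \<le> B \<longrightarrow> B \<le> B' \<longrightarrow> norm (integral {B..B'} (ray_fun d \<tau> (\<zeta> n) (w2 n))) \<le> C / B"
  proof (rule ray_fun_tail[OF lz lw])
    show "Re (w2 n) \<ge> 0" for n using w by (simp add: w2_def \<zeta>_def)
    show "Re (w2 n + of_real s * (\<zeta> n)\<^sup>2) \<ge> 0" for n using q(2)[of n] by (simp add: w2_def)
    show "(\<forall>n. \<zeta> n = 0) \<or> 0 < Re \<zeta>0" using z0 by (auto simp: \<zeta>_def)
  qed (use nz in \<open>auto simp: complex_eq_iff\<close>)
  then obtain N C where NC: "\<And>n B B'. n \<ge> N \<Longrightarrow> 1 \<le> B \<Longrightarrow> B \<le> B' \<Longrightarrow> norm (integral {B..B'} (ray_fun d \<tau> (\<zeta> n) (w2 n))) \<le> C / B"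
    by blast
  define F where "F = (\<lambda>n u. (\<Prod>j\<le>d. Phi (of_real (\<tau> j) * \<zeta> n * of_real u)) * exp (- (w2 n * (of_real u)\<^sup>2 / 2)))"
  have Fint: "integrable lborel (F n)" for n
    using integral_Q_eq_Phi(1)[OF k(1) k(2) q(1) q(2) P c, of n] unfolding F_def w2_def \<zeta>_def by simp
  have even: "F n u + F n (- u) = ray_fun d \<tau> (\<zeta> n) (w2 n) u" for n u
    by (simp add: F_def ray_fun_def distrib_right)
  define J where "J = (\<lambda>n. \<integral>u. indicator {0..} u *\<^sub>R ray_fun d \<tau> (\<zeta> n) (w2 n) u \<partial>lborel)"
  have FJ: "(\<integral>u. F n u \<partial>lborel) = J n" for n
    using integral_lborel_even_part(2)[OF Fint] unfolding even J_def .
  have Jint: "integrable lborel (\<lambda>u. indicator {0..} u *\<^sub>R ray_fun d \<tau> (\<zeta> n) (w2 n) u)" for n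
    using integral_lborel_even_part(1)[OF Fint[of n]] unfolding even .
  \<comment> \<open>The tail bound holds from N on only, hence the shift.\<close>
  have lz': "(\<lambda>n. \<zeta> (n + N)) \<longlonglongrightarrow> \<zeta>0" and lw': "(\<lambda>n. w2 (n + N)) \<longlonglongrightarrow> - 2 * \<i>"
    by (intro LIMSEQ_ignore_initial_segment lz lw)+
  obtain L where L: "((\<lambda>B. integral {0..B} (ray_fun d \<tau> \<zeta>0 (- 2 * \<i>))) \<longlongrightarrow> L) at_top" "(\<lambda>n. J (n + N)) \<longlonglongrightarrow> L"
    unfolding J_def
  proof (rule improper_limit_exchange[of "\<lambda>n. ray_fun d \<tau> (\<zeta> (n + N)) (w2 (n + N))" "ray_fun d \<tau> \<zeta>0 (- 2 * \<i>)" C])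
    show "\<exists>M. \<forall>n. \<forall>u\<in>{0..B}. norm (ray_fun d \<tau> (\<zeta> (n + N)) (w2 (n + N)) u) \<le> M" for B
      by (rule ray_fun_bounded[OF lz' lw'])
    show "(\<lambda>n. ray_fun d \<tau> (\<zeta> (n + N)) (w2 (n + N)) u) \<longlonglongrightarrow> ray_fun d \<tau> \<zeta>0 (- 2 * \<i>) u" for u
      by (rule ray_fun_tendsto[OF lz' lw'])
  qed (auto intro!: continuous_ray_fun Jint NC)
  have JL: "J \<longlonglongrightarrow> L" using L(2) by (rule LIMSEQ_offset)
  define V where "V = (\<lambda>n. \<integral>y. indicator Q y *\<^sub>R (1 / csqrt (((k n)\<^sup>2 / of_real s - (a n)\<^sup>2) + (k n)\<^sup>2 * of_real ((norm y)\<^sup>2))) ^ Suc d \<partial>lborel)"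
  have Vn: "V n = of_real (sphere_area (Suc d) * sqrt s / sqrt (2 * pi)) * (q n / k n ^ Suc d) * J n" for n
    using integral_Q_eq_Phi(2)[OF k(1) k(2) q(1) q(2) P c, of n] unfolding V_def FJ[symmetric] F_def w2_def \<zeta>_def .
  have "V \<longlonglongrightarrow> of_real (sphere_area (Suc d) * sqrt s / sqrt (2 * pi)) * (q0 / k0 ^ Suc d) * L"
    unfolding Vn using k0 by (intro tendsto_intros lim JL) auto
  moreover have "V \<longlonglongrightarrow> of_real (klein_vol \<kappa> Q) * (of_real (sqrt 2) / (1 + \<i> * of_real \<sigma>)) ^ Suc d"
    unfolding V_def
  proof (rule regularised_volume_tendsto[OF Q \<sigma> P k(2) im])
    have "(\<lambda>n. (k n)\<^sup>2 / of_real s - (a n)\<^sup>2) \<longlonglongrightarrow> k0\<^sup>2 / of_real s - a0\<^sup>2"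
      by (intro tendsto_intros lim) (use s_pos in auto)
    then show "(\<lambda>n. (k n)\<^sup>2 / of_real s - (a n)\<^sup>2) \<longlonglongrightarrow> \<i> * of_real \<sigma>" unfolding P0 .
    have "(\<lambda>n. (k n)\<^sup>2) \<longlonglongrightarrow> k0\<^sup>2" by (intro tendsto_intros lim)
    then show "(\<lambda>n. (k n)\<^sup>2) \<longlonglongrightarrow> \<i> * of_real (\<sigma> * \<kappa>)" unfolding K0 .
  qed
  ultimately show ?thesis using that[OF L(1)] LIMSEQ_unique by blast
qed

end

section \<open>The volume formula\<close>

lemma scaled_square: "(complex_of_real r * z)\<^sup>2 = of_real (r\<^sup>2) * z\<^sup>2"
  by (simp add: power_mult_distrib)

context orthocentric_simplex
begin

text \<open>The terms with a single factor \<open>\<psi>\<close> decay only like \<open>1 / u\<close>, so their phase must not vanish. For \<open>d = 1\<close> it would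
  vanish at an ideal vertex.\<close>

lemma phase_nonvanishing:
  assumes Q: "Q \<subseteq> klein_cball \<kappa>" and j: "j \<le> d" and \<kappa>: "\<kappa> \<noteq> 0"
  shows "(\<tau> j)\<^sup>2 * (s - \<kappa>) < s\<^sup>2"
proof -
  \<comment> \<open>As d >= 2 there is a third index l, whose square makes the inequality
    strict.\<close>
  have others: "(\<tau> j)\<^sup>2 + (\<tau> m)\<^sup>2 < s" if "m \<le> d" "m \<noteq> j" for m
  proof -
    have "\<exists>l. l \<le> d \<and> l \<noteq> j \<and> l \<noteq> m"
    proof (rule ccontr)
      assume "\<not> ?thesis"
      then have "{..d} \<subseteq> {j, m}" by auto
      then have "card {..d} \<le> card {j, m}" by (intro card_mono) auto
      also have "\<dots> \<le> 2" by (simp add: card_insert_if)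
      finally show False using d_ge_2 by simp
    qed
    then obtain l where l: "l \<le> d" "l \<noteq> j" "l \<noteq> m" by blast
    have "(\<Sum>i\<in>{j, m, l}. (\<tau> i)\<^sup>2) \<le> s" unfolding s_def using l j that by (intro sum_mono2) auto
    also have "(\<Sum>i\<in>{j, m, l}. (\<tau> i)\<^sup>2) = (\<tau> j)\<^sup>2 + (\<tau> m)\<^sup>2 + (\<tau> l)\<^sup>2" using l that by simp
    finally show ?thesis using zero_less_power[OF \<tau>_pos[OF l(1)], of 2] by linarith
  qed
  have "\<exists>m. m \<le> d \<and> m \<noteq> j" using d_ge_2 by (intro exI[of _ "if j = 0 then 1 else 0"]) auto
  then obtain m where m: "m \<le> d" "m \<noteq> j" by blast
  show ?thesis
  proof (cases "\<kappa> > 0")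
    case True
    have "(\<tau> j)\<^sup>2 < s" using others[OF m] zero_le_power2[of "\<tau> m"] by linarith
    have "(\<tau> j)\<^sup>2 * (s - \<kappa>) < (\<tau> j)\<^sup>2 * s" using True \<tau>_pos[OF j] by (intro mult_strict_left_mono) auto
    also have "\<dots> \<le> s * s" using \<open>(\<tau> j)\<^sup>2 < s\<close> s_pos by (intro mult_right_mono) auto
    finally show ?thesis by (simp add: power2_eq_square)
  next
    case False
    then have \<kappa>: "\<kappa> < 0" using \<kappa> by simp
    have "- \<kappa> / (\<tau> m)\<^sup>2 \<le> 1 - \<kappa> / s" by (rule vertex_bound[OF \<kappa> Q m(1)])
    then have b: "- \<kappa> * s \<le> (\<tau> m)\<^sup>2 * (s - \<kappa>)"
      using \<tau>_pos[OF m(1)] s_pos by (simp add: field_simps)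
    have "(\<tau> j)\<^sup>2 * (s - \<kappa>) < (s - (\<tau> m)\<^sup>2) * (s - \<kappa>)"
      using others[OF m] \<kappa> s_pos by (intro mult_strict_right_mono) auto
    also have "\<dots> = s * s - \<kappa> * s - (\<tau> m)\<^sup>2 * (s - \<kappa>)" by (simp add: algebra_simps)
    also have "\<dots> \<le> s\<^sup>2" using b by (simp add: power2_eq_square)
    finally show ?thesis .
  qed
qed

text \<open>With \<open>c\<^sup>2 = \<epsilon> - \<i>\<close>, the parameters \<open>k, q, a\<close> of the regularisation are real multiples of \<open>c\<close> or its conjugate, up to
  a factor \<open>\<i>\<close> in \<open>a\<close>. For \<open>\<kappa> \<le> s\<close> they are chosen such that \<open>a * q\<close> is purely imaginary.\<close>

lemma ray_volume_plus:
  assumes Q: "Q \<subseteq> klein_cball \<kappa>" and \<kappa>: "\<kappa> \<noteq> 0"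
  obtains L where "((\<lambda>B. integral {0..B} (ray_fun d \<tau> (sqrt_plus (\<kappa> - s) * (1 - \<i>) / of_real s) (- 2 * \<i>))) \<longlongrightarrow> L) at_top"
    and "of_real (klein_vol \<kappa> Q) = of_real (sphere_area (Suc d)) / sqrt_plus \<kappa> ^ d * (1 / of_real (sqrt (2 * pi))) * ((1 - \<i>) * L)"
proof -
  define \<epsilon> where "\<epsilon> = (\<lambda>n. inverse (real (Suc n)))"
  have \<epsilon>: "\<epsilon> n > 0" for n by (simp add: \<epsilon>_def)
  define c where "c = (\<lambda>n. csqrt (Complex (\<epsilon> n) (- 1)))"
  define c0 where "c0 = (1 - \<i>) / complex_of_real (sqrt 2)"
  have c2: "(c n)\<^sup>2 = Complex (\<epsilon> n) (- 1)" "(cnj (c n))\<^sup>2 = Complex (\<epsilon> n) 1" for n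
    by (simp add: c_def) (simp add: c_def complex_eq_iff flip: complex_cnj_power)
  have Rec: "Re (c n) > 0" for n unfolding c_def using \<epsilon> by (intro Re_csqrt_pos) simp
  have "csqrt (\<i> * of_real ((- 1) * 1)) = of_real (sqrt 1 / sqrt 2) * (1 + \<i> * of_real (- 1))"
    by (rule csqrt_imaginary) auto
  then have c0: "csqrt (- \<i>) = c0" by (simp add: c0_def)
  have c02: "c0\<^sup>2 = - \<i>" "(cnj c0)\<^sup>2 = \<i>" unfolding c0[symmetric] by (simp, simp flip: complex_cnj_power)
  have c0n: "c0 \<noteq> 0" "cnj c0 \<noteq> 0" by (auto simp: c0_def complex_eq_iff)
  have r2: "complex_of_real (sqrt 2) * complex_of_real (sqrt 2) = 2"
    by (simp flip: of_real_mult)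
  have cs: "of_real (sqrt 2) * c0 = 1 - \<i>" "of_real (sqrt 2) * cnj c0 = 1 + \<i>"
    by (auto simp: c0_def)
  have \<sigma>c: "of_real (sqrt 2) / (1 + \<i> * of_real (- 1)) = 1 / c0" "of_real (sqrt 2) / (1 + \<i> * of_real 1) = 1 / cnj c0"
    unfolding c0_def by simp_all
  have lc: "c \<longlonglongrightarrow> c0" unfolding c_def c0[symmetric]
  proof (rule isCont_tendsto_compose[OF continuous_at_csqrt])
    show "- \<i> \<notin> \<real>\<^sub>\<le>\<^sub>0" by (simp add: complex_nonpos_Reals_iff)
    have "(\<lambda>n. Complex (\<epsilon> n) (- 1)) \<longlonglongrightarrow> Complex 0 (- 1)"
      unfolding \<epsilon>_def by (intro tendsto_Complex LIMSEQ_inverse_real_of_nat tendsto_const)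
    also have "Complex 0 (- 1) = - \<i>" by (simp add: complex_eq_iff)
    finally show "(\<lambda>n. Complex (\<epsilon> n) (- 1)) \<longlonglongrightarrow> - \<i>" .
  qed
  have lc': "(\<lambda>n. cnj (c n)) \<longlonglongrightarrow> cnj c0" by (intro tendsto_intros lc)
  define \<delta> where "\<delta> = \<bar>\<kappa> - s\<bar>"
  \<comment> \<open>The limiting moduli of k, q, a and \<zeta>: k^2 = K has modulus |\<kappa>|, a^2
    = K / s - P has modulus |\<kappa> - s| / s, and q^2 = - 2 \<i> + s \<zeta>^2 = - 2 \<i> \<kappa>
    / s.\<close>
  define x y A Z where "x = sqrt \<bar>\<kappa>\<bar>" and "y = sqrt (2 * \<bar>\<kappa>\<bar> / s)" and "A = sqrt (\<delta> / s)" and "Z = sqrt \<delta> * sqrt 2 / s"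
  have \<delta>0: "\<delta> \<ge> 0" by (simp add: \<delta>_def)
  have pos: "x > 0" "y > 0" "A \<ge> 0" "Z \<ge> 0" using \<kappa> s_pos \<delta>0 by (auto simp: x_def y_def A_def Z_def)
  have sq: "x\<^sup>2 = \<bar>\<kappa>\<bar>" "y\<^sup>2 = 2 * \<bar>\<kappa>\<bar> / s" "A\<^sup>2 = \<delta> / s" "Z\<^sup>2 = 2 * \<delta> / s\<^sup>2"
    using s_pos \<delta>0 by (auto simp: x_def y_def A_def Z_def power_mult_distrib power_divide)
  have AyZx: "A * y = Z * x"
  proof (rule power2_eq_imp_eq)
    show "(A * y)\<^sup>2 = (Z * x)\<^sup>2" unfolding power_mult_distrib sq by (simp add: power2_eq_square)
  qed (use pos in auto)
  have sy: "sqrt s * y = sqrt 2 * x"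
    using s_pos by (simp add: y_def x_def real_sqrt_divide real_sqrt_mult)
  have Zc0: "of_real Z * c0 = of_real (sqrt \<delta>) * (1 - \<i>) / of_real s"
    unfolding Z_def c0_def by simp
  define \<zeta>0 where "\<zeta>0 = sqrt_plus (\<kappa> - s) * (1 - \<i>) / of_real s"
  have \<zeta>0_cases: "\<kappa> > s \<Longrightarrow> \<zeta>0 = of_real Z * c0" "\<kappa> \<le> s \<Longrightarrow> \<zeta>0 = \<i> * of_real Z * c0"
    unfolding mult.assoc Zc0 by (auto simp: \<zeta>0_def sqrt_plus_def \<delta>_def)
  have \<zeta>02: "\<zeta>0\<^sup>2 = - 2 * \<i> * of_real ((\<kappa> - s) / s\<^sup>2)"
  proof (cases "\<kappa> > s")
    case True
    then show ?thesis unfolding \<zeta>0_cases(1)[OF True] scaled_square c02 sq by (simp add: \<delta>_def)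
  next
    case False
    then show ?thesis unfolding \<zeta>0_cases(2)[OF leI[OF False]] mult.assoc power_mult_distrib[of \<i>] scaled_square c02 sq
      by (simp add: \<delta>_def field_simps)
  qed
  have nz: "- 2 * \<i> + of_real ((\<tau> j)\<^sup>2) * \<zeta>0\<^sup>2 \<noteq> 0" if "j \<le> d" for j
  proof -
    define t where "t = 1 + (\<tau> j)\<^sup>2 * ((\<kappa> - s) / s\<^sup>2)"
    have "t = (s\<^sup>2 - (\<tau> j)\<^sup>2 * (s - \<kappa>)) / s\<^sup>2"
      using s_pos by (simp add: t_def field_simps)
    also have "\<dots> > 0"
      using phase_nonvanishing[OF Q that \<kappa>] s_pos by (intro divide_pos_pos) auto
    finally have "t > 0" .
    moreover have "- 2 * \<i> + of_real ((\<tau> j)\<^sup>2) * \<zeta>0\<^sup>2 = - 2 * \<i> * of_real t"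
      unfolding \<zeta>02 t_def by (simp add: algebra_simps)
    ultimately show ?thesis by simp
  qed
  have Re\<zeta>0: "\<delta> = 0 \<or> Re \<zeta>0 > 0"
  proof -
    have "Re \<zeta>0 = sqrt \<delta> / s"
      unfolding \<zeta>0_def sqrt_plus_def by (auto simp: \<delta>_def)
    moreover have "\<delta> > 0 \<Longrightarrow> sqrt \<delta> / s > 0" using s_pos by (intro divide_pos_pos) auto
    ultimately show ?thesis using \<delta>0 by linarith
  qed
  \<comment> \<open>The case \<kappa> > 0. The powers of e cancel because k tends to x e, with e the
    same root of \<i> \<sigma> as in the volume limit. By \<open>sy\<close>, sqrt s times the limit
    y c0 of q equals (1 - \<i>) x, which removes one of the d + 1 factors x and supplies the
    direction of the ray.\<close>
  have fin: "of_real (klein_vol \<kappa> Q) = of_real (sphere_area (Suc d)) / sqrt_plus \<kappa> ^ d * (1 / of_real (sqrt (2 * pi))) * ((1 - \<i>) * L)"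
    if e: "e \<noteq> 0" and V: "of_real (klein_vol \<kappa> Q) * (1 / e) ^ Suc d =
      of_real (sphere_area (Suc d) * sqrt s / sqrt (2 * pi)) * ((of_real y * c0) / (of_real x * e) ^ Suc d) * L"
      and xk: "sqrt_plus \<kappa> = of_real x" for e L
  proof -
    have "of_real (klein_vol \<kappa> Q) = (of_real (klein_vol \<kappa> Q) * (1 / e) ^ Suc d) * e ^ Suc d"
      using e by (simp add: power_divide)
    also have "\<dots> = of_real (sphere_area (Suc d) / sqrt (2 * pi)) * (of_real (sqrt s * y) * c0 / of_real x ^ Suc d) * L"
      unfolding V using e pos by (simp add: power_mult_distrib)
    also have "of_real (sqrt s * y) * c0 / of_real x ^ Suc d = (of_real (sqrt 2) * c0) / of_real x ^ d"
      unfolding sy using pos by simp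
    finally show ?thesis unfolding cs xk by (simp add: mult_ac)
  qed
  consider (gt) "\<kappa> > s" | (le) "0 < \<kappa>" "\<kappa> \<le> s" | (neg) "\<kappa> < 0" using \<kappa> by linarith
  then show ?thesis
  proof cases
    \<comment> \<open>Here \<sigma> = - 1 with P = c^2 and K = \<kappa> c^2. The real part of a q is
      A y \<epsilon>, and the Fubini condition reduces to \<kappa> - s < \<kappa>.\<close>
    case gt
    then have \<kappa>': "\<bar>\<kappa>\<bar> = \<kappa>" "\<delta> = \<kappa> - s" "\<kappa> > 0" using s_pos by (auto simp: \<delta>_def)
    have P: "(of_real x * c n)\<^sup>2 / of_real s - (of_real A * c n)\<^sup>2 = (c n)\<^sup>2" for n
    proof -
      have "(of_real x * c n)\<^sup>2 / of_real s - (of_real A * c n)\<^sup>2 = of_real (\<kappa> / s - (\<kappa> - s) / s) * (c n)\<^sup>2"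
        unfolding scaled_square sq \<kappa>' by (simp add: algebra_simps diff_divide_distrib)
      also have "\<kappa> / s - (\<kappa> - s) / s = 1" using s_pos by (simp add: field_simps)
      finally show ?thesis by simp
    qed
    have z: "of_real A * c' * (of_real y * c') / (of_real x * c') = of_real Z * c'" if "c' \<noteq> 0" for c' :: complex
    proof -
      have "of_real A * c' * (of_real y * c') / (of_real x * c') = of_real (A * y) * c' / of_real x"
        using that by simp
      then show ?thesis using pos by (simp add: AyZx del: of_real_mult) (simp add: mult.commute)
    qed
    obtain L where L: "((\<lambda>B. integral {0..B} (ray_fun d \<tau> \<zeta>0 (- 2 * \<i>))) \<longlongrightarrow> L) at_top"
      "of_real (klein_vol \<kappa> Q) * (of_real (sqrt 2) / (1 + \<i> * of_real (- 1))) ^ Suc d =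
        of_real (sphere_area (Suc d) * sqrt s / sqrt (2 * pi)) * ((of_real y * c0) / (of_real x * c0) ^ Suc d) * L"
    proof (rule volume_formula_limit[OF Q, of "-1" "\<lambda>n. of_real x * c n" "\<lambda>n. of_real y * c n" "\<lambda>n. of_real A * c n"
          "of_real x * c0" "of_real y * c0" "of_real A * c0" \<zeta>0])
      show "(\<lambda>n. of_real x * c n) \<longlonglongrightarrow> of_real x * c0" "(\<lambda>n. of_real y * c n) \<longlonglongrightarrow> of_real y * c0"
        "(\<lambda>n. of_real A * c n) \<longlonglongrightarrow> of_real A * c0" by (intro tendsto_intros lc)+
      show "s * (Re (of_real A * c n * (of_real y * c n)))\<^sup>2 < Re ((of_real x * c n)\<^sup>2) * Re ((of_real y * c n)\<^sup>2)" for n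
      proof -
        have "of_real A * c n * (of_real y * c n) = of_real (A * y) * (c n)\<^sup>2" by (simp add: power2_eq_square)
        then have "Re (of_real A * c n * (of_real y * c n)) = A * y * \<epsilon> n"
          by (simp only: c2) simp
        then have "s * (Re (of_real A * c n * (of_real y * c n)))\<^sup>2 = s * (A\<^sup>2 * y\<^sup>2 * (\<epsilon> n)\<^sup>2)"
          by (simp only: power_mult_distrib)
        also have "\<dots> = (\<kappa> - s) * (2 * \<kappa> / s * (\<epsilon> n)\<^sup>2)" unfolding sq \<kappa>' using s_pos by simp
        also have "\<dots> < \<kappa> * (2 * \<kappa> / s * (\<epsilon> n)\<^sup>2)" using s_pos \<kappa>' \<epsilon>[of n] by (intro mult_strict_right_mono) auto
        also have "\<dots> = Re ((of_real x * c n)\<^sup>2) * Re ((of_real y * c n)\<^sup>2)"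
          unfolding scaled_square sq \<kappa>' c2 by (simp add: power2_eq_square)
        finally show ?thesis .
      qed
      show "0 \<le> Re ((of_real y * c n)\<^sup>2 - of_real s * (of_real A * c n * (of_real y * c n) / (of_real x * c n))\<^sup>2)" for n
      proof -
        have "c n \<noteq> 0" using Rec[of n] by auto
        have "(of_real y * c n)\<^sup>2 - of_real s * (of_real A * c n * (of_real y * c n) / (of_real x * c n))\<^sup>2 =
          of_real (2 * \<kappa> / s - s * (2 * (\<kappa> - s) / s\<^sup>2)) * (c n)\<^sup>2"
          unfolding z[OF \<open>c n \<noteq> 0\<close>] scaled_square sq \<kappa>' by (simp add: algebra_simps)
        also have "2 * \<kappa> / s - s * (2 * (\<kappa> - s) / s\<^sup>2) = 2" using s_pos by (simp add: field_simps power2_eq_square)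
        finally show ?thesis using \<epsilon>[of n] by (simp add: c2)
      qed
      show "\<zeta>0 = of_real A * c0 * (of_real y * c0) / (of_real x * c0)"
        unfolding z[OF c0n(1)] by (rule \<zeta>0_cases(1)[OF gt])
      show "(of_real y * c0)\<^sup>2 - of_real s * \<zeta>0\<^sup>2 = - 2 * \<i>"
        unfolding \<zeta>02 scaled_square sq \<kappa>' c02 using s_pos by (simp add: field_simps power2_eq_square)
      show "(\<forall>n. of_real A * c n = 0) \<or> Re \<zeta>0 > 0" using Re\<zeta>0 \<kappa>' gt by auto
      show "Im ((of_real x * c n)\<^sup>2 / of_real s - (of_real A * c n)\<^sup>2) = - 1" for n unfolding P c2 by simp
      show "Re ((of_real x * c n)\<^sup>2 / of_real s - (of_real A * c n)\<^sup>2) > 0" for n unfolding P c2 using \<epsilon> by simp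
      have "(of_real x * c0)\<^sup>2 / of_real s - (of_real A * c0)\<^sup>2 = of_real (\<kappa> / s - (\<kappa> - s) / s) * c0\<^sup>2"
        unfolding scaled_square sq \<kappa>' by (simp add: algebra_simps diff_divide_distrib)
      also have "\<kappa> / s - (\<kappa> - s) / s = 1" using s_pos by (simp add: field_simps)
      finally show "(of_real x * c0)\<^sup>2 / of_real s - (of_real A * c0)\<^sup>2 = \<i> * of_real (- 1)" by (simp add: c02)
    qed (use pos Rec \<epsilon> \<kappa>' c0n nz s_pos in \<open>auto simp: scaled_square sq c2 c02\<close>)
    have xk: "sqrt_plus \<kappa> = of_real x" using \<kappa>' by (simp add: sqrt_plus_def x_def)
    show ?thesis
      by (rule that[OF L(1)[unfolded \<zeta>0_def] fin[OF _ L(2)[unfolded \<sigma>c] xk]]) (use c0n in auto)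
  next
    \<comment> \<open>Here \<sigma> = 1, so k and a use the conjugate of c, while q must stay a
      multiple of c. This gives a q = \<i> A y |c|^2, and in \<zeta> = a q / k the conjugates
      cancel, leaving \<i> Z c.\<close>
    case le
    then have \<kappa>': "\<bar>\<kappa>\<bar> = \<kappa>" "\<delta> = s - \<kappa>" by (auto simp: \<delta>_def)
    have P: "(of_real x * c')\<^sup>2 / of_real s - (\<i> * of_real A * c')\<^sup>2 = c'\<^sup>2" for c'
    proof -
      show ?thesis unfolding mult.assoc power_mult_distrib[of \<i>] scaled_square sq \<kappa>'
        using s_pos by (simp add: field_simps)
    qed
    have z: "\<i> * of_real A * cnj c' * (of_real y * c') / (of_real x * cnj c') = \<i> * of_real Z * c'" if "c' \<noteq> 0" for c' :: complex
    proof -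
      have "\<i> * of_real A * cnj c' * (of_real y * c') / (of_real x * cnj c') = \<i> * of_real (A * y) * c' / of_real x"
        using that by simp
      then show ?thesis using pos by (simp add: AyZx del: of_real_mult) (simp add: mult.commute)
    qed
    obtain L where L: "((\<lambda>B. integral {0..B} (ray_fun d \<tau> \<zeta>0 (- 2 * \<i>))) \<longlongrightarrow> L) at_top"
      "of_real (klein_vol \<kappa> Q) * (of_real (sqrt 2) / (1 + \<i> * of_real 1)) ^ Suc d =
        of_real (sphere_area (Suc d) * sqrt s / sqrt (2 * pi)) * ((of_real y * c0) / (of_real x * cnj c0) ^ Suc d) * L"
    proof (rule volume_formula_limit[OF Q, of "1" "\<lambda>n. of_real x * cnj (c n)" "\<lambda>n. of_real y * c n" "\<lambda>n. \<i> * of_real A * cnj (c n)"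
          "of_real x * cnj c0" "of_real y * c0" "\<i> * of_real A * cnj c0" \<zeta>0])
      show "(\<lambda>n. of_real x * cnj (c n)) \<longlonglongrightarrow> of_real x * cnj c0" "(\<lambda>n. of_real y * c n) \<longlonglongrightarrow> of_real y * c0"
        "(\<lambda>n. \<i> * of_real A * cnj (c n)) \<longlonglongrightarrow> \<i> * of_real A * cnj c0" by (intro tendsto_intros lc lc')+
      show "s * (Re (\<i> * of_real A * cnj (c n) * (of_real y * c n)))\<^sup>2 < Re ((of_real x * cnj (c n))\<^sup>2) * Re ((of_real y * c n)\<^sup>2)" for n
      proof -
        have "Re (\<i> * of_real A * cnj (c n) * (of_real y * c n)) = 0" by (simp add: algebra_simps)
        then show ?thesis using \<epsilon>[of n] le s_pos unfolding scaled_square sq \<kappa>' c2 by simp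
      qed
      show "0 \<le> Re ((of_real y * c n)\<^sup>2 - of_real s * (\<i> * of_real A * cnj (c n) * (of_real y * c n) / (of_real x * cnj (c n)))\<^sup>2)" for n
      proof -
        have "c n \<noteq> 0" using Rec[of n] by auto
        have "(of_real y * c n)\<^sup>2 - of_real s * (\<i> * of_real A * cnj (c n) * (of_real y * c n) / (of_real x * cnj (c n)))\<^sup>2 =
          of_real (2 * \<kappa> / s + s * (2 * (s - \<kappa>) / s\<^sup>2)) * (c n)\<^sup>2"
          unfolding z[OF \<open>c n \<noteq> 0\<close>] unfolding mult.assoc power_mult_distrib[of \<i>] scaled_square sq \<kappa>'
          using s_pos by (simp add: field_simps)
        also have "2 * \<kappa> / s + s * (2 * (s - \<kappa>) / s\<^sup>2) = 2" using s_pos by (simp add: field_simps power2_eq_square)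
        finally show ?thesis using \<epsilon>[of n] by (simp add: c2)
      qed
      show "\<zeta>0 = \<i> * of_real A * cnj c0 * (of_real y * c0) / (of_real x * cnj c0)"
        unfolding z[OF c0n(1)] by (rule \<zeta>0_cases(2)[OF le(2)])
      show "(of_real y * c0)\<^sup>2 - of_real s * \<zeta>0\<^sup>2 = - 2 * \<i>"
        unfolding \<zeta>02 scaled_square sq \<kappa>' c02 using s_pos by (simp add: field_simps power2_eq_square)
      show "(\<forall>n. \<i> * of_real A * cnj (c n) = 0) \<or> Re \<zeta>0 > 0" using Re\<zeta>0 by (auto simp: A_def)
      show "Im ((of_real x * cnj (c n))\<^sup>2 / of_real s - (\<i> * of_real A * cnj (c n))\<^sup>2) = 1" for n unfolding P c2 by simp
      show "Re ((of_real x * cnj (c n))\<^sup>2 / of_real s - (\<i> * of_real A * cnj (c n))\<^sup>2) > 0" for n unfolding P c2 using \<epsilon> by simp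
      show "(of_real x * cnj c0)\<^sup>2 / of_real s - (\<i> * of_real A * cnj c0)\<^sup>2 = \<i> * of_real 1" unfolding P c02 by simp
    qed (use pos Rec \<epsilon> \<kappa>' c0n nz s_pos le in \<open>auto simp: scaled_square sq c2 c02\<close>)
    have xk: "sqrt_plus \<kappa> = of_real x" using le by (simp add: sqrt_plus_def x_def)
    show ?thesis
      by (rule that[OF L(1)[unfolded \<zeta>0_def] fin[OF _ L(2)[unfolded \<sigma>c] xk]]) (use c0n in auto)
  next
    \<comment> \<open>Here \<sigma> = - 1, but K = - \<kappa> times the square of the conjugate of
      c, because - \<kappa> > 0. P mixes both squares: its real part is \<epsilon> (s - 2 \<kappa>)
      / s and its imaginary part - 1.\<close>
    case neg
    then have \<kappa>': "\<bar>\<kappa>\<bar> = - \<kappa>" "\<delta> = s - \<kappa>" "\<kappa> \<le> s" using s_pos by (auto simp: \<delta>_def)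
    have P: "(of_real x * cnj c')\<^sup>2 / of_real s - (\<i> * of_real A * c')\<^sup>2 = of_real (- \<kappa> / s) * (cnj c')\<^sup>2 + of_real ((s - \<kappa>) / s) * c'\<^sup>2" for c'
      unfolding mult.assoc power_mult_distrib[of \<i>] scaled_square sq \<kappa>' using s_pos by (simp add: field_simps)
    have z: "\<i> * of_real A * c' * (of_real y * cnj c') / (of_real x * cnj c') = \<i> * of_real Z * c'" if "c' \<noteq> 0" for c' :: complex
    proof -
      have "\<i> * of_real A * c' * (of_real y * cnj c') / (of_real x * cnj c') = \<i> * of_real (A * y) * c' / of_real x"
        using that by simp
      then show ?thesis using pos by (simp add: AyZx del: of_real_mult) (simp add: mult.commute)
    qed
    obtain L where L: "((\<lambda>B. integral {0..B} (ray_fun d \<tau> \<zeta>0 (- 2 * \<i>))) \<longlongrightarrow> L) at_top"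
      "of_real (klein_vol \<kappa> Q) * (of_real (sqrt 2) / (1 + \<i> * of_real (- 1))) ^ Suc d =
        of_real (sphere_area (Suc d) * sqrt s / sqrt (2 * pi)) * ((of_real y * cnj c0) / (of_real x * cnj c0) ^ Suc d) * L"
    proof (rule volume_formula_limit[OF Q, of "-1" "\<lambda>n. of_real x * cnj (c n)" "\<lambda>n. of_real y * cnj (c n)" "\<lambda>n. \<i> * of_real A * c n"
          "of_real x * cnj c0" "of_real y * cnj c0" "\<i> * of_real A * c0" \<zeta>0])
      show "(\<lambda>n. of_real x * cnj (c n)) \<longlonglongrightarrow> of_real x * cnj c0" "(\<lambda>n. of_real y * cnj (c n)) \<longlonglongrightarrow> of_real y * cnj c0"
        "(\<lambda>n. \<i> * of_real A * c n) \<longlonglongrightarrow> \<i> * of_real A * c0" by (intro tendsto_intros lc lc')+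
      show "s * (Re (\<i> * of_real A * c n * (of_real y * cnj (c n))))\<^sup>2 < Re ((of_real x * cnj (c n))\<^sup>2) * Re ((of_real y * cnj (c n))\<^sup>2)" for n
      proof -
        have "Re (\<i> * of_real A * c n * (of_real y * cnj (c n))) = 0" by (simp add: algebra_simps)
        then show ?thesis using \<epsilon>[of n] neg s_pos unfolding scaled_square sq \<kappa>' c2
          by (simp add: zero_less_mult_iff zero_less_divide_iff divide_less_0_iff mult_less_0_iff)
      qed
      show "0 \<le> Re ((of_real y * cnj (c n))\<^sup>2 - of_real s * (\<i> * of_real A * c n * (of_real y * cnj (c n)) / (of_real x * cnj (c n)))\<^sup>2)" for n
      proof -
        have "c n \<noteq> 0" using Rec[of n] by auto
        have "(of_real y * cnj (c n))\<^sup>2 - of_real s * (\<i> * of_real A * c n * (of_real y * cnj (c n)) / (of_real x * cnj (c n)))\<^sup>2 =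
          of_real (2 * - \<kappa> / s) * (cnj (c n))\<^sup>2 + of_real (s * (2 * (s - \<kappa>) / s\<^sup>2)) * (c n)\<^sup>2"
          unfolding z[OF \<open>c n \<noteq> 0\<close>] unfolding mult.assoc power_mult_distrib[of \<i>] scaled_square sq \<kappa>'
          using s_pos by (simp add: field_simps)
        then have "Re ((of_real y * cnj (c n))\<^sup>2 - of_real s * (\<i> * of_real A * c n * (of_real y * cnj (c n)) / (of_real x * cnj (c n)))\<^sup>2) =
          (2 * - \<kappa> / s) * \<epsilon> n + (s * (2 * (s - \<kappa>) / s\<^sup>2)) * \<epsilon> n"
          unfolding c2 by simp
        also have "\<dots> \<ge> 0" using \<epsilon>[of n] neg s_pos
          by (intro add_nonneg_nonneg mult_nonneg_nonneg divide_nonneg_nonneg) auto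
        finally show ?thesis .
      qed
      show "\<zeta>0 = \<i> * of_real A * c0 * (of_real y * cnj c0) / (of_real x * cnj c0)"
        unfolding z[OF c0n(1)] by (rule \<zeta>0_cases(2)[OF \<kappa>'(3)])
      show "(of_real y * cnj c0)\<^sup>2 - of_real s * \<zeta>0\<^sup>2 = - 2 * \<i>"
        unfolding \<zeta>02 scaled_square sq \<kappa>' c02 using s_pos by (simp add: field_simps power2_eq_square)
      show "(\<forall>n. \<i> * of_real A * c n = 0) \<or> Re \<zeta>0 > 0" using Re\<zeta>0 by (auto simp: A_def)
      show "Im ((of_real x * cnj (c n))\<^sup>2 / of_real s - (\<i> * of_real A * c n)\<^sup>2) = - 1" for n
        unfolding P c2 using s_pos by (simp add: field_simps)
      show "Re ((of_real x * cnj (c n))\<^sup>2 / of_real s - (\<i> * of_real A * c n)\<^sup>2) > 0" for n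
      proof -
        have "Re ((of_real x * cnj (c n))\<^sup>2 / of_real s - (\<i> * of_real A * c n)\<^sup>2) = - \<kappa> / s * \<epsilon> n + (s - \<kappa>) / s * \<epsilon> n"
          unfolding P c2 by simp
        also have "\<dots> > 0" using \<epsilon>[of n] neg s_pos by (intro add_pos_pos mult_pos_pos divide_pos_pos) auto
        finally show ?thesis .
      qed
      show "(of_real x * cnj c0)\<^sup>2 / of_real s - (\<i> * of_real A * c0)\<^sup>2 = \<i> * of_real (- 1)"
        unfolding P c02 using s_pos by (simp add: field_simps)
    qed (use pos Rec \<epsilon> \<kappa>' c0n nz s_pos neg in \<open>auto simp: scaled_square sq c2 c02 divide_neg_pos mult_neg_pos\<close>)
    have xk: "sqrt_plus \<kappa> = \<i> * of_real x" using neg by (simp add: sqrt_plus_def x_def)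
    \<comment> \<open>Now the volume limit contains c0, while k tends to x times its conjugate. The
      quotient - \<i> occurs to the power d + 1: d of these factors form 1 / sqrt \<kappa> ^ d
      together with x, and the last one turns 1 + \<i> into 1 - \<i>.\<close>
    have "c0 = - \<i> * cnj c0" by (simp add: c0_def right_diff_distrib diff_divide_distrib add_divide_distrib distrib_left)
    then have cc: "c0 / cnj c0 = - \<i>" using c0n(2) by (metis nonzero_divide_eq_eq)
    show ?thesis
    proof (rule that[OF L(1)[unfolded \<zeta>0_def]])
      have "of_real (klein_vol \<kappa> Q) = (of_real (klein_vol \<kappa> Q) * (1 / c0) ^ Suc d) * c0 ^ Suc d"
        using c0n by (simp add: power_divide)
      also have "\<dots> = of_real (sphere_area (Suc d) / sqrt (2 * pi)) * (of_real (sqrt s * y) * cnj c0 / of_real x ^ Suc d) * (c0 / cnj c0) ^ Suc d * L"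
        unfolding L(2)[unfolded \<sigma>c] using c0n pos by (simp add: power_mult_distrib power_divide)
      also have "of_real (sqrt s * y) * cnj c0 / of_real x ^ Suc d = (of_real (sqrt 2) * cnj c0) / of_real x ^ d"
        unfolding sy using pos by simp
      finally have "of_real (klein_vol \<kappa> Q) = of_real (sphere_area (Suc d) / sqrt (2 * pi)) * ((1 + \<i>) / of_real x ^ d) * (- \<i>) ^ Suc d * L"
        unfolding cs cc .
      also have "\<dots> = of_real (sphere_area (Suc d) / sqrt (2 * pi)) * ((- \<i>) ^ d / of_real x ^ d) * ((1 + \<i>) * (- \<i>) * L)"
        by simp
      also have "(- \<i>) ^ d / complex_of_real x ^ d = 1 / (\<i> * of_real x) ^ d"
      proof -
        have "- \<i> = 1 / \<i>" by simp
        then have "(- \<i>) ^ d = 1 / \<i> ^ d" by (metis power_one_over)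
        then show ?thesis by (simp add: power_mult_distrib)
      qed
      also have "(1 + \<i>) * (- \<i>) = 1 - \<i>" by (simp add: algebra_simps)
      finally show "of_real (klein_vol \<kappa> Q) = of_real (sphere_area (Suc d)) / sqrt_plus \<kappa> ^ d * (1 / of_real (sqrt (2 * pi))) * ((1 - \<i>) * L)"
        unfolding xk by (simp add: mult_ac)
    qed
  qed
qed

text \<open>On the ray x = (1 - \<i>) u one has x^2 = - 2 \<i> u^2, which explains the exponent, and
  the factor 1 - \<i> of the arguments is absorbed into \<zeta>.\<close>

lemma ray_integral_plus:
  assumes "((\<lambda>B. integral {0..B} (ray_fun d \<tau> (sqrt_plus (\<kappa> - s) * (1 - \<i>) / of_real s) (- 2 * \<i>))) \<longlongrightarrow> L) at_top"
  shows "ray_integral_conv (1 - \<i>) (orth_integrand sqrt_plus d \<tau> \<kappa>) ((1 - \<i>) * L)"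
proof -
  have eq: "orth_integrand sqrt_plus d \<tau> \<kappa> ((1 - \<i>) * of_real u) * (1 - \<i>) =
      (1 - \<i>) * ray_fun d \<tau> (sqrt_plus (\<kappa> - s) * (1 - \<i>) / of_real s) (- 2 * \<i>) u" for u
  proof -
    have 1: "of_real (\<tau> j / s) * sqrt_plus (\<kappa> - s) * ((1 - \<i>) * of_real u) =
       of_real (\<tau> j) * (sqrt_plus (\<kappa> - s) * (1 - \<i>) / of_real s) * of_real u" for j
      by (simp add: divide_inverse mult_ac)
    have "((1 - \<i>) * complex_of_real u)\<^sup>2 = - 2 * \<i> * (of_real u)\<^sup>2"
      by (simp add: power2_eq_square algebra_simps)
    then have 2: "- (((1 - \<i>) * complex_of_real u)\<^sup>2) / 2 = - (- 2 * \<i> * (of_real u)\<^sup>2 / 2)" by simp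
    show ?thesis unfolding orth_integrand_def ray_fun_def Let_def s_def[symmetric] minus_mult_left[symmetric] 1 2
      by (simp only: mult.commute)
  qed
  show ?thesis unfolding ray_integral_conv_def eq Henstock_Kurzweil_Integration.integral_mult_right
    by (rule tendsto_mult_left[OF assms])
qed

end

section \<open>Complex conjugation and the second formula\<close>

lemma sqrt_minus_eq_cnj: "sqrt_minus r = cnj (sqrt_plus r)"
  by (simp add: sqrt_minus_def sqrt_plus_def)

lemma orth_integrand_cnj:
  "orth_integrand sqrt_minus d \<tau> \<kappa> (cnj x) = cnj (orth_integrand sqrt_plus d \<tau> \<kappa> x)"
  unfolding orth_integrand_def Let_def sqrt_minus_eq_cnj
  by (simp only: complex_cnj_mult complex_cnj_add cnj_prod Phi_cnj[symmetric] exp_cnj complex_cnj_minus complex_cnj_power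
    complex_cnj_divide complex_cnj_complex_of_real complex_cnj_numeral)

lemma ray_integral_conv_cnj:
  assumes "ray_integral_conv (1 - \<i>) (orth_integrand sqrt_plus d \<tau> \<kappa>) L"
  shows "ray_integral_conv (1 + \<i>) (orth_integrand sqrt_minus d \<tau> \<kappa>) (cnj L)"
proof -
  have eq: "orth_integrand sqrt_minus d \<tau> \<kappa> ((1 + \<i>) * of_real y) * (1 + \<i>) =
      cnj (orth_integrand sqrt_plus d \<tau> \<kappa> ((1 - \<i>) * of_real y) * (1 - \<i>))" for y
    using orth_integrand_cnj[of d \<tau> \<kappa> "(1 - \<i>) * of_real y"] by simp
  show ?thesis using tendsto_cnj[OF assms[unfolded ray_integral_conv_def]]
    unfolding ray_integral_conv_def eq Henstock_Kurzweil_Integration.integral_cnj .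
qed

theorem mainTheorem1:
  fixes d :: nat and \<tau> :: "nat \<Rightarrow> real" and v :: "nat \<Rightarrow> real ^ 'n" and \<kappa> :: real
  assumes "d = CARD('n)" and "d \<ge> 2"
    and "\<And>j. j \<le> d \<Longrightarrow> \<tau> j > 0"
    and "orthocentric d \<tau> v"
    and "\<kappa> \<noteq> 0"
    and "convex hull (v ` {0..d}) \<subseteq> klein_cball \<kappa>"
  shows "set_integrable lborel (convex hull (v ` {0..d})) (klein_density \<kappa>)
    \<and> (\<exists>L. ray_integral_conv (1 - \<i>) (orth_integrand sqrt_plus d \<tau> \<kappa>) L \<and>
          complex_of_real (klein_vol \<kappa> (convex hull (v ` {0..d}))) =
            complex_of_real (sphere_area (d + 1)) / (sqrt_plus \<kappa>) ^ d *
            (1 / complex_of_real (sqrt (2 * pi))) * L)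
    \<and> (\<exists>L. ray_integral_conv (1 + \<i>) (orth_integrand sqrt_minus d \<tau> \<kappa>) L \<and>
          complex_of_real (klein_vol \<kappa> (convex hull (v ` {0..d}))) =
            complex_of_real (sphere_area (d + 1)) / (sqrt_minus \<kappa>) ^ d *
            (1 / complex_of_real (sqrt (2 * pi))) * L)"
proof -
  have "card (UNIV :: 'n set) = card {1..d}" using assms(1) by simp
  from finite_same_card_bij[OF finite finite_atLeastAtMost this]
  obtain idx :: "'n \<Rightarrow> nat" where idx: "bij_betw idx UNIV {1..d}" by blast
  interpret orthocentric_simplex d \<tau> v idx
    by unfold_locales (use assms idx in auto)
  have Q: "Q \<subseteq> klein_cball \<kappa>" using assms(6) by (simp add: Q_def)
  obtain L where L: "((\<lambda>B. integral {0..B} (ray_fun d \<tau> (sqrt_plus (\<kappa> - s) * (1 - \<i>) / of_real s) (- 2 * \<i>))) \<longlongrightarrow> L) at_top"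
    "of_real (klein_vol \<kappa> Q) = of_real (sphere_area (Suc d)) / sqrt_plus \<kappa> ^ d * (1 / of_real (sqrt (2 * pi))) * ((1 - \<i>) * L)"
    by (rule ray_volume_plus[OF Q assms(5)])
  have conv: "ray_integral_conv (1 - \<i>) (orth_integrand sqrt_plus d \<tau> \<kappa>) ((1 - \<i>) * L)"
    by (rule ray_integral_plus[OF L(1)])
  \<comment> \<open>The volume is real, so conjugating the first formula changes its right side
    only.\<close>
  have "cnj (of_real (klein_vol \<kappa> Q)) = of_real (sphere_area (Suc d)) / sqrt_minus \<kappa> ^ d * (1 / of_real (sqrt (2 * pi))) * cnj ((1 - \<i>) * L)"
    unfolding L(2) sqrt_minus_eq_cnj by simp
  then have vol_minus: "of_real (klein_vol \<kappa> Q) = of_real (sphere_area (Suc d)) / sqrt_minus \<kappa> ^ d * (1 / of_real (sqrt (2 * pi))) * cnj ((1 - \<i>) * L)"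
    by simp
  show ?thesis
    unfolding Q_def[symmetric] Suc_eq_plus1[symmetric]
  proof (intro conjI)
    show "set_integrable lborel Q (klein_density \<kappa>)"
      unfolding set_integrable_def by (rule klein_density_integrable[OF Q])
    show "\<exists>L. ray_integral_conv (1 - \<i>) (orth_integrand sqrt_plus d \<tau> \<kappa>) L \<and>
      of_real (klein_vol \<kappa> Q) = of_real (sphere_area (Suc d)) / sqrt_plus \<kappa> ^ d * (1 / of_real (sqrt (2 * pi))) * L"
      using conv L(2) by blast
    show "\<exists>L. ray_integral_conv (1 + \<i>) (orth_integrand sqrt_minus d \<tau> \<kappa>) L \<and>
      of_real (klein_vol \<kappa> Q) = of_real (sphere_area (Suc d)) / sqrt_minus \<kappa> ^ d * (1 / of_real (sqrt (2 * pi))) * L"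
      using ray_integral_conv_cnj[OF conv] vol_minus by blast
  qed
qed

end
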